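(* For every positive integer $n$ the following four identities hold. (1) \begin{align*} W_{1,42}(n) ={}& \tfrac{1}{6000}\sigma_3(n)+\tfrac{1}{1500}\sigma_3(\tfrac n2)+\tfrac{3}{2000}\sigma_3(\tfrac n3)+\tfrac{3}{500}\sigma_3(\tfrac n6)+\tfrac{49}{6000}\sigma_3(\tfrac n7)+\tfrac{49}{1500}\sigma_3(\tfrac n{14})+\tfrac{147}{2000}\sigma_3(\tfrac n{21})+\tfrac{147}{500}\sigma_3(\tfrac n{42})\\ &+\left(\tfrac1{24}-\tfrac n{168}\right)\sigma(n)+\left(\tfrac1{24}-\tfrac n4\right)\sigma(\tfrac n{42})\\ &-\tfrac1{35}c_1(n)-\tfrac{57}{2800}c_2(n)-\tfrac1{140}c_4(n)-\tfrac1{6000}c_5(n)+\tfrac{49}{40}c_6(n)-\tfrac{883}{200}c_7(n)+\tfrac{2051}{6000}c_8(n)+\tfrac{17}{120}c_9(n)-\tfrac{97}{50}c_{10}(n)\\ &+\tfrac{543}{40}c_{11}(n)-\tfrac{127}{150}c_{12}(n)+\tfrac{31}{60}c_{13}(n)-\tfrac{27}{10}c_{14}(n)-\tfrac15c_{15}(n)+\tfrac{43}{20}c_{16}(n)-\tfrac9{10}c_{18}(n)-\tfrac9{400}c_{19}(n)-\tfrac3{20}c_{20}(n). \end{align*} (2) \begin{align*} W_{2,21}(n) ={}& \tfrac{1}{6000}\sigma_3(n)+\tfrac{1}{1500}\sigma_3(\tfrac n2)+\tfrac{3}{2000}\sigma_3(\tfrac n3)+\tfrac{3}{500}\sigma_3(\tfrac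 n6)+\tfrac{49}{6000}\sigma_3(\tfrac n7)+\tfrac{49}{1500}\sigma_3(\tfrac n{14})+\tfrac{147}{2000}\sigma_3(\tfrac n{21})+\tfrac{147}{500}\sigma_3(\tfrac n{42})\\ &+\left(\tfrac1{24}-\tfrac n{84}\right)\sigma(\tfrac n2)+\left(\tfrac1{24}-\tfrac n8\right)\sigma(\tfrac n{21})\\ &-\tfrac1{70}c_1(n)-\tfrac{57}{2800}c_2(n)-\tfrac1{28}c_3(n)+\tfrac1{70}c_4(n)-\tfrac1{6000}c_5(n)+\tfrac{13}{8}c_6(n)-\tfrac{703}{200}c_7(n)-\tfrac{4249}{6000}c_8(n)+\tfrac{41}{120}c_9(n)-\tfrac{97}{50}c_{10}(n)\\ &+\tfrac{379}{40}c_{11}(n)-\tfrac{61}{75}c_{12}(n)+\tfrac{11}{20}c_{13}(n)-\tfrac{18}{5}c_{14}(n)-\tfrac1{10}c_{15}(n)+\tfrac{39}{20}c_{16}(n)+\tfrac3{10}c_{18}(n)-\tfrac9{400}c_{19}(n)-\tfrac9{20}c_{20}(n). \end{align*} (3) \begin{align*} W_{3,14}(n) ={}& \tfrac{1}{6000}\sigma_3(n)+\tfrac{1}{1500}\sigma_3(\tfrac n2)+\tfrac{3}{2000}\sigma_3(\tfrac n3)+\tfrac{3}{500}\sigma_3(\tfrac n6)+\tfrac{49}{6000}\sigma_3(\tfrac n7)+\tfrac{49}{1500}\sigma_3(\tfrac n{14})+\tfrac{147}{2000}\sigma_3(\tfrac n{21})+\tfrac{147}{500}\sigma_3(\tfrac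 n{42})\\ &+\left(\tfrac1{24}-\tfrac n{56}\right)\sigma(\tfrac n3)+\left(\tfrac1{24}-\tfrac n{12}\right)\sigma(\tfrac n{14})\\ &+\tfrac1{35}c_1(n)-\tfrac{1}{400}c_2(n)-\tfrac1{35}c_4(n)-\tfrac1{6000}c_5(n)-\tfrac{37}{40}c_6(n)+\tfrac{837}{200}c_7(n)-\tfrac{2149}{6000}c_8(n)-\tfrac{17}{120}c_9(n)+\tfrac{103}{50}c_{10}(n)\\ &-\tfrac{543}{40}c_{11}(n)+\tfrac{87}{100}c_{12}(n)-\tfrac{31}{60}c_{13}(n)+\tfrac{27}{10}c_{14}(n)+\tfrac15c_{15}(n)-\tfrac{43}{20}c_{16}(n)-\tfrac9{28}c_{17}(n)+\tfrac9{10}c_{18}(n)-\tfrac{513}{2800}c_{19}(n)+\tfrac3{20}c_{20}(n). \end{align*} (4) \begin{align*} W_{6,7}(n) ={}& \tfrac{1}{6000}\sigma_3(n)+\tfrac{1}{1500}\sigma_3(\tfrac n2)+\tfrac{3}{2000}\sigma_3(\tfrac n3)+\tfrac{3}{500}\sigma_3(\tfrac n6)+\tfrac{49}{6000}\sigma_3(\tfrac n7)+\tfrac{49}{1500}\sigma_3(\tfrac n{14})+\tfrac{147}{2000}\sigma_3(\tfrac n{21})+\tfrac{147}{500}\sigma_3(\tfrac n{42})\\ &+\left(\tfrac1{24}-\tfrac n{28}\right)\sigma(\tfrac n6)+\left(\tfrac1{24}-\tfrac n{24}\right)\sigma(\tfrac n7)\\ &+\tfrac1{70}c_1(n)-\tfrac{407}{2800}c_2(n)+\tfrac1{28}c_3(n)+\tfrac3{140}c_4(n)-\tfrac{1507}{42000}c_5(n)-\tfrac{53}{40}c_6(n)+\tfrac{6899}{1400}c_7(n)-\tfrac{6349}{6000}c_8(n)-\tfrac{41}{120}c_9(n)+\tfrac{221}{350}c_{10}(n)\\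 &-\tfrac{379}{40}c_{11}(n)+\tfrac{969}{700}c_{12}(n)-\tfrac{11}{20}c_{13}(n)+\tfrac{18}{5}c_{14}(n)+\tfrac1{10}c_{15}(n)-\tfrac{39}{20}c_{16}(n)+\tfrac9{28}c_{17}(n)-\tfrac3{10}c_{18}(n)-\tfrac{4113}{2800}c_{19}(n)+\tfrac9{20}c_{20}(n). \end{align*}
   Context: $\mathbb N$ is the set of positive integers and $\mathbb N_0=\mathbb N\cup\{0\}$. For $k\in\mathbb N$ and $n\in\mathbb Q$, $\sigma_k(n)=\sum_{d\in\mathbb N,\,d\mid n}d^k$ if $n\in\mathbb N$, and $\sigma_k(n)=0$ if $n\notin\mathbb N$ (in particular $\sigma_k(0)=0$); $\sigma(n)$ means $\sigma_1(n)$. For $r,s\in\mathbb N$ with $r\le s$, $$W_{r,s}(n)=\sum_{(l,m)\in\mathbb N_0^2,\ rl+sm=n}\sigma(l)\sigma(m).$$ For $z$ in the upper half plane put $q=e^{2\pi i z}$ and let $\eta(z)=e^{\pi i z/12}\prod_{n\ge1}(1-e^{2\pi i n z})$ be the Dedekind eta function. Write $\eta_\delta=\eta(\delta z)$. Define the eta quotients $C_1=\frac{\eta_1^5\eta_7^5}{\eta_2\eta_{14}}$, $C_2=\eta_1^2\eta_2^2\eta_7^2\eta_{14}^2$, $C_3=\frac{\eta_1^6\eta_{14}^6}{\eta_2^2\eta_7^2}$, $C_4=\frac{\eta_2^6\eta_7^6}{\eta_1^2\eta_{14}^2}$, $C_5=\eta_1^2\eta_2^2\eta_3^2\eta_6^2$,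 $C_6=\eta_2\eta_3^3\eta_7\eta_{42}^3$, $C_7=\eta_1\eta_6^3\eta_{14}\eta_{21}^3$, $C_8=\eta_7^2\eta_{14}^2\eta_{21}^2\eta_{42}^2$, $C_9=\eta_3\eta_6\eta_7^3\eta_{14}^3$, $C_{10}=\eta_2^2\eta_6^2\eta_7^2\eta_{21}^2$, $C_{11}=\eta_1\eta_2\eta_{21}^3\eta_{42}^3$, $C_{12}=\eta_1^3\eta_6\eta_{14}^3\eta_{21}$, $C_{13}=\eta_1^3\eta_2^3\eta_{21}\eta_{42}$, $C_{14}=\frac{\eta_2^2\eta_{14}^2\eta_{21}^6}{\eta_7^2}$, $C_{15}=\frac{\eta_2^6\eta_3^2\eta_{21}^2}{\eta_6^2}$, $C_{16}=\frac{\eta_2^5\eta_{21}^5}{\eta_1\eta_{42}}$, $C_{17}=\frac{\eta_6^6\eta_{21}^6}{\eta_3^2\eta_{42}^2}$, $C_{18}=\frac{\eta_6^3\eta_7\eta_{14}\eta_{21}^4}{\eta_3}$, $C_{19}=\eta_3^2\eta_6^2\eta_{21}^2\eta_{42}^2$, $C_{20}=\frac{\eta_3^4\eta_{14}^4\eta_{21}^2\eta_{42}^2}{\eta_6^2\eta_7^2}$. For $1\le k\le 20$ the integers $c_k(n)$ ($n\in\mathbb N$) are defined by the $q$-expansion $C_k(q)=\sum_{n=1}^\infty c_k(n)q^n$. *)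

theory Defs
  imports "HOL-Complex_Analysis.Complex_Analysis"
begin

definition divisor_sigma :: "nat \<Rightarrow> rat \<Rightarrow> nat" where
  "divisor_sigma k x =
     (if x \<in> \<int> \<and> x > 0 then (\<Sum>d | d dvd nat \<lfloor>x\<rfloor>. d ^ k) else 0)"

text \<open>For positive \<open>r\<close> and \<open>s\<close>, the index set of the sum is finite.\<close>
definition conv_W :: "nat \<Rightarrow> nat \<Rightarrow> nat \<Rightarrow> nat" where
  "conv_W r s n =
     (\<Sum>(l, m) \<in> {(l, m). r * l + s * m = n}.
        divisor_sigma 1 (rat_of_nat l) * divisor_sigma 1 (rat_of_nat m))"

definition dedekind_eta :: "complex \<Rightarrow> complex" where
  "dedekind_eta z =
     exp (of_real pi * \<i> * z / 12) * (\<Prod>n. 1 - exp (2 * of_real pi * \<i> * of_nat (Suc n) * z))"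

text \<open>The \<open>k\<close>-th eta quotient, for \<open>1 \<le> k \<le> 20\<close>; list positions start at \<open>0\<close>.\<close>
definition eta_quotient :: "nat \<Rightarrow> complex \<Rightarrow> complex" where
  "eta_quotient k z = (let e = (\<lambda>d::nat. dedekind_eta (of_nat d * z)) in
      [e 1 ^ 5 * e 7 ^ 5 / (e 2 * e 14),
       e 1 ^ 2 * e 2 ^ 2 * e 7 ^ 2 * e 14 ^ 2,
       e 1 ^ 6 * e 14 ^ 6 / (e 2 ^ 2 * e 7 ^ 2),
       e 2 ^ 6 * e 7 ^ 6 / (e 1 ^ 2 * e 14 ^ 2),
       e 1 ^ 2 * e 2 ^ 2 * e 3 ^ 2 * e 6 ^ 2,
       e 2 * e 3 ^ 3 * e 7 * e 42 ^ 3,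
       e 1 * e 6 ^ 3 * e 14 * e 21 ^ 3,
       e 7 ^ 2 * e 14 ^ 2 * e 21 ^ 2 * e 42 ^ 2,
       e 3 * e 6 * e 7 ^ 3 * e 14 ^ 3,
       e 2 ^ 2 * e 6 ^ 2 * e 7 ^ 2 * e 21 ^ 2,
       e 1 * e 2 * e 21 ^ 3 * e 42 ^ 3,
       e 1 ^ 3 * e 6 * e 14 ^ 3 * e 21,
       e 1 ^ 3 * e 2 ^ 3 * e 21 * e 42,
       e 2 ^ 2 * e 14 ^ 2 * e 21 ^ 6 / e 7 ^ 2,
       e 2 ^ 6 * e 3 ^ 2 * e 21 ^ 2 / e 6 ^ 2,
       e 2 ^ 5 * e 21 ^ 5 / (e 1 * e 42),
       e 6 ^ 6 * e 21 ^ 6 / (e 3 ^ 2 * e 42 ^ 2),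
       e 6 ^ 3 * e 7 * e 14 * e 21 ^ 4 / e 3,
       e 3 ^ 2 * e 6 ^ 2 * e 21 ^ 2 * e 42 ^ 2,
       e 3 ^ 4 * e 14 ^ 4 * e 21 ^ 2 * e 42 ^ 2 / (e 6 ^ 2 * e 7 ^ 2)] ! (k - 1))"

text \<open>The series effectively starts at \<open>n = 1\<close>, since \<open>a 0 = 0\<close>.\<close>
definition has_q_expansion :: "(complex \<Rightarrow> complex) \<Rightarrow> (nat \<Rightarrow> int) \<Rightarrow> bool" where
  "has_q_expansion f a \<longleftrightarrow>
     a 0 = 0 \<and>
     (\<forall>z. Im z > 0 \<longrightarrow> (\<lambda>n. of_int (a n) * exp (2 * of_real pi * \<i> * z) ^ n) sums f z)"

definition eta_coeff :: "nat \<Rightarrow> nat \<Rightarrow> int" where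
  "eta_coeff k = (THE a. has_q_expansion (eta_quotient k) a)"

lemma has_q_expansion_unique:
  assumes "has_q_expansion f a" "has_q_expansion f b"
  shows "a = b"
proof -
  define A B where "A = Abs_fps (\<lambda>n. complex_of_int (a n))"
    and "B = Abs_fps (\<lambda>n. complex_of_int (b n))"
  have *: "(\<lambda>n. of_int (a n) * q ^ n) sums f (Ln q / (2 * of_real pi * \<i>)) \<and>
           (\<lambda>n. of_int (b n) * q ^ n) sums f (Ln q / (2 * of_real pi * \<i>))"
    if q: "norm q < 1" "q \<noteq> 0" for q :: complex
  proof -
    define z where "z = Ln q / (2 * of_real pi * \<i>)"
    have e: "exp (2 * of_real pi * \<i> * z) = q"
      using q by (simp add: z_def)
    have "norm q = exp (- 2 * pi * Im z)"
      by (subst e[symmetric]) simp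
    hence "Im z > 0"
      using q(1) by (simp add: zero_less_mult_iff)
    with assms e show ?thesis
      unfolding has_q_expansion_def z_def by metis
  qed
  have s: "(\<lambda>n. complex_of_int (a n - b n) * q ^ n) sums 0"
    if "norm q < 1" for q :: complex
  proof (cases "q = 0")
    case True
    thus ?thesis using assms by (simp add: has_q_expansion_def)
  next
    case False
    from sums_diff[OF *[THEN conjunct1, OF that False] *[THEN conjunct2, OF that False]]
    show ?thesis by (simp add: algebra_simps)
  qed
  have "complex_of_int (a n - b n) = 0" for n
  proof (rule ccontr)
    assume n: "complex_of_int (a n - b n) \<noteq> 0"
    hence "n > 0" using assms by (cases n) (auto simp: has_q_expansion_def)
    show False
    proof (rule powser_0_nonzero[of 1 "0::complex" "\<lambda>n. complex_of_int (a n - b n)" "\<lambda>_. 0" n])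
      fix r :: real
      assume "0 < r" and r: "\<And>z. z \<in> cball (0::complex) r - {0} \<Longrightarrow> (0::complex) \<noteq> 0"
      thus False using r[of "of_real r"] by auto
    qed (use s n \<open>n > 0\<close> in auto)
  qed
  thus ?thesis by (intro ext) simp
qed

definition int_power_series :: "(complex \<Rightarrow> complex) \<Rightarrow> bool" where
  "int_power_series g \<longleftrightarrow>
     g holomorphic_on ball 0 1 \<and> (\<forall>n. fps_nth (fps_expansion g 0) n \<in> \<int>)"

lemma int_power_seriesI:
  assumes "g holomorphic_on ball 0 1" "g has_fps_expansion F" "\<And>n. fps_nth F n \<in> \<int>"
  shows "int_power_series g"
  using assms fps_expansion_eqI[OF assms(2)] by (simp add: int_power_series_def)

lemma int_power_series_has_fps_expansion:
  "int_power_series g \<Longrightarrow> g has_fps_expansion fps_expansion g 0"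
  unfolding int_power_series_def by (rule has_fps_expansion_fps_expansion[of "ball 0 1"]) auto

lemma int_power_series_const: "c \<in> \<int> \<Longrightarrow> int_power_series (\<lambda>_. c)"
  by (rule int_power_seriesI[of _ "fps_const c"]) auto

lemma int_power_series_monom: "int_power_series (\<lambda>q. q ^ n)"
  by (rule int_power_seriesI[of _ "fps_X ^ n"])
     (auto intro!: holomorphic_intros has_fps_expansion_fps_X_power simp: fps_X_power_nth)

lemma int_power_series_diff:
  assumes "int_power_series f" "int_power_series g"
  shows "int_power_series (\<lambda>q. f q - g q)"
  by (rule int_power_seriesI[OF _ has_fps_expansion_diff[OF assms[THEN int_power_series_has_fps_expansion]]])
     (use assms in \<open>auto simp: int_power_series_def intro!: holomorphic_intros\<close>)

lemma int_power_series_mult: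
  assumes "int_power_series f" "int_power_series g"
  shows "int_power_series (\<lambda>q. f q * g q)"
  by (rule int_power_seriesI[OF _ has_fps_expansion_mult[OF assms[THEN int_power_series_has_fps_expansion]]])
     (use assms in \<open>auto simp: int_power_series_def fps_mult_nth intro!: holomorphic_intros Ints_sum Ints_mult\<close>)

lemma int_power_series_power:
  "int_power_series f \<Longrightarrow> int_power_series (\<lambda>q. f q ^ n)"
  by (induction n) (auto intro: int_power_series_mult int_power_series_const)

lemma int_power_series_prod:
  "(\<And>i. i \<in> A \<Longrightarrow> int_power_series (f i)) \<Longrightarrow> int_power_series (\<lambda>q. \<Prod>i\<in>A. f i q)"
  by (induction A rule: infinite_finite_induct)
     (auto intro: int_power_series_mult int_power_series_const)

lemma int_power_series_inverse:
  assumes g: "int_power_series g" and nz: "\<And>q. norm q < 1 \<Longrightarrow> g q \<noteq> 0" and g0: "g 0 = 1"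
  shows "int_power_series (\<lambda>q. inverse (g q))"
proof -
  define F where "F = fps_expansion g 0"
  have F: "g has_fps_expansion F" and FZ: "\<And>n. fps_nth F n \<in> \<int>"
    using g int_power_series_has_fps_expansion[OF g] by (auto simp: F_def int_power_series_def)
  have F0: "fps_nth F 0 = 1"
    using has_fps_expansion_imp_0_eq_fps_nth_0[OF F] g0 by simp
  show ?thesis
  proof (rule int_power_seriesI[OF _ has_fps_expansion_inverse[OF F]])
    show "(\<lambda>q. inverse (g q)) holomorphic_on ball 0 1"
      using g nz by (auto simp: int_power_series_def intro!: holomorphic_intros)
    show "fps_nth F 0 \<noteq> 0" using F0 by simp
    show "fps_nth (inverse F) n \<in> \<int>" for n
    proof (induction n rule: less_induct)
      case (less n)
      show ?case
      proof (cases "n = 0")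
        case False
        have "fps_nth (inverse F) n = - (\<Sum>i=1..n. fps_nth F i * fps_nth (inverse F) (n - i))"
          using False F0 by (cases n) (simp_all add: fps_inverse_def)
        thus ?thesis
          using less FZ by (auto intro!: Ints_minus Ints_sum Ints_mult)
      qed (simp add: F0)
    qed
  qed
qed

lemma int_power_series_limit:
  assumes "\<And>N. int_power_series (f N)"
    and lim: "\<And>r. 0 < r \<Longrightarrow> r < 1 \<Longrightarrow> uniform_limit (cball 0 r) f g sequentially"
  shows "int_power_series g"
proof -
  have holo: "f N holomorphic_on ball 0 1" for N
    using assms(1) by (simp add: int_power_series_def)
  have "g holomorphic_on ball 0 1"
  proof (rule holomorphic_uniform_sequence)
    fix x :: complex assume x: "x \<in> ball 0 1"
    define d where "d = (1 - norm x) / 2"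
    have d: "d > 0" "norm x + d < 1" using x by (auto simp: d_def field_simps)
    have sub: "cball x d \<subseteq> cball 0 (norm x + d)"
    proof
      fix y assume "y \<in> cball x d"
      thus "y \<in> cball 0 (norm x + d)"
        using norm_triangle_ineq[of x "y - x"] by (simp add: dist_norm norm_minus_commute)
    qed
    have "uniform_limit (cball x d) f g sequentially"
      by (rule uniform_limit_on_subset[OF lim sub]) (use d in \<open>auto intro: add_nonneg_pos\<close>)
    with d sub show "\<exists>d>0. cball x d \<subseteq> ball 0 1 \<and> uniform_limit (cball x d) f g sequentially"
      by (intro exI[of _ d]) fastforce
  qed (use holo in auto)
  moreover have "fps_nth (fps_expansion g 0) n \<in> \<int>" for n
  proof (rule Lim_in_closed_set[of \<int>])
    have "uniform_limit (ball 0 (1/2)) f g sequentially"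
      by (rule uniform_limit_on_subset[OF lim[of "1/2"]]) auto
    hence "(\<lambda>N. (deriv ^^ n) (f N) 0) \<longlonglongrightarrow> (deriv ^^ n) g 0"
      by (rule higher_deriv_complex_uniform_limit)
         (auto intro!: always_eventually holomorphic_on_subset[OF holo])
    thus "(\<lambda>N. fps_nth (fps_expansion (f N) 0) n) \<longlonglongrightarrow> fps_nth (fps_expansion g 0) n"
      unfolding fps_expansion_def by (auto intro!: tendsto_intros)
    show "\<forall>\<^sub>F N in sequentially. fps_nth (fps_expansion (f N) 0) n \<in> \<int>"
      using assms(1) by (simp add: int_power_series_def)
  qed auto
  ultimately show ?thesis by (simp add: int_power_series_def)
qed

definition euler_prod :: "nat \<Rightarrow> complex \<Rightarrow> complex" where
  "euler_prod d q = (\<Prod>n. 1 - q ^ (d * Suc n))"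

lemma euler_prod_convergent:
  fixes q :: complex
  assumes "d > 0" "norm q < 1"
  shows "convergent_prod (\<lambda>n. 1 - q ^ (d * Suc n))"
proof -
  have "norm q ^ d < 1" using assms by (simp add: power_less_one_iff)
  hence "summable (\<lambda>n. (norm q ^ d) * (norm q ^ d) ^ n)"
    by (intro summable_mult summable_geometric) simp
  hence "summable (\<lambda>n. norm ((1 - q ^ (d * Suc n)) - 1))"
    by (simp add: norm_power norm_mult power_mult power_add)
  thus ?thesis
    by (intro abs_convergent_prod_imp_convergent_prod summable_imp_abs_convergent_prod)
qed

lemma euler_prod_nonzero:
  assumes "d > 0" "norm q < 1"
  shows "euler_prod d q \<noteq> 0"
  unfolding euler_prod_def
proof (rule prodinf_nonzero[OF euler_prod_convergent[OF assms]])
  fix n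
  have "norm (q ^ (d * Suc n)) < 1"
    unfolding norm_power using assms by (subst power_less_one_iff) auto
  thus "1 - q ^ (d * Suc n) \<noteq> 0" by auto
qed

lemma euler_prod_0: "d > 0 \<Longrightarrow> euler_prod d 0 = 1"
  by (simp add: euler_prod_def power_0_left)

lemma int_power_series_euler_prod:
  assumes d: "d > 0"
  shows "int_power_series (euler_prod d)"
proof (rule int_power_series_limit)
  show "int_power_series (\<lambda>q. \<Prod>n<N. 1 - q ^ (d * Suc n))" for N
    by (intro int_power_series_prod int_power_series_diff int_power_series_const
              int_power_series_monom) auto
  fix r :: real assume r: "0 < r" "r < 1"
  have "uniformly_convergent_on (cball 0 r) (\<lambda>N q. \<Prod>n<N. 1 - q ^ (d * Suc n) :: complex)"
  proof (rule uniformly_convergent_on_prod')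
    have rd: "r ^ d < 1" using r d by (simp add: power_less_one_iff)
    show "uniformly_convergent_on (cball 0 r)
            (\<lambda>N q. \<Sum>n<N. norm (1 - q ^ (d * Suc n) - 1 :: complex))"
    proof (rule Weierstrass_m_test')
      show "summable (\<lambda>n. r ^ d * (r ^ d) ^ n)"
        using rd r by (intro summable_mult summable_geometric) simp
      fix n and q :: complex assume "q \<in> cball 0 r"
      hence "norm q ^ (d * Suc n) \<le> r ^ (d * Suc n)" by (intro power_mono) auto
      thus "norm (norm (1 - q ^ (d * Suc n) - 1)) \<le> r ^ d * (r ^ d) ^ n"
        by (simp add: norm_power norm_mult power_mult power_add)
    qed
  qed (auto intro!: continuous_intros)
  then obtain h where h: "uniform_limit (cball 0 r)
      (\<lambda>N q. \<Prod>n<N. 1 - q ^ (d * Suc n) :: complex) h sequentially"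
    by (auto simp: uniformly_convergent_on_def)
  have "h q = euler_prod d q" if q: "q \<in> cball 0 r" for q
  proof (rule LIMSEQ_unique)
    show "(\<lambda>N. \<Prod>n<N. 1 - q ^ (d * Suc n)) \<longlonglongrightarrow> h q"
      using h q by (rule tendsto_uniform_limitI)
    show "(\<lambda>N. \<Prod>n<N. 1 - q ^ (d * Suc n)) \<longlonglongrightarrow> euler_prod d q"
      unfolding euler_prod_def
      by (rule has_prod_imp_tendsto', rule convergent_prod_has_prod, rule euler_prod_convergent)
         (use q r d in auto)
  qed
  thus "uniform_limit (cball 0 r) (\<lambda>N q. \<Prod>n<N. 1 - q ^ (d * Suc n)) (euler_prod d) sequentially"
    using h by (subst uniform_limit_cong'[where g = "\<lambda>N q. \<Prod>n<N. 1 - q ^ (d * Suc n)" and i = h]) auto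
qed

lemma dedekind_eta_conv_euler_prod:
  "dedekind_eta (of_nat d * z) =
     exp (of_real pi * \<i> * z / 12) ^ d * euler_prod d (exp (2 * of_real pi * \<i> * z))"
proof -
  have 1: "exp (of_real pi * \<i> * (of_nat d * z) / 12) = exp (of_real pi * \<i> * z / 12) ^ d"
    unfolding exp_of_nat_mult[symmetric] by (simp add: mult_ac)
  have 2: "exp (2 * of_real pi * \<i> * of_nat (Suc n) * (of_nat d * z)) =
        exp (2 * of_real pi * \<i> * z) ^ (d * Suc n)" for n
    unfolding exp_of_nat_mult[symmetric] of_nat_mult by (simp only: mult_ac)
  show ?thesis
    unfolding dedekind_eta_def euler_prod_def 1 2 ..
qed

definition eta_arg :: "complex \<Rightarrow> complex" where
  "eta_arg z = of_real pi * \<i> * z / 12"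

definition eta_like :: "int \<Rightarrow> (complex \<Rightarrow> complex) \<Rightarrow> bool" where
  "eta_like m f \<longleftrightarrow> (\<exists>g. int_power_series g \<and> g 0 = 1 \<and> (\<forall>q. norm q < 1 \<longrightarrow> g q \<noteq> 0) \<and>
     (\<forall>z. Im z > 0 \<longrightarrow> f z = exp (of_int m * eta_arg z) * g (exp (2 * of_real pi * \<i> * z))))"

lemma eta_like_eta:
  assumes "d > 0"
  shows "eta_like (int d) (\<lambda>z. dedekind_eta (of_nat d * z))"
  unfolding eta_like_def dedekind_eta_conv_euler_prod eta_arg_def[symmetric]
  by (intro exI[of _ "euler_prod d"])
     (use assms int_power_series_euler_prod euler_prod_nonzero euler_prod_0 in
       \<open>auto simp: exp_of_nat_mult\<close>)

lemma eta_like_eta_1: "eta_like 1 dedekind_eta"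
  using eta_like_eta[of 1] by simp

lemma eta_like_eta_numeral:
  "eta_like (numeral d) (\<lambda>z. dedekind_eta (numeral d * z))"
  using eta_like_eta[of "numeral d"] by simp

lemma eta_like_mult:
  assumes "eta_like a f" "eta_like b h"
  shows "eta_like (a + b) (\<lambda>z. f z * h z)"
proof -
  from assms obtain F H where "int_power_series F" "int_power_series H" "F 0 = 1" "H 0 = 1"
    "\<forall>q. norm q < 1 \<longrightarrow> F q \<noteq> 0" "\<forall>q. norm q < 1 \<longrightarrow> H q \<noteq> 0"
    "\<forall>z. Im z > 0 \<longrightarrow> f z = exp (of_int a * eta_arg z) * F (exp (2 * of_real pi * \<i> * z))"
    "\<forall>z. Im z > 0 \<longrightarrow> h z = exp (of_int b * eta_arg z) * H (exp (2 * of_real pi * \<i> * z))"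
    unfolding eta_like_def by blast
  thus ?thesis
    unfolding eta_like_def
    by (intro exI[of _ "\<lambda>q. F q * H q"]) (auto intro: int_power_series_mult simp: exp_add ring_distribs)
qed

lemma eta_like_inverse:
  assumes "eta_like a f"
  shows "eta_like (- a) (\<lambda>z. inverse (f z))"
proof -
  from assms obtain F where "int_power_series F" "F 0 = 1" "\<forall>q. norm q < 1 \<longrightarrow> F q \<noteq> 0"
    "\<forall>z. Im z > 0 \<longrightarrow> f z = exp (of_int a * eta_arg z) * F (exp (2 * of_real pi * \<i> * z))"
    unfolding eta_like_def by blast
  thus ?thesis
    unfolding eta_like_def
    by (intro exI[of _ "\<lambda>q. inverse (F q)"]) (auto intro: int_power_series_inverse simp: exp_minus)
qed

lemma eta_like_divide:
  "eta_like a f \<Longrightarrow> eta_like b h \<Longrightarrow> eta_like (a - b) (\<lambda>z. f z / h z)"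
  using eta_like_mult[OF _ eta_like_inverse, of a f b h] by (simp add: divide_inverse)

lemma eta_like_power: "eta_like a f \<Longrightarrow> eta_like (int n * a) (\<lambda>z. f z ^ n)"
proof (induction n)
  case 0
  show ?case
    unfolding eta_like_def by (intro exI[of _ "\<lambda>_. 1"]) (auto intro: int_power_series_const)
next
  case (Suc n)
  thus ?case using eta_like_mult[of a f "int n * a" "\<lambda>z. f z ^ n"] by (simp add: algebra_simps)
qed

lemma eta_like_imp_q_expansion:
  assumes "eta_like k f" "k mod 24 = 0" "k > 0"
  shows "\<exists>a. has_q_expansion f a"
proof -
  define m where "m = nat (k div 24)"
  have m: "m > 0" "k = 24 * int m" using assms(2,3) by (auto simp: m_def)
  obtain g where g: "int_power_series g" and eq: "\<And>z. Im z > 0 \<Longrightarrow>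
      f z = exp (of_int k * eta_arg z) * g (exp (2 * of_real pi * \<i> * z))"
    using assms(1) unfolding eta_like_def by blast
  have em: "exp (of_int k * eta_arg z) = exp (2 * of_real pi * \<i> * z) ^ m" for z
    unfolding exp_of_nat_mult[symmetric] m(2) eta_arg_def by (simp add: mult_ac)
  define h where "h = (\<lambda>q. q ^ m * g q)"
  have h: "int_power_series h"
    unfolding h_def by (intro int_power_series_mult int_power_series_monom g)
  define F where "F = fps_expansion h 0"
  have "\<forall>n. \<exists>k. fps_nth F n = of_int k"
    using h by (auto simp: int_power_series_def F_def elim!: Ints_cases)
  then obtain a where a: "\<And>n. fps_nth F n = of_int (a n)" by metis
  have F: "h has_fps_expansion F"
    unfolding F_def by (rule int_power_series_has_fps_expansion[OF h])
  have "h 0 = 0" using m by (simp add: h_def)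
  hence "a 0 = 0" using has_fps_expansion_imp_0_eq_fps_nth_0[OF F] a[of 0] by simp
  moreover have "(\<lambda>n. of_int (a n) * exp (2 * of_real pi * \<i> * z) ^ n) sums f z"
    if z: "Im z > 0" for z
  proof -
    have "norm (exp (2 * of_real pi * \<i> * z)) < 1" using z by simp
    moreover have "h holomorphic_on eball 0 1"
      using h by (simp add: int_power_series_def one_ereal_def)
    ultimately have "(\<lambda>n. fps_nth F n * exp (2 * of_real pi * \<i> * z) ^ n) sums
        h (exp (2 * of_real pi * \<i> * z))"
      by (intro has_fps_expansion_imp_sums_complex[OF F, where r = 1]) (auto simp: one_ereal_def)
    thus ?thesis using eq[OF z] by (simp add: a h_def em)
  qed
  ultimately show ?thesis unfolding has_q_expansion_def by blast
qed

text \<open>The definite description in \<^const>\<open>eta_coeff\<close> is meaningful for all \<open>1 \<le> k \<le> 20\<close>.\<close>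
theorem has_q_expansion_eta_coeff:
  assumes "k \<in> {1..20}"
  shows "has_q_expansion (eta_quotient k) (eta_coeff k)"
proof -
  note rules = eta_like_mult eta_like_divide eta_like_power eta_like_eta_1 eta_like_eta_numeral
  have "\<exists>m. eta_like m (eta_quotient k) \<and> m mod 24 = 0 \<and> m > 0"
  proof -
    consider "k = 1" | "k = 2" | "k = 3" | "k = 4" | "k = 5" | "k = 6" | "k = 7" | "k = 8" | "k = 9" | "k = 10" | "k = 11" | "k = 12" | "k = 13" | "k = 14" | "k = 15" | "k = 16" | "k = 17" | "k = 18" | "k = 19" | "k = 20"
      using assms by (auto simp: atLeastAtMost_iff le_Suc_eq numeral_eq_Suc)
    thus ?thesis
      unfolding eta_quotient_def[abs_def] Let_def
      by cases ((simp, rule exI, rule conjI, (rule rules)+, simp)+)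
  qed
  hence "\<exists>a. has_q_expansion (eta_quotient k) a"
    by (elim exE conjE) (rule eta_like_imp_q_expansion)
  thus ?thesis
    unfolding eta_coeff_def by (metis has_q_expansion_unique theI)
qed

end

theory Submission
  imports Defs
begin

text \<open>
The identities are equalities between Fourier coefficients of modular forms of weight 4 for
\<open>\<Gamma>\<^sub>0(42)\<close>, and such an equality follows from its first few coefficients.

With \<open>E2 = 1 - 24 \<Sum> \<sigma>(n) q^n\<close> put \<open>L\<^sub>d(z) = d E2(d z)\<close>. Each \<open>L\<^sub>d\<close> fails to be modular of
weight 2 by an anomaly that does not depend on \<open>d\<close>, so \<open>(L\<^sub>r - L\<^sub>s)^2\<close> is a genuine form of weight 4
when \<open>r\<close> and \<open>s\<close> divide 42. Its cross term \<open>L\<^sub>r L\<^sub>s\<close> produces \<open>W\<close>, and its two squares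
are turned into \<open>\<sigma>\<^sub>3(n/d)\<close> and \<open>n \<sigma>(n/d)\<close> by Ramanujan's
\<open>E2^2 = E4 + 12 \<theta> E2\<close>, where \<open>\<theta> = q d/dq\<close>; coefficientwise this is Besge's formula for
\<open>\<Sum> \<sigma>(i) \<sigma>(n-i)\<close>, proved here by an elementary count (\<open>besge_identity\<close>). Hence the difference of the
two sides of an identity is, up to the common denominator 42000, the \<open>n\<close>-th coefficient of an
explicit combination \<open>F\<close> of \<open>(L\<^sub>r - L\<^sub>s)^2\<close>, of the eight functions \<open>E4(d z)\<close> and of the twenty eta
quotients, and one has to show \<open>F = 0\<close>.

Modularity rests on one analytic fact, the behaviour of \<open>E2\<close> under \<open>z \<mapsto> -1/z\<close>
(\<open>lambert_square_inversion\<close>), which is obtained by interchanging the order of summation in a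
regularised lattice sum. Integrating it gives the law for \<open>\<eta>\<close> under inversion
(\<open>dedekind_eta_inversion\<close>) and, by the Euclidean algorithm, under every integral matrix of
determinant 1 (\<open>dedekind_eta_modular\<close>). Differentiating logarithmically leads back from \<open>\<eta>\<close> to
\<open>L\<^sub>d\<close> and to \<open>E4(d z)\<close>, written as \<open>L\<^sub>d^2 - (6/\<pi>i) L\<^sub>d'\<close>. So a single computation with integer
matrices, a check over the 96 cosets of \<open>\<Gamma>\<^sub>0(42)\<close>, yields 96 functions, the expansions of \<open>F\<close> at all
cosets, which \<open>z \<mapsto> z + 1\<close> and \<open>z \<mapsto> -1/z\<close> permute up to the factor of automorphy.

The product of these 96 functions is a form of weight \<open>96 \<cdot> 4 = 384 = 12 \<cdot> 32\<close> for the full modular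
group, holomorphic at the cusp. Divided by \<open>\<eta>^768 = \<Delta>^32\<close> it has invariant modulus, and if \<open>F\<close>
vanishes to order 33 the quotient tends to 0 at the cusp; by the maximum principle it is then
identically 0 (\<open>modular_function_vanishes\<close>), whence \<open>F = 0\<close> (\<open>form_at_vanishes\<close>).

It remains to see that the coefficients of \<open>F\<close> with index below 33 are zero. Those of an
eta quotient are computed from the recurrence that its logarithmic derivative provides
(\<open>eta_coeff_recurrence\<close>), and the rest is integer arithmetic (\<open>residual_check\<close>).
\<close>

section \<open>Partial fractions of the cotangent\<close>
lemma has_sum_int:
  fixes f :: "int \<Rightarrow> complex"
  assumes "((\<lambda>k. f (int k)) has_sum a) UNIV" "((\<lambda>k. f (- 1 - int k)) has_sum b) UNIV"
  shows "(f has_sum (a + b)) UNIV"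
proof -
  have "(f has_sum a) (range int)"
    using assms(1) by (subst has_sum_reindex) (auto simp: o_def)
  moreover have "(f has_sum b) (range (\<lambda>k. - 1 - int k))"
    using assms(2) by (subst has_sum_reindex) (auto simp: o_def inj_on_def)
  ultimately have "(f has_sum (a + b)) (range int \<union> range (\<lambda>k. - 1 - int k))"
    by (rule has_sum_Un_disjoint) auto
  also have "range int \<union> range (\<lambda>k. - 1 - int k) = UNIV"
  proof -
    have "n \<in> range int \<union> range (\<lambda>k. - 1 - int k)" for n :: int
    proof (cases "n \<ge> 0")
      case True
      hence "n = int (nat n)" by simp
      thus ?thesis by blast
    next
      case False
      hence "n = - 1 - int (nat (- 1 - n))" by simp
      thus ?thesis by blast
    qed
    thus ?thesis by blast
  qed
  finally show ?thesis .
qed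

text \<open>This is the logarithmic derivative of the reflection formula \<open>\<Gamma>(z) \<Gamma>(1 - z) = \<pi> / sin \<pi>z\<close>. It
gives the partial fractions of the cotangent because the series of the digamma function sums over
half of the integers.\<close>
lemma Digamma_reflection:
  fixes z :: complex
  assumes "z \<notin> \<int>"
  shows "Digamma (1 - z) - Digamma z = of_real pi * cot (of_real pi * z)"
proof -
  have z1: "1 - z \<notin> \<int>"
    using assms Ints_diff[of 1 "1 - z"] by auto
  have nz: "z \<notin> \<int>\<^sub>\<le>\<^sub>0" "1 - z \<notin> \<int>\<^sub>\<le>\<^sub>0"
    using assms z1 by (auto dest: nonpos_Ints_Int)
  have s: "sin (of_real pi * z) \<noteq> 0"
    using assms by (auto simp: sin_eq_0)
  have "((\<lambda>z. Gamma z * Gamma (1 - z)) has_field_derivative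
          Gamma z * Gamma (1 - z) * (Digamma z - Digamma (1 - z))) (at z)"
    by (rule derivative_eq_intros refl nz | simp add: nz algebra_simps)+
  moreover have "((\<lambda>z. of_real pi / sin (of_real pi * z)) has_field_derivative
          - of_real pi * (cos (of_real pi * z) * of_real pi) / sin (of_real pi * z) ^ 2) (at z)"
    by (rule derivative_eq_intros refl | simp add: s power2_eq_square)+
  ultimately have "Gamma z * Gamma (1 - z) * (Digamma z - Digamma (1 - z)) =
      - of_real pi * (cos (of_real pi * z) * of_real pi) / sin (of_real pi * z) ^ 2"
    unfolding Gamma_reflection_complex by (rule DERIV_unique)
  hence "of_real pi / sin (of_real pi * z) * (Digamma z - Digamma (1 - z)) =
      of_real pi / sin (of_real pi * z) * (- of_real pi * cot (of_real pi * z))"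
    using s by (simp add: Gamma_reflection_complex cot_def power2_eq_square field_simps)
  hence "Digamma z - Digamma (1 - z) = - of_real pi * cot (of_real pi * z)"
    using s by (subst (asm) mult_left_cancel) auto
  thus ?thesis by (simp add: algebra_simps)
qed

lemma Polygamma_1_reflection:
  fixes z :: complex
  assumes "z \<notin> \<int>"
  shows "Polygamma 1 z + Polygamma 1 (1 - z) = (of_real pi / sin (of_real pi * z)) ^ 2"
proof -
  have z1: "1 - z \<notin> \<int>"
    using assms Ints_diff[of 1 "1 - z"] by auto
  have nz: "z \<notin> \<int>\<^sub>\<le>\<^sub>0" "1 - z \<notin> \<int>\<^sub>\<le>\<^sub>0"
    using assms z1 by (auto dest: nonpos_Ints_Int)
  have s: "sin (of_real pi * z) \<noteq> 0"
    using assms by (auto simp: sin_eq_0)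
  have "((\<lambda>z. of_real pi * cot (of_real pi * z)) has_field_derivative
          of_real pi * (- inverse (sin (of_real pi * z) ^ 2) * of_real pi)) (at z)"
    by (rule derivative_eq_intros DERIV_chain2[OF DERIV_cot] refl s | simp)+
  moreover have "((\<lambda>z. of_real pi * cot (of_real pi * z)) has_field_derivative
          - Polygamma 1 (1 - z) - Polygamma 1 z) (at z)"
  proof (rule has_field_derivative_transform_within_open)
    show "((\<lambda>z. Digamma (1 - z) - Digamma z) has_field_derivative
            - Polygamma 1 (1 - z) - Polygamma 1 z) (at z)"
      by (rule derivative_eq_intros DERIV_chain2[OF has_field_derivative_Polygamma] refl nz | simp)+
    show "open (- \<int> :: complex set)" by auto
  qed (use assms Digamma_reflection in auto)
  ultimately have "of_real pi * (- inverse (sin (of_real pi * z) ^ 2) * of_real pi) =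
      - Polygamma 1 (1 - z) - Polygamma 1 z"
    by (rule DERIV_unique)
  thus ?thesis
    using s by (simp add: field_simps power2_eq_square)
qed

lemma norm_summable_inverse_square_shift:
  fixes u :: complex
  shows "summable (\<lambda>k. norm (1 / (of_nat k + u) ^ 2))"
proof (rule summable_comparison_test_ev)
  show "summable (\<lambda>k. 4 * inverse (real k ^ 2))"
    by (intro summable_mult inverse_power_summable) simp
  have "eventually (\<lambda>k. real k > 2 * norm u) sequentially"
    using filterlim_real_sequentially by (simp add: filterlim_at_top_dense)
  thus "\<forall>\<^sub>F k in sequentially. norm (norm (1 / (of_nat k + u) ^ 2)) \<le> 4 * inverse (real k ^ 2)"
  proof eventually_elim
    case (elim k)
    have "real k - norm u \<le> norm (of_nat k + u)"
      using norm_triangle_ineq2[of "of_nat k" "- u"] by simp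
    hence *: "real k / 2 \<le> norm (of_nat k + u)" using elim by simp
    have k: "real k > 0" using elim norm_ge_zero[of u] by linarith
    have "(real k / 2) ^ 2 \<le> norm (of_nat k + u) ^ 2"
      using * k by (intro power_mono) auto
    hence "inverse (norm (of_nat k + u) ^ 2) \<le> inverse ((real k / 2) ^ 2)"
      using k by (intro le_imp_inverse_le) auto
    thus ?case by (simp add: norm_divide norm_power field_simps)
  qed
qed

lemma has_sum_inverse_square:
  fixes u :: complex
  assumes "u \<notin> \<int>"
  shows "((\<lambda>n::int. 1 / (of_int n + u) ^ 2) has_sum (of_real pi / sin (of_real pi * u)) ^ 2) UNIV"
proof -
  have *: "((\<lambda>k. 1 / (of_nat k + u) ^ 2) has_sum Polygamma 1 u) UNIV" if "u \<noteq> 0" for u :: complex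
  proof (rule norm_summable_imp_has_sum)
    show "(\<lambda>k. 1 / (of_nat k + u) ^ 2) sums Polygamma 1 u"
      using Polygamma_LIMSEQ[of u 1] that by (simp add: field_simps add_ac power2_eq_square)
  qed (rule norm_summable_inverse_square_shift)
  have nz: "u \<noteq> 0" "1 - u \<noteq> 0" using assms by auto
  have e: "1 / (of_int (- 1 - int k) + u) ^ 2 = 1 / (of_nat k + (1 - u)) ^ 2" for k
    using power2_minus[of "of_nat k + (1 - u)"] by (simp add: algebra_simps)
  have "((\<lambda>n::int. 1 / (of_int n + u) ^ 2) has_sum (Polygamma 1 u + Polygamma 1 (1 - u))) UNIV"
    by (rule has_sum_int) (use *[OF nz(1)] *[OF nz(2)] e in simp_all)
  thus ?thesis using Polygamma_1_reflection[OF assms] by simp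
qed

lemma has_sum_cot_diff:
  fixes u v :: complex
  assumes "u \<notin> \<int>" "v \<notin> \<int>"
  shows "((\<lambda>n::int. 1 / (of_int n + u) - 1 / (of_int n + v)) has_sum
          (of_real pi * cot (of_real pi * u) - of_real pi * cot (of_real pi * v))) UNIV"
proof -
  have *: "((\<lambda>k. 1 / (of_nat k + u) - 1 / (of_nat k + v)) has_sum (Digamma v - Digamma u)) UNIV"
    if "u \<notin> \<int>" "v \<notin> \<int>" for u v :: complex
  proof (rule norm_summable_imp_has_sum)
    have nz: "u \<noteq> 0" "v \<noteq> 0" using that by auto
    have "(\<lambda>m. (of_real (ln (real m)) - (\<Sum>n<m. inverse (v + of_nat n))) -
               (of_real (ln (real m)) - (\<Sum>n<m. inverse (u + of_nat n))))
            \<longlonglongrightarrow> Digamma v - Digamma u"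
      by (intro tendsto_diff Digamma_LIMSEQ nz)
    thus "(\<lambda>k. 1 / (of_nat k + u) - 1 / (of_nat k + v)) sums (Digamma v - Digamma u)"
      unfolding sums_def by (simp add: sum_subtractf field_simps)
    show "summable (\<lambda>k. norm (1 / (of_nat k + u) - 1 / (of_nat k + v)))"
    proof (rule summable_comparison_test')
      show "summable (\<lambda>k. norm (v - u) * (norm (1 / (of_nat k + u) ^ 2) + norm (1 / (of_nat k + v) ^ 2)))"
        by (intro summable_mult summable_add norm_summable_inverse_square_shift)
      fix k :: nat
      have nz: "of_nat k + u \<noteq> 0" "of_nat k + v \<noteq> 0"
        using that by (metis Ints_minus Ints_of_nat add.inverse_unique)+
      define x y where "x = norm (1 / (of_nat k + u))" and "y = norm (1 / (of_nat k + v))"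
      have "1 / (of_nat k + u) - 1 / (of_nat k + v) = (v - u) * ((1 / (of_nat k + u)) * (1 / (of_nat k + v)))"
        using nz by (simp add: divide_simps)
      hence "norm (1 / (of_nat k + u) - 1 / (of_nat k + v)) = norm (v - u) * (x * y)"
        by (simp only: norm_mult x_def y_def)
      also have "x * y \<le> x ^ 2 + y ^ 2"
      proof -
        have "x * y \<ge> 0" by (simp add: x_def y_def)
        thus ?thesis using sum_squares_bound[of x y] by linarith
      qed
      hence "norm (v - u) * (x * y) \<le> norm (v - u) * (x ^ 2 + y ^ 2)"
        by (intro mult_left_mono) auto
      finally show "norm (norm (1 / (of_nat k + u) - 1 / (of_nat k + v))) \<le>
         norm (v - u) * (norm (1 / (of_nat k + u) ^ 2) + norm (1 / (of_nat k + v) ^ 2))"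
        by (simp add: x_def y_def norm_divide norm_power power_divide)
    qed
  qed
  have nz: "1 - u \<notin> \<int>" "1 - v \<notin> \<int>"
    using assms Ints_diff[of 1 "1 - u"] Ints_diff[of 1 "1 - v"] by auto
  have e: "1 / (of_int (- 1 - int k) + u) - 1 / (of_int (- 1 - int k) + v) =
      1 / (of_nat k + (1 - v)) - 1 / (of_nat k + (1 - u))" for k
  proof -
    have "1 / (of_int (- 1 - int k) + u) = - (1 / (of_nat k + (1 - u)))" for u :: complex
      by (subst minus_divide_right) (simp add: algebra_simps)
    thus ?thesis by simp
  qed
  have "((\<lambda>n::int. 1 / (of_int n + u) - 1 / (of_int n + v)) has_sum
           ((Digamma v - Digamma u) + (Digamma (1 - u) - Digamma (1 - v)))) UNIV"
    by (rule has_sum_int) (use *[OF assms] *[OF nz(2,1)] e in simp_all)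
  thus ?thesis
    using Digamma_reflection[OF assms(1)] Digamma_reflection[OF assms(2)]
    by (simp add: algebra_simps)
qed

section \<open>The Eisenstein series of weight 2 under inversion\<close>
lemma lattice_norm_bound:
  fixes z :: complex
  assumes "Im z > 0"
  obtains k :: real where "0 < k" "k \<le> 1"
    "\<And>x y :: real. k * (\<bar>x\<bar> + \<bar>y\<bar>) \<le> norm (of_real x + of_real y * z)"
proof
  define K where "K = 1 + (norm z + 1) / Im z"
  have K: "K \<ge> 1" using assms by (simp add: K_def)
  show "0 < 1 / K" "1 / K \<le> 1" using K by auto
  fix x y :: real
  define w where "w = of_real x + of_real y * z"
  have "\<bar>y\<bar> * Im z = \<bar>Im w\<bar>" using assms by (simp add: w_def abs_mult)
  also have "\<dots> \<le> norm w" by (rule abs_Im_le_cmod)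
  finally have y: "\<bar>y\<bar> \<le> norm w / Im z" using assms by (simp add: field_simps)
  have "\<bar>x\<bar> = norm (w - of_real y * z)" by (simp add: w_def)
  also have "\<dots> \<le> norm w + \<bar>y\<bar> * norm z"
    by (rule order.trans[OF norm_triangle_ineq4]) (simp add: norm_mult)
  also have "\<bar>y\<bar> * norm z \<le> norm w / Im z * norm z"
    using y by (rule mult_right_mono) simp
  finally have "\<bar>x\<bar> + \<bar>y\<bar> \<le> norm w + norm w / Im z * norm z + norm w / Im z"
    using y by simp
  also have "\<dots> = norm w * K"
    by (simp add: K_def add_divide_distrib ring_distribs)
  finally have "\<bar>x\<bar> + \<bar>y\<bar> \<le> norm w * K" .
  thus "1 / K * (\<bar>x\<bar> + \<bar>y\<bar>) \<le> norm (of_real x + of_real y * z)"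
    using K by (simp add: w_def field_simps)
qed

lemma summable_on_int_product:
  "(\<lambda>(m :: int, n :: int). 1 / ((1 + \<bar>real_of_int m\<bar>) ^ 2 * (1 + \<bar>real_of_int n\<bar>) ^ 2)) summable_on UNIV \<times> UNIV"
proof -
  define g where "g = (\<lambda>n :: int. 1 / (1 + \<bar>real_of_int n\<bar>) ^ 2)"
  have half: "(1 / 2 :: complex) \<notin> \<int>"
    using fraction_not_in_Ints[of 2 1, where 'a = complex] by simp
  have "(\<lambda>n::int. norm (1 / (of_int n + 1 / 2 :: complex) ^ 2)) summable_on UNIV"
    using has_sum_imp_summable[OF has_sum_inverse_square[OF half]]
    by (rule summable_on_iff_abs_summable_on_complex [THEN iffD1])
  hence "g summable_on UNIV"
  proof (rule summable_on_comparison_test)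
    fix n :: int
    have le: "norm (of_int n + 1 / 2 :: complex) \<le> 1 + \<bar>real_of_int n\<bar>"
      by (rule order.trans[OF norm_triangle_ineq]) simp
    have "of_int n + 1 / 2 \<noteq> (0 :: complex)"
    proof
      assume "of_int n + 1 / 2 = (0 :: complex)"
      hence "(1 / 2 :: complex) = of_int (- n)" by (simp add: add_eq_0_iff2)
      thus False using half by (metis Ints_of_int)
    qed
    hence "norm (of_int n + 1 / 2 :: complex) > 0" by (rule zero_less_norm_iff[THEN iffD2])
    with le show "g n \<le> norm (1 / (of_int n + 1 / 2 :: complex) ^ 2)"
      unfolding g_def norm_divide norm_power norm_one by (intro divide_left_mono power_mono) auto
  qed (simp add: g_def)
  hence g: "(g has_sum infsum g UNIV) UNIV" by simp
  have "(\<lambda>p. g (fst p) * g (snd p)) summable_on (SIGMA x:UNIV. UNIV)"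
  proof (rule summable_on_SigmaI)
    show "((\<lambda>y. g (fst (x, y)) * g (snd (x, y))) has_sum g x * infsum g UNIV) UNIV" for x
      using g by (simp add: has_sum_cmult_right)
    show "(\<lambda>x. g x * infsum g UNIV) summable_on UNIV"
      by (intro summable_on_cmult_left \<open>g summable_on UNIV\<close>)
  qed (auto simp: g_def)
  thus ?thesis by (simp add: g_def case_prod_unfold)
qed

text \<open>The value of \<open>\<Sum> 1/(m + k t)^2\<close> over all integers \<open>m\<close>. In the row \<open>k = 0\<close> the term \<open>m = 0\<close>
contributes \<open>1/0 = 0\<close>, so that the row sums to \<open>2 \<zeta>(2)\<close>.\<close>
definition eis_row :: "int \<Rightarrow> complex \<Rightarrow> complex" where
  "eis_row k t = (if k = 0 then of_real pi ^ 2 / 3 else (of_real pi / sin (of_real pi * (of_int k * t))) ^ 2)"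

lemma eis_row_minus: "eis_row (- k) t = eis_row k t"
  by (simp add: eis_row_def)

lemma of_int_mult_upper_notin_Ints:
  assumes "Im t > 0" "k \<noteq> 0"
  shows "of_int k * t \<notin> \<int>"
  using assms by (auto simp: complex_is_Int_iff)

lemma has_sum_eis_row:
  assumes t: "Im t > 0"
  shows "((\<lambda>m::int. 1 / (of_int m + of_int k * t) ^ 2) has_sum eis_row k t) UNIV"
proof (cases "k = 0")
  case False
  thus ?thesis
    using has_sum_inverse_square[OF of_int_mult_upper_notin_Ints[OF t False]] by (simp add: eis_row_def)
next
  case True
  have "(\<lambda>n. 1 / (real n + 1) ^ 2) sums (pi ^ 2 / 6)"
    using inverse_squares_sums by (simp add: add_ac)
  hence 1: "(\<lambda>n. 1 / (of_nat (Suc n)) ^ 2) sums (of_real pi ^ 2 / 6 :: complex)"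
    by (subst (asm) sums_of_real_iff [symmetric, where 'a = complex]) (simp add: add_ac)
  have n: "summable (\<lambda>n. norm (1 / of_nat (Suc n) ^ 2 :: complex))"
    using norm_summable_inverse_square_shift[of 1] by (simp add: add_ac)
  have 2: "(\<lambda>n. 1 / (of_nat n) ^ 2) sums (of_real pi ^ 2 / 6 :: complex)"
    using 1 by (subst (asm) sums_Suc_iff) simp
  have n2: "summable (\<lambda>n. norm (1 / of_nat n ^ 2 :: complex))"
    using n by (subst (asm) summable_Suc_iff)
  have e: "(of_int (- 1 - int k)) ^ 2 = (of_nat (Suc k) :: complex) ^ 2" for k
    using power2_minus[of "of_nat (Suc k) :: complex"] by simp
  have "((\<lambda>m::int. 1 / (of_int m) ^ 2) has_sum (of_real pi ^ 2 / 6 + of_real pi ^ 2 / 6 :: complex)) UNIV"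
    by (rule has_sum_int; (subst e)?) (use norm_summable_imp_has_sum[OF n 1] norm_summable_imp_has_sum[OF n2 2] in simp_all)
  thus ?thesis using True by (simp add: eis_row_def)
qed

definition lambert_square :: "complex \<Rightarrow> complex" where
  "lambert_square q = (\<Sum>k. q ^ Suc k / (1 - q ^ Suc k) ^ 2)"

lemma summable_lambert_square:
  fixes q :: complex
  assumes q: "norm q < 1"
  shows "summable (\<lambda>k. norm (q ^ Suc k / (1 - q ^ Suc k) ^ 2))"
proof (rule summable_comparison_test')
  show "summable (\<lambda>k. norm q ^ k * (norm q / (1 - norm q) ^ 2))"
    using q by (intro summable_mult2 summable_geometric) simp
  fix k :: nat
  have "norm (q ^ Suc k) \<le> norm q"
    using q power_decreasing[of 1 "Suc k" "norm q"] by (simp add: norm_power norm_mult)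
  hence "1 - norm q \<le> norm (1 - q ^ Suc k)"
    using norm_triangle_ineq2[of 1 "q ^ Suc k"] by simp
  hence "(1 - norm q) ^ 2 \<le> norm (1 - q ^ Suc k) ^ 2"
    using q by (intro power_mono) auto
  hence "norm q ^ Suc k / norm (1 - q ^ Suc k) ^ 2 \<le> norm q ^ Suc k / (1 - norm q) ^ 2"
    using q by (intro divide_left_mono mult_pos_pos) (auto intro: less_le_trans[of 0 "(1 - norm q) ^ 2"])
  thus "norm (norm (q ^ Suc k / (1 - q ^ Suc k) ^ 2)) \<le> norm q ^ k * (norm q / (1 - norm q) ^ 2)"
    by (simp add: norm_divide norm_power norm_mult mult_ac)
qed

lemma norm_exp_2pi_less_1: "Im t > 0 \<Longrightarrow> norm (exp (2 * of_real pi * \<i> * t)) < 1"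
  by simp

lemma eis_row_nome:
  assumes t: "Im t > 0"
  defines "q \<equiv> exp (2 * of_real pi * \<i> * t)"
  shows "eis_row (int (Suc k)) t = - 4 * of_real pi ^ 2 * (q ^ Suc k / (1 - q ^ Suc k) ^ 2)"
proof -
  define y where "y = exp (\<i> * (of_real pi * (of_nat (Suc k) * t)))"
  have y0: "y \<noteq> 0" by (simp add: y_def)
  have y2: "y ^ 2 = q ^ Suc k"
    by (simp only: y_def q_def exp_of_nat_mult [symmetric] flip: exp_double) (simp add: algebra_simps)
  have "sin (of_real pi * (of_nat (Suc k) * t)) = - (1 - y ^ 2) / (2 * \<i> * y)"
    unfolding sin_exp_eq exp_minus y_def [symmetric] using y0 by (simp add: field_simps power2_eq_square)
  hence "(of_real pi / sin (of_real pi * (of_nat (Suc k) * t))) ^ 2 = - 4 * of_real pi ^ 2 * (y ^ 2 / (1 - y ^ 2) ^ 2)"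
    using power2_commute[of "y ^ 2" 1] by (simp add: power_divide power_mult_distrib)
  thus ?thesis by (simp add: eis_row_def y2)
qed

lemma has_sum_eis_rows:
  assumes t: "Im t > 0"
  shows "((\<lambda>k. eis_row k t) has_sum
          (of_real pi ^ 2 / 3 * (1 - 24 * lambert_square (exp (2 * of_real pi * \<i> * t))))) UNIV"
proof -
  define q where "q = exp (2 * of_real pi * \<i> * t)"
  define a where "a = (\<lambda>k. eis_row (int (Suc k)) t)"
  have a_eq: "a = (\<lambda>k. - 4 * of_real pi ^ 2 * (q ^ Suc k / (1 - q ^ Suc k) ^ 2))"
    unfolding a_def q_def by (intro ext eis_row_nome t)
  have sm: "summable (\<lambda>k. norm (q ^ Suc k / (1 - q ^ Suc k) ^ 2))"
    using summable_lambert_square[OF norm_exp_2pi_less_1[OF t]] by (simp add: q_def)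
  have n: "summable (\<lambda>k. norm (a k))"
    unfolding a_eq norm_mult by (intro summable_mult sm)
  have s: "a sums (- 4 * of_real pi ^ 2 * lambert_square q)"
    unfolding a_eq lambert_square_def
    by (intro sums_mult summable_sums summable_norm_cancel[OF sm])
  have n0: "summable (\<lambda>k. norm (eis_row (int k) t))"
    using n unfolding a_def by (subst (asm) summable_Suc_iff)
  have s0: "(\<lambda>k. eis_row (int k) t) sums (- 4 * of_real pi ^ 2 * lambert_square q + of_real pi ^ 2 / 3)"
    using s unfolding a_def by (subst (asm) sums_Suc_iff) (simp add: eis_row_def)
  have e: "eis_row (- 1 - int k) t = a k" for k
    using eis_row_minus[of "int (Suc k)" t] by (simp add: a_def)
  have "((\<lambda>k. eis_row k t) has_sum ((- 4 * of_real pi ^ 2 * lambert_square q + of_real pi ^ 2 / 3)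
             + - 4 * of_real pi ^ 2 * lambert_square q)) UNIV"
    by (rule has_sum_int; (subst e)?) (intro norm_summable_imp_has_sum s0 s n n0)+
  thus ?thesis by (simp add: q_def algebra_simps)
qed

text \<open>The sum of \<open>1/w^2\<close> over a lattice does not converge absolutely. Subtracting \<open>1/(w^2 - 1/4)\<close> leaves
terms of order \<open>|w|^(-4)\<close>; the shift by \<open>1/2\<close> is chosen since no lattice point \<open>m + n z\<close> equals
\<open>1/2\<close> or \<open>-1/2\<close>, so that no denominator of the correction vanishes.\<close>
lemma summable_on_regularised_lattice:
  fixes z :: complex
  assumes z: "Im z > 0"
  shows "(\<lambda>(n::int, m::int). 1 / (of_int m + of_int n * z) ^ 2 - 1 / ((of_int m + of_int n * z) ^ 2 - 1 / 4))
           summable_on UNIV \<times> UNIV"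
proof -
  obtain k :: real where k: "0 < k" "k \<le> 1"
    and bd: "\<And>x y :: real. k * (\<bar>x\<bar> + \<bar>y\<bar>) \<le> norm (of_real x + of_real y * z)"
    using lattice_norm_bound[OF z] by blast
  define c where "c = (\<lambda>(n::int, m::int). 1 / (of_int m + of_int n * z) ^ 2 - 1 / ((of_int m + of_int n * z) ^ 2 - 1 / 4))"
  define g where "g = (\<lambda>(n::int, m::int). 1 / ((1 + \<bar>real_of_int n\<bar>) ^ 2 * (1 + \<bar>real_of_int m\<bar>) ^ 2))"
  have "norm (c p) \<le> 16 / k ^ 4 * g p" for p
  proof (cases p)
    case [simp]: (Pair n m)
    show ?thesis
    proof (cases "n = 0 \<and> m = 0")
      case True
      have "k ^ 4 \<le> 1" using k by (simp add: power_le_one)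
      thus ?thesis using True k by (simp add: c_def g_def field_simps)
    next
      case False
      define w where "w = of_int m + of_int n * z"
      define s where "s = \<bar>real_of_int m\<bar> + \<bar>real_of_int n\<bar>"
      have "\<bar>m\<bar> + \<bar>n\<bar> \<ge> 1" using False by linarith
      hence s: "s \<ge> 1" unfolding s_def by linarith
      have w: "k * s \<le> norm w"
        using bd[of "of_int m" "of_int n"] by (simp add: w_def s_def)
      \<comment> \<open>A half-integral shift at most halves the absolute value of an integer, which keeps \<open>w \<plusminus> 1/2\<close>
          comparable with \<open>w\<close>.\<close>
      have h1: "\<bar>real_of_int m\<bar> / 2 \<le> \<bar>of_int m - 1 / 2\<bar>" "\<bar>real_of_int m\<bar> / 2 \<le> \<bar>of_int m + 1 / 2\<bar>"
        by (cases "m = 0"; linarith)+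
      have "k * (s / 2) \<le> k * (\<bar>of_int m - 1 / 2\<bar> + \<bar>real_of_int n\<bar>)"
      proof (intro mult_left_mono)
        show "s / 2 \<le> \<bar>of_int m - 1 / 2\<bar> + \<bar>real_of_int n\<bar>"
          unfolding s_def add_divide_distrib by (intro add_mono h1) simp
      qed (use k in simp)
      also have "\<dots> \<le> norm (w - 1 / 2)"
        using bd[of "of_int m - 1 / 2" "of_int n"] by (simp add: w_def algebra_simps)
      finally have w1: "k * (s / 2) \<le> norm (w - 1 / 2)" .
      have "k * (s / 2) \<le> k * (\<bar>of_int m + 1 / 2\<bar> + \<bar>real_of_int n\<bar>)"
      proof (intro mult_left_mono)
        show "s / 2 \<le> \<bar>of_int m + 1 / 2\<bar> + \<bar>real_of_int n\<bar>"
          unfolding s_def add_divide_distrib by (intro add_mono h1) simp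
      qed (use k in simp)
      also have "\<dots> \<le> norm (w + 1 / 2)"
        using bd[of "of_int m + 1 / 2" "of_int n"] by (simp add: w_def algebra_simps)
      finally have w2: "k * (s / 2) \<le> norm (w + 1 / 2)" .
      have ks: "k * s > 0" using k s by simp
      have fac: "w ^ 2 - 1 / 4 = (w - 1 / 2) * (w + 1 / 2)"
        by (simp add: field_simps power2_eq_square)
      have "k * (s / 2) * (k * (s / 2)) \<le> norm (w - 1 / 2) * norm (w + 1 / 2)"
        using w1 w2 ks by (intro mult_mono) auto
      hence n1: "(k * s) ^ 2 / 4 \<le> norm (w ^ 2 - 1 / 4)"
        unfolding fac norm_mult by (simp add: power2_eq_square)
      have n2: "(k * s) ^ 2 \<le> norm w ^ 2"
        using w ks by (intro power_mono) auto
      have "norm (w ^ 2 - 1 / 4) > 0"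
        using n1 zero_less_power[OF ks, of 2] by linarith
      hence nz: "w \<noteq> 0" "w ^ 2 - 1 / 4 \<noteq> 0"
        using w ks by (auto simp only: zero_less_norm_iff norm_zero)
      have "c p = - (1 / 4) / (w ^ 2 * (w ^ 2 - 1 / 4))"
        using nz by (simp add: c_def w_def [symmetric] divide_simps)
      hence "norm (c p) = (1 / 4) / (norm w ^ 2 * norm (w ^ 2 - 1 / 4))"
        by (simp add: norm_divide norm_mult norm_power)
      also have "\<dots> \<le> (1 / 4) / ((k * s) ^ 2 * ((k * s) ^ 2 / 4))"
      proof (rule frac_le)
        show "(k * s) ^ 2 * ((k * s) ^ 2 / 4) \<le> norm w ^ 2 * norm (w ^ 2 - 1 / 4)"
          by (intro mult_mono n1 n2) simp_all
      qed (use k s in simp_all)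
      also have "\<dots> = 16 / k ^ 4 * (1 / (16 * s ^ 4))"
      proof -
        have "(k * s) ^ 2 * ((k * s) ^ 2 / 4) = k ^ 4 * s ^ 4 / 4"
          by (simp add: power2_eq_square power4_eq_xxxx)
        thus ?thesis using k s by simp
      qed
      also have "1 / (16 * s ^ 4) \<le> g p"
      proof -
        define x y where "x = \<bar>real_of_int n\<bar>" and "y = \<bar>real_of_int m\<bar>"
        have "(1 + x) * (1 + y) \<le> (2 * s) * (2 * s)"
          using s by (intro mult_mono) (auto simp: s_def x_def y_def)
        hence "((1 + x) * (1 + y)) ^ 2 \<le> (4 * s ^ 2) ^ 2"
          by (intro power_mono) (auto simp: x_def y_def power2_eq_square)
        hence "(1 + x) ^ 2 * (1 + y) ^ 2 \<le> 16 * s ^ 4"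
          by (simp add: power_mult_distrib flip: power_mult)
        thus ?thesis
          using s by (auto simp: g_def x_def y_def intro!: divide_left_mono mult_pos_pos)
      qed
      hence "16 / k ^ 4 * (1 / (16 * s ^ 4)) \<le> 16 / k ^ 4 * g p"
        using k by (intro mult_left_mono) auto
      finally show ?thesis .
    qed
  qed
  note le = this
  have "(\<lambda>p. 16 / k ^ 4 * g p) summable_on UNIV \<times> UNIV"
    using summable_on_int_product by (intro summable_on_cmult_right) (simp add: g_def)
  hence "(\<lambda>p. norm (c p)) summable_on UNIV \<times> UNIV"
    by (rule summable_on_comparison_test) (rule le, simp)
  hence "c summable_on UNIV \<times> UNIV"
    by (rule summable_on_iff_abs_summable_on_complex [THEN iffD2])
  thus ?thesis by (simp add: c_def)
qed

text \<open>The terms \<open>N + 1/2\<close> are the ends of a telescoping sum over \<open>-N..N\<close>. This limit is the sole source of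
the anomaly in the inversion formula.\<close>
lemma cot_downwards_limit:
  fixes w :: complex
  assumes w: "Im w < 0"
  shows "(\<lambda>N. cot (of_real pi * ((of_nat N + 1 / 2) * w))) \<longlonglongrightarrow> \<i>"
proof -
  define u where "u = exp (- 2 * \<i> * of_real pi * w)"
  define t where "t = (\<lambda>N. exp (- \<i> * of_real pi * w) * u ^ N)"
  have "norm u < 1" using w by (simp add: u_def mult_pos_neg)
  hence u: "(\<lambda>N. u ^ N) \<longlonglongrightarrow> 0" by (rule LIMSEQ_power_zero)
  hence t0: "t \<longlonglongrightarrow> 0"
    unfolding t_def by (rule tendsto_mult_right_zero)
  have eq: "cot (of_real pi * ((of_nat N + 1 / 2) * w)) = \<i> * (1 + t N) / (1 - t N)" for N
  proof -
    define y where "y = exp (\<i> * (of_real pi * ((of_nat N + 1 / 2) * w)))"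
    have y0: "y \<noteq> 0" by (simp add: y_def)
    have "t N = inverse y ^ 2"
      unfolding t_def u_def y_def exp_of_nat_mult [symmetric] exp_minus [symmetric] exp_double [symmetric] exp_add [symmetric]
      by (rule arg_cong[where f = exp]) (simp add: algebra_simps)
    hence "1 + t N = (y + inverse y) * inverse y" "1 - t N = (y - inverse y) * inverse y"
      using y0 by (simp_all add: power2_eq_square ring_distribs)
    moreover have "(a / 2) / (b / (2 * \<i>)) = \<i> * a / b" for a b :: complex
      by (cases "b = 0") (auto simp: field_simps)
    ultimately show ?thesis
      using y0 unfolding cot_def sin_exp_eq cos_exp_eq exp_minus y_def [symmetric] by (simp only: nonzero_mult_divide_mult_cancel_right times_divide_eq_right [symmetric]) simp
  qed
  have "(\<lambda>N. \<i> * (1 + t N) / (1 - t N)) \<longlonglongrightarrow> \<i> * (1 + 0) / (1 - 0)"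
    by (intro tendsto_intros t0) auto
  thus ?thesis by (simp add: eq)
qed

lemma has_sum_difference:
  fixes f g :: "'a \<Rightarrow> complex"
  assumes "(f has_sum a) A" "(g has_sum b) A"
  shows "((\<lambda>x. f x - g x) has_sum (a - b)) A"
  using has_sum_add[OF assms(1) has_sum_cmult_right[OF assms(2), of "-1"]] by simp

lemma has_sum_int_symmetric_limit:
  fixes f :: "int \<Rightarrow> complex"
  assumes "(f has_sum s) UNIV"
  shows "(\<lambda>N. \<Sum>m\<in>{- int N..int N}. f m) \<longlonglongrightarrow> s"
proof -
  have "filterlim (\<lambda>N. {- int N..int N}) (finite_subsets_at_top UNIV) sequentially"
    unfolding filterlim_finite_subsets_at_top
  proof safe
    fix X :: "int set" assume X: "finite X"
    define M where "M = nat (Max (insert 0 (abs ` X)))"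
    have "X \<subseteq> {- int N..int N}" if "N \<ge> M" for N
    proof
      fix x assume "x \<in> X"
      hence "\<bar>x\<bar> \<le> Max (insert 0 (abs ` X))" using X by (intro Max_ge) auto
      thus "x \<in> {- int N..int N}" using that by (auto simp: M_def)
    qed
    thus "eventually (\<lambda>N. finite {- int N..int N} \<and> X \<subseteq> {- int N..int N} \<and> {- int N..int N} \<subseteq> UNIV) sequentially"
      by (intro eventually_sequentiallyI[of M]) auto
  qed
  thus ?thesis
    using assms unfolding has_sum_def by (rule filterlim_compose[rotated])
qed

lemma sum_int_symmetric_telescope:
  fixes f :: "complex \<Rightarrow> complex"
  shows "(\<Sum>m\<in>{- int N..int N}. f (of_int m - 1 / 2) - f (of_int m + 1 / 2)) =
         f (- (of_nat N + 1 / 2)) - f (of_nat N + 1 / 2)"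
proof (induction N)
  case (Suc N)
  have "{- int (Suc N)..int (Suc N)} = insert (- int (Suc N)) (insert (int (Suc N)) {- int N..int N})"
    by auto
  hence "(\<Sum>m\<in>{- int (Suc N)..int (Suc N)}. f (of_int m - 1 / 2) - f (of_int m + 1 / 2)) =
     (f (- (of_nat (Suc N) + 1 / 2)) - f (- (of_nat N + 1 / 2))) +
     ((f (of_nat N + 1 / 2) - f (of_nat (Suc N) + 1 / 2)) + (f (- (of_nat N + 1 / 2)) - f (of_nat N + 1 / 2)))"
    by (simp add: Suc.IH algebra_simps minus_diff_commute[of "1 / 2"])
  thus ?case by simp
qed simp

text \<open>The regularised lattice sum can be evaluated by rows and by columns. Along a row, the correction
\<open>1/(w^2 - 1/4) = 1/(w - 1/2) - 1/(w + 1/2)\<close> sums to 0, because the cotangent has period \<open>\<pi>\<close>; the rows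
therefore give the Eisenstein series at \<open>z\<close>. Along a column one finds the row of the series at
\<open>-1/z\<close>, divided by \<open>z^2\<close>, and a correction \<open>\<beta> m\<close> that is nonzero but telescopes over \<open>m\<close>.\<close>
theorem lambert_square_inversion:
  fixes z :: complex
  assumes z: "Im z > 0"
  shows "1 - 24 * lambert_square (exp (2 * of_real pi * \<i> * (- 1 / z))) =
         z ^ 2 * (1 - 24 * lambert_square (exp (2 * of_real pi * \<i> * z))) + 6 * z / (of_real pi * \<i>)"
proof -
  have z0: "z \<noteq> 0" using z by auto
  have z': "Im (- 1 / z) > 0" 
  proof -
    have "Im (- 1 / z) = Im z / (Re z ^ 2 + Im z ^ 2)" by (simp add: Im_divide)
    also have "\<dots> > 0" using z by (intro divide_pos_pos add_nonneg_pos) auto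
    finally show ?thesis .
  qed
  define W where "W = (\<lambda>n m :: int. of_int m + of_int n * z)"
  define c where "c = (\<lambda>n m. 1 / W n m ^ 2 - 1 / (W n m ^ 2 - 1 / 4))"
  define \<beta> where "\<beta> = (\<lambda>m::int. of_real pi / z * cot (of_real pi * ((of_int m - 1 / 2) / z))
                           - of_real pi / z * cot (of_real pi * ((of_int m + 1 / 2) / z)))"
  define G where "G = (\<lambda>t. of_real pi ^ 2 / 3 * (1 - 24 * lambert_square (exp (2 * of_real pi * \<i> * t))))"
  have sm: "(\<lambda>(n, m). c n m) summable_on UNIV \<times> UNIV"
    using summable_on_regularised_lattice[OF z] by (simp add: c_def W_def)
  have fac: "1 / (W n m ^ 2 - 1 / 4) = 1 / (W n m - 1 / 2) - 1 / (W n m + 1 / 2)"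
    if "W n m - 1 / 2 \<noteq> 0" "W n m + 1 / 2 \<noteq> 0" for n m
  proof -
    have *: "W n m ^ 2 - 1 / 4 = (W n m - 1 / 2) * (W n m + 1 / 2)"
      by (simp add: field_simps power2_eq_square)
    show ?thesis unfolding * using that by (simp add: divide_simps)
  qed
  have notint: "of_int n * z + 1 / 2 \<notin> \<int>" "of_int n * z - 1 / 2 \<notin> \<int>" for n
  proof -
    have half: "(1 / 2 :: complex) \<notin> \<int>"
      using fraction_not_in_Ints[of 2 1, where 'a = complex] by simp
    show 1: "of_int n * z + 1 / 2 \<notin> \<int>" for n
    proof (cases "n = 0")
      case False
      thus ?thesis using z by (auto simp: complex_is_Int_iff)
    qed (use half in auto)
    have "of_int n * z - 1 / 2 = of_int n * z + 1 / 2 - 1" by simp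
    thus "of_int n * z - 1 / 2 \<notin> \<int>" using 1[of n] by (metis Ints_1 Ints_add diff_add_cancel)
  qed
  have Wnz: "W n m - 1 / 2 \<noteq> 0" "W n m + 1 / 2 \<noteq> 0" for n m
  proof -
    have "W n m - 1 / 2 = of_int m + (of_int n * z - 1 / 2)" "W n m + 1 / 2 = of_int m + (of_int n * z + 1 / 2)"
      by (simp_all add: W_def)
    thus "W n m - 1 / 2 \<noteq> 0" "W n m + 1 / 2 \<noteq> 0"
      using notint[of n] by (metis Ints_minus Ints_of_int add.inverse_unique)+
  qed
  have rows: "(c n has_sum eis_row n z) UNIV" for n
  proof -
    have "((\<lambda>m. 1 / W n m ^ 2) has_sum eis_row n z) UNIV"
      using has_sum_eis_row[OF z, of n] by (simp add: W_def)
    moreover have "((\<lambda>m. 1 / (W n m ^ 2 - 1 / 4)) has_sum 0) UNIV"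
    proof -
      have "cot (of_real pi * (of_int n * z + 1 / 2)) = cot (of_real pi * (of_int n * z - 1 / 2) + of_real pi)"
        by (rule arg_cong[where f = cot]) (simp add: algebra_simps)
      also have "\<dots> = cot (of_real pi * (of_int n * z - 1 / 2))"
        by (simp add: cot_def sin_add cos_add)
      finally have "((\<lambda>m::int. 1 / (of_int m + (of_int n * z - 1 / 2)) - 1 / (of_int m + (of_int n * z + 1 / 2))) has_sum 0) UNIV"
        using has_sum_cot_diff[OF notint(2,1), of n n] by simp
      thus ?thesis
        by (subst fac[OF Wnz]) (simp add: W_def algebra_simps)
    qed
    ultimately have "((\<lambda>m. 1 / W n m ^ 2 - 1 / (W n m ^ 2 - 1 / 4)) has_sum (eis_row n z - 0)) UNIV"
      by (rule has_sum_difference)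
    thus ?thesis by (simp add: c_def)
  qed
  \<comment> \<open>Column \<open>m\<close> at \<open>z\<close> is row \<open>-m\<close> at \<open>-1/z\<close>, scaled, since \<open>m + n z = z (n - m (-1/z))\<close>.\<close>
  have cols: "((\<lambda>n. c n m) has_sum (eis_row m (- 1 / z) / z ^ 2 - \<beta> m)) UNIV" for m
  proof -
    have "((\<lambda>n. 1 / z ^ 2 * (1 / (of_int n + of_int (- m) * (- 1 / z)) ^ 2)) has_sum 1 / z ^ 2 * eis_row (- m) (- 1 / z)) UNIV"
      by (intro has_sum_cmult_right has_sum_eis_row z')
    moreover have "1 / z ^ 2 * (1 / (of_int n + of_int (- m) * (- 1 / z)) ^ 2) = 1 / W n m ^ 2" for n
    proof -
      have "W n m = z * (of_int n + of_int (- m) * (- 1 / z))"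
        using z0 by (simp add: W_def field_simps)
      thus ?thesis by (simp add: power_mult_distrib)
    qed
    ultimately have 1: "((\<lambda>n. 1 / W n m ^ 2) has_sum eis_row m (- 1 / z) / z ^ 2) UNIV"
      by (simp add: eis_row_minus)
    have ni: "(of_int m - 1 / 2) / z \<notin> \<int>" "(of_int m + 1 / 2) / z \<notin> \<int>"
    proof -
      have "x / z \<notin> \<int>" if "\<And>n. x + of_int n * z \<noteq> 0" for x
      proof
        assume "x / z \<in> \<int>"
        then obtain k where "x / z = of_int k" by (auto elim: Ints_cases)
        hence "x + of_int (- k) * z = 0" using z0 by (simp add: field_simps)
        thus False using that by blast
      qed
      note * = this
      have "of_int m - 1 / 2 + of_int n * z \<noteq> 0" "of_int m + 1 / 2 + of_int n * z \<noteq> 0" for n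
        using Wnz[of n m] by (simp_all add: W_def algebra_simps)
      thus "(of_int m - 1 / 2) / z \<notin> \<int>" "(of_int m + 1 / 2) / z \<notin> \<int>" using * by blast+
    qed
    have "((\<lambda>n::int. 1 / z * (1 / (of_int n + (of_int m - 1 / 2) / z) - 1 / (of_int n + (of_int m + 1 / 2) / z))) has_sum
            1 / z * (of_real pi * cot (of_real pi * ((of_int m - 1 / 2) / z)) - of_real pi * cot (of_real pi * ((of_int m + 1 / 2) / z)))) UNIV"
      by (intro has_sum_cmult_right has_sum_cot_diff ni)
    moreover have "1 / z * (1 / (of_int n + (of_int m - 1 / 2) / z) - 1 / (of_int n + (of_int m + 1 / 2) / z)) = 1 / (W n m ^ 2 - 1 / 4)" for n
    proof -
      have "z * (of_int n + (of_int m - 1 / 2) / z) = W n m - 1 / 2" "z * (of_int n + (of_int m + 1 / 2) / z) = W n m + 1 / 2"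
        using z0 by (simp_all add: W_def field_simps)
      from this [symmetric] have "1 / (W n m - 1 / 2) = 1 / z * (1 / (of_int n + (of_int m - 1 / 2) / z))"
            "1 / (W n m + 1 / 2) = 1 / z * (1 / (of_int n + (of_int m + 1 / 2) / z))"
        by (simp_all only: mult_1 times_divide_eq_left times_divide_eq_right divide_divide_eq_left)
      thus ?thesis unfolding fac[OF Wnz] by (simp only: right_diff_distrib)
    qed
    ultimately have 2: "((\<lambda>n. 1 / (W n m ^ 2 - 1 / 4)) has_sum \<beta> m) UNIV"
      by (simp add: \<beta>_def algebra_simps)
    show ?thesis
      unfolding c_def by (rule has_sum_difference[OF 1 2])
  qed
  have swap: "infsum (\<lambda>n. infsum (c n) UNIV) UNIV = infsum (\<lambda>m. infsum (\<lambda>n. c n m) UNIV) UNIV"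
    using infsum_swap_banach[OF sm] by simp
  have "(\<lambda>(m, n). c n m) summable_on UNIV \<times> UNIV"
    using summable_on_swap[THEN iffD1, OF sm] by simp
  hence "(\<lambda>m. infsum (\<lambda>n. c n m) UNIV) summable_on UNIV"
    by (rule summable_on_Sigma_banach)
  hence "((\<lambda>m. infsum (\<lambda>n. c n m) UNIV) has_sum infsum (\<lambda>n. infsum (c n) UNIV) UNIV) UNIV"
    unfolding swap by (rule has_sum_infsum)
  also have "(\<lambda>n. infsum (c n) UNIV) = (\<lambda>n. eis_row n z)"
    by (intro ext infsumI rows)
  also have "infsum (\<lambda>n. eis_row n z) UNIV = G z"
    unfolding G_def by (rule infsumI[OF has_sum_eis_rows[OF z]])
  also have "(\<lambda>m. infsum (\<lambda>n. c n m) UNIV) = (\<lambda>m. eis_row m (- 1 / z) / z ^ 2 - \<beta> m)"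
    by (intro ext infsumI cols)
  finally have A: "((\<lambda>m. eis_row m (- 1 / z) / z ^ 2 - \<beta> m) has_sum G z) UNIV" .
  have B: "((\<lambda>m. 1 / z ^ 2 * eis_row m (- 1 / z)) has_sum 1 / z ^ 2 * G (- 1 / z)) UNIV"
    unfolding G_def by (intro has_sum_cmult_right has_sum_eis_rows z')
  have "(\<beta> has_sum (G (- 1 / z) / z ^ 2 - G z)) UNIV"
    using has_sum_difference[OF B A] by simp
  hence "(\<lambda>N. \<Sum>m\<in>{- int N..int N}. \<beta> m) \<longlonglongrightarrow> G (- 1 / z) / z ^ 2 - G z"
    by (rule has_sum_int_symmetric_limit)
  moreover have "(\<lambda>N. \<Sum>m\<in>{- int N..int N}. \<beta> m) = (\<lambda>N. - 2 * of_real pi / z * cot (of_real pi * ((of_nat N + 1 / 2) * (1 / z))))"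
  proof
    fix N
    have "cot (- x) = - cot x" for x :: complex by (simp add: cot_def)
    hence "cot (of_real pi * (- (of_nat N + 1 / 2) / z)) = - cot (of_real pi * ((of_nat N + 1 / 2) / z))"
      by (metis minus_divide_left mult_minus_right)
    thus "(\<Sum>m\<in>{- int N..int N}. \<beta> m) = - 2 * of_real pi / z * cot (of_real pi * ((of_nat N + 1 / 2) * (1 / z)))"
      unfolding \<beta>_def sum_int_symmetric_telescope[of "\<lambda>x. of_real pi / z * cot (of_real pi * (x / z))"] 
      by (simp only:) simp
  qed
  moreover have "(\<lambda>N. - 2 * of_real pi / z * cot (of_real pi * ((of_nat N + 1 / 2) * (1 / z)))) \<longlonglongrightarrow> - 2 * of_real pi / z * \<i>"
    using z' by (intro tendsto_mult_left cot_downwards_limit) (simp add: Im_divide)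
  ultimately have "G (- 1 / z) / z ^ 2 - G z = - 2 * of_real pi / z * \<i>"
    using LIMSEQ_unique by metis
  hence "z ^ 2 * (G (- 1 / z) / z ^ 2 - G z) = z ^ 2 * (- 2 * of_real pi / z * \<i>)"
    by simp
  moreover have "z ^ 2 * (- 2 * of_real pi / z * \<i>) = - 2 * of_real pi * \<i> * z"
    using z0 by (simp add: power2_eq_square)
  moreover have "z ^ 2 * (G (- 1 / z) / z ^ 2 - G z) = G (- 1 / z) - z ^ 2 * G z"
    using z0 by (simp add: right_diff_distrib)
  moreover have "of_real pi ^ 2 / 3 * (6 * z / (of_real pi * \<i>)) = - 2 * of_real pi * \<i> * z"
    by (simp add: power2_eq_square divide_simps)
  ultimately have "G (- 1 / z) = z ^ 2 * G z + of_real pi ^ 2 / 3 * (6 * z / (of_real pi * \<i>))"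
    by (simp only: diff_eq_eq add.commute)
  also have "\<dots> = of_real pi ^ 2 / 3 * (z ^ 2 * (1 - 24 * lambert_square (exp (2 * of_real pi * \<i> * z))) + 6 * z / (of_real pi * \<i>))"
    unfolding G_def distrib_left by (simp only: mult.left_commute)
  finally show ?thesis
    unfolding G_def by (subst (asm) mult_left_cancel) simp_all
qed

section \<open>The transformation law of the eta function\<close>
abbreviation nome :: "complex \<Rightarrow> complex" where "nome z \<equiv> exp (2 * of_real pi * \<i> * z)"

abbreviation upper_half_plane :: "complex set" where "upper_half_plane \<equiv> {z. Im z > 0}"

lemma open_upper_half_plane: "open upper_half_plane"
  by (rule open_halfspace_Im_gt)

lemma connected_upper_half_plane: "connected upper_half_plane"
  by (intro convex_connected convex_halfspace_Im_gt)

lemma nome_add_int: "nome (z + of_int n) = nome z"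
proof -
  have "nome (z + of_int n) = nome z * exp (2 * of_int n * of_real pi * \<i>)"
    by (simp add: ring_distribs exp_add mult_ac)
  moreover have "exp (2 * of_int n * of_real pi * \<i>) = 1"
    by (auto simp: exp_eq_1 intro!: exI[of _ n])
  ultimately show ?thesis by simp
qed

lemma nome_of_nat_mult: "nome (of_nat n * z) = nome z ^ n"
  unfolding exp_of_nat_mult [symmetric] by (simp add: mult_ac)

definition eisE2 :: "complex \<Rightarrow> complex" where
  "eisE2 z = 1 - 24 * lambert_square (nome z)"

lemma eisE2_inversion:
  assumes "Im z > 0"
  shows "eisE2 (- 1 / z) = z ^ 2 * eisE2 z + 6 * z / (of_real pi * \<i>)"
  unfolding eisE2_def by (rule lambert_square_inversion[OF assms])

lemma sums_Suc_mult_power: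
  fixes y :: "'a :: {real_normed_field, banach}"
  assumes "norm y < 1"
  shows "(\<lambda>k. of_nat (Suc k) * y ^ Suc k) sums (y / (1 - y) ^ 2)"
  using sums_mult[OF geometric_deriv_sums[OF assms], of y] by (simp add: mult_ac)

text \<open>Absolute convergence of the double series allows it to be summed in the other order, which gives
\<open>\<Sum> k q^k / (1 - q^k)\<close>, and along the divisors of \<open>n\<close>, which gives \<open>\<Sum> \<sigma>(n) q^n\<close>. The first form is the
logarithmic derivative of the Euler product, the second the usual expansion of \<open>E2\<close>.\<close>
lemma lambert_double_sum:
  fixes q :: complex
  assumes q: "norm q < 1"
  shows "((\<lambda>(k, m). of_nat (Suc k) * q ^ (Suc k * Suc m)) has_sum lambert_square q) UNIV"
proof -
  define F where "F = (\<lambda>(m, k). of_nat (Suc k) * q ^ (Suc k * Suc m))"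
  have pw: "norm q ^ Suc m < 1" for m
    using q power_Suc_less_one[of "norm q" m] by (cases "q = 0") auto
  have "(\<lambda>p. norm (F p)) summable_on (SIGMA m:UNIV. UNIV)"
  proof (rule summable_on_SigmaI)
    fix m :: nat
    have "(\<lambda>k. real (Suc k) * (norm q ^ Suc m) ^ Suc k) sums (norm q ^ Suc m / (1 - norm q ^ Suc m) ^ 2)"
      using sums_Suc_mult_power[of "norm q ^ Suc m"] pw by simp
    moreover have "norm (F (m, k)) = real (Suc k) * (norm q ^ Suc m) ^ Suc k" for k
      unfolding F_def prod.case norm_mult norm_power norm_of_nat by (simp only: power_mult [symmetric] mult.commute)
    ultimately have "(\<lambda>k. norm (F (m, k))) sums (norm q ^ Suc m / (1 - norm q ^ Suc m) ^ 2)"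
      by simp
    thus "((\<lambda>k. norm (F (m, k))) has_sum (norm q ^ Suc m / (1 - norm q ^ Suc m) ^ 2)) UNIV"
      by (rule sums_nonneg_imp_has_sum) simp
  next
    have "summable (\<lambda>m. norm (of_real (norm q) ^ Suc m / (1 - of_real (norm q) ^ Suc m) ^ 2 :: complex))"
      by (rule summable_lambert_square) (use q in simp)
    also have "(\<lambda>m. norm (of_real (norm q) ^ Suc m / (1 - of_real (norm q) ^ Suc m) ^ 2 :: complex)) =
               (\<lambda>m. norm (norm q ^ Suc m / (1 - norm q ^ Suc m) ^ 2))"
    proof
      fix m
      have "(of_real (norm q) ^ Suc m / (1 - of_real (norm q) ^ Suc m) ^ 2 :: complex) =
            of_real (norm q ^ Suc m / (1 - norm q ^ Suc m) ^ 2)" by simp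
      thus "norm (of_real (norm q) ^ Suc m / (1 - of_real (norm q) ^ Suc m) ^ 2 :: complex) =
            norm (norm q ^ Suc m / (1 - norm q ^ Suc m) ^ 2)"
        by (simp only: norm_of_real real_norm_def)
    qed
    finally show "(\<lambda>m. norm q ^ Suc m / (1 - norm q ^ Suc m) ^ 2) summable_on UNIV"
      by (rule norm_summable_imp_summable_on)
  qed auto
  hence sm: "F summable_on (SIGMA m:UNIV. UNIV)"
    by (rule summable_on_iff_abs_summable_on_complex [THEN iffD2])
  have "(F has_sum lambert_square q) (SIGMA m:UNIV. UNIV)"
  proof (rule has_sum_SigmaI[OF _ _ sm])
    fix m :: nat
    have p: "norm (q ^ Suc m) < 1" using pw by (simp only: norm_power)
    have "(\<lambda>k. of_nat (Suc k) * (q ^ Suc m) ^ Suc k) sums (q ^ Suc m / (1 - q ^ Suc m) ^ 2)"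
      by (rule sums_Suc_mult_power[OF p])
    moreover have "summable (\<lambda>k. norm (of_nat (Suc k) * (q ^ Suc m) ^ Suc k))"
      unfolding norm_mult norm_of_nat norm_power[of "q ^ Suc m"]
      by (rule sums_summable[OF sums_Suc_mult_power]) (use p in simp)
    ultimately have "((\<lambda>k. of_nat (Suc k) * (q ^ Suc m) ^ Suc k) has_sum (q ^ Suc m / (1 - q ^ Suc m) ^ 2)) UNIV"
      by (intro norm_summable_imp_has_sum)
    thus "((\<lambda>k. F (m, k)) has_sum (q ^ Suc m / (1 - q ^ Suc m) ^ 2)) UNIV"
      unfolding F_def prod.case by (simp only: power_mult [symmetric] mult.commute)
  next
    show "((\<lambda>m. q ^ Suc m / (1 - q ^ Suc m) ^ 2) has_sum lambert_square q) UNIV"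
      unfolding lambert_square_def
      by (intro norm_summable_imp_has_sum summable_lambert_square summable_sums q
                summable_norm_cancel[OF summable_lambert_square])
  qed
  hence "((\<lambda>(k, m). F (m, k)) has_sum lambert_square q) (UNIV \<times> UNIV)"
    by (rule has_sum_swap[THEN iffD1])
  thus ?thesis by (simp add: F_def)
qed

lemma lambert_square_sums_rows:
  fixes q :: complex
  assumes q: "norm q < 1"
  shows "(\<lambda>k. of_nat (Suc k) * q ^ Suc k / (1 - q ^ Suc k)) sums lambert_square q"
proof (rule has_sum_imp_sums, rule has_sum_SigmaD)
  show "((\<lambda>(k, m). of_nat (Suc k) * q ^ (Suc k * Suc m)) has_sum lambert_square q) (SIGMA k:UNIV. UNIV)"
    using lambert_double_sum[OF q] by simp
  fix k :: nat
  define y where "y = q ^ Suc k"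
  have y: "norm y < 1"
    using q power_Suc_less_one[of "norm q" k] by (cases "q = 0") (auto simp: y_def norm_power simp del: power_Suc)
  have "(\<lambda>m. of_nat (Suc k) * y * y ^ m) sums (of_nat (Suc k) * y * (1 / (1 - y)))"
    by (intro sums_mult geometric_sums y)
  moreover have "summable (\<lambda>m. norm (of_nat (Suc k) * y * y ^ m))"
    unfolding norm_mult norm_power using y by (intro summable_mult summable_geometric) auto
  ultimately have "((\<lambda>m. of_nat (Suc k) * y * y ^ m) has_sum (of_nat (Suc k) * y * (1 / (1 - y)))) UNIV"
    by (intro norm_summable_imp_has_sum)
  moreover have "of_nat (Suc k) * y * y ^ m = of_nat (Suc k) * q ^ (Suc k * Suc m)" for m
    unfolding y_def power_mult by (simp only: power_Suc mult.assoc)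
  ultimately show "((\<lambda>m. case (k, m) of (k, m) \<Rightarrow> of_nat (Suc k) * q ^ (Suc k * Suc m)) has_sum
                     (of_nat (Suc k) * q ^ Suc k / (1 - q ^ Suc k))) UNIV"
    by (simp only: prod.case y_def times_divide_eq_right mult_1_right)
qed

lemma lambert_square_power_series:
  fixes q :: complex
  assumes q: "norm q < 1"
  shows "(\<lambda>n. of_nat (if n = 0 then 0 else \<Sum>d | d dvd n. d) * q ^ n) sums lambert_square q"
proof (rule has_sum_imp_sums, rule has_sum_SigmaD)
  let ?B = "\<lambda>n::nat. if n = 0 then {} else {d. d dvd n}"
  define j :: "nat \<times> nat \<Rightarrow> nat \<times> nat" where "j = (\<lambda>(k, m). (Suc k * Suc m, Suc k))"
  define i :: "nat \<times> nat \<Rightarrow> nat \<times> nat" where "i = (\<lambda>(n, d). (d - 1, n div d - 1))"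
  have "((\<lambda>(k, m). of_nat (Suc k) * q ^ (Suc k * Suc m)) has_sum lambert_square q) UNIV =
        ((\<lambda>(n, d). of_nat d * q ^ n) has_sum lambert_square q) (SIGMA n:UNIV. ?B n)"
  proof (rule has_sum_reindex_bij_witness[where i = i and j = j])
    fix b assume "b \<in> (SIGMA n:UNIV. ?B n)"
    then obtain n d where b: "b = (n, d)" "d dvd n" "n > 0" by (auto split: if_splits)
    then obtain c where c: "n = d * c" by (auto elim: dvdE)
    then obtain d' c' where "d = Suc d'" "c = Suc c'" using b by (cases c; cases d) auto
    thus "j (i b) = b" "i b \<in> UNIV" using b c by (auto simp: i_def j_def simp del: mult_Suc mult_Suc_right)
  qed (auto simp: i_def j_def simp del: mult_Suc mult_Suc_right)
  thus "((\<lambda>(n, d). of_nat d * q ^ n) has_sum lambert_square q) (SIGMA n:UNIV. ?B n)"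
    using lambert_double_sum[OF q] by simp
  fix n :: nat
  have "((\<lambda>d. of_nat d * q ^ n) has_sum (\<Sum>d\<in>?B n. of_nat d * q ^ n)) (?B n)"
    by (intro has_sum_finite) (simp add: finite_divisors_nat)
  thus "((\<lambda>d. case (n, d) of (n, d) \<Rightarrow> of_nat d * q ^ n) has_sum
          (of_nat (if n = 0 then 0 else \<Sum>d | d dvd n. d) * q ^ n)) (?B n)"
    by (cases "n = 0") (simp_all add: sum_distrib_right)
qed

lemma dedekind_eta_euler_prod:
  "dedekind_eta z = exp (of_real pi * \<i> * z / 12) * euler_prod 1 (nome z)"
  using dedekind_eta_conv_euler_prod[of 1 z] by simp

lemma dedekind_eta_nonzero: "Im z > 0 \<Longrightarrow> dedekind_eta z \<noteq> 0"
  unfolding dedekind_eta_euler_prod using euler_prod_nonzero[of 1 "nome z"] by simp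

lemma euler_prod_uniform_limit:
  fixes r :: real
  assumes r: "0 < r" "r < 1"
  shows "uniform_limit (cball 0 r) (\<lambda>N q. \<Prod>n<N. 1 - q ^ Suc n) (euler_prod 1) sequentially"
proof -
  have "uniformly_convergent_on (cball 0 r) (\<lambda>N q. \<Prod>n<N. 1 - q ^ Suc n :: complex)"
  proof (rule uniformly_convergent_on_prod')
    show "uniformly_convergent_on (cball 0 r) (\<lambda>N q. \<Sum>n<N. norm (1 - q ^ Suc n - 1 :: complex))"
    proof (rule Weierstrass_m_test')
      show "summable (\<lambda>n. r * r ^ n)"
        using r by (intro summable_mult summable_geometric) simp
      fix n and q :: complex assume "q \<in> cball 0 r"
      hence "norm q ^ Suc n \<le> r ^ Suc n" by (intro power_mono) auto
      thus "norm (norm (1 - q ^ Suc n - 1)) \<le> r * r ^ n"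
        by (simp add: norm_power norm_mult)
    qed
  qed (auto intro!: continuous_intros)
  then obtain h where h: "uniform_limit (cball 0 r) (\<lambda>N q. \<Prod>n<N. 1 - q ^ Suc n :: complex) h sequentially"
    by (auto simp: uniformly_convergent_on_def)
  have "h q = euler_prod 1 q" if q: "q \<in> cball 0 r" for q
  proof (rule LIMSEQ_unique)
    show "(\<lambda>N. \<Prod>n<N. 1 - q ^ Suc n) \<longlonglongrightarrow> h q"
      using h q by (rule tendsto_uniform_limitI)
    have "(\<lambda>n. 1 - q ^ Suc n) has_prod euler_prod 1 q"
      using convergent_prod_has_prod[OF euler_prod_convergent[of 1 q]] q r by (simp add: euler_prod_def)
    thus "(\<lambda>N. \<Prod>n<N. 1 - q ^ Suc n) \<longlonglongrightarrow> euler_prod 1 q"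
      by (rule has_prod_imp_tendsto')
  qed
  thus ?thesis
    using h by (subst uniform_limit_cong'[where g = "\<lambda>N q. \<Prod>n<N. 1 - q ^ Suc n" and i = h]) auto
qed

lemma euler_prod_holomorphic: "euler_prod 1 holomorphic_on ball 0 1"
  using int_power_series_euler_prod[of 1] by (simp add: int_power_series_def)

lemma euler_prod_logderiv:
  assumes q: "norm q < 1"
  shows "q * deriv (euler_prod 1) q = - lambert_square q * euler_prod 1 q"
proof -
  define r where "r = (norm q + 1) / 2"
  have r: "0 < r" "r < 1" "norm q < r" using q by (auto simp: r_def intro: add_nonneg_pos)
  have nz: "euler_prod 1 q \<noteq> 0" by (rule euler_prod_nonzero) (use q in auto)
  have nz1: "1 - q ^ Suc k \<noteq> 0" for k
  proof -
    have "norm (q ^ Suc k) < 1" using q power_Suc_less_one[of "norm q" k] by (cases "q = 0") (auto simp: norm_power simp del: power_Suc)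
    thus ?thesis by auto
  qed
  have "(\<lambda>k. deriv (\<lambda>q. 1 - q ^ Suc k) q / (1 - q ^ Suc k)) sums (deriv (euler_prod 1) q / euler_prod 1 q)"
  proof (rule logderiv_prodinf_complex_uniform_limit[where A = "ball 0 r"])
    show "uniform_limit (ball 0 r) (\<lambda>n x. \<Prod>k<n. 1 - x ^ Suc k) (euler_prod 1) sequentially"
      by (rule uniform_limit_on_subset[OF euler_prod_uniform_limit[OF r(1,2)]]) auto
  qed (use r nz in \<open>auto intro!: holomorphic_intros\<close>)
  moreover have "deriv (\<lambda>q. 1 - q ^ Suc k) q = - of_nat (Suc k) * q ^ k" for k
    by (rule DERIV_imp_deriv) (rule derivative_eq_intros refl | simp add: algebra_simps)+
  ultimately have "(\<lambda>k. - (q * (- of_nat (Suc k) * q ^ k / (1 - q ^ Suc k)))) sums - (q * (deriv (euler_prod 1) q / euler_prod 1 q))"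
    by (intro sums_minus sums_mult) simp
  moreover have "- (q * (- of_nat (Suc k) * q ^ k / (1 - q ^ Suc k))) = of_nat (Suc k) * q ^ Suc k / (1 - q ^ Suc k)" for k
  proof -
    have "- (q * (- a * q ^ k / c)) = a * q ^ Suc k / c" for a c
      by (simp add: mult_ac)
    thus ?thesis .
  qed
  ultimately have "(\<lambda>k. of_nat (Suc k) * q ^ Suc k / (1 - q ^ Suc k)) sums - (q * (deriv (euler_prod 1) q / euler_prod 1 q))"
    by simp
  from sums_unique2[OF this lambert_square_sums_rows[OF q]] show ?thesis
    using nz by (simp add: field_simps) (metis minus_minus)
qed

lemma has_field_derivative_dedekind_eta:
  assumes z: "Im z > 0"
  shows "(dedekind_eta has_field_derivative (of_real pi * \<i> / 12 * eisE2 z * dedekind_eta z)) (at z)"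
proof -
  have q: "norm (nome z) < 1" using z by simp
  have E: "(euler_prod 1 has_field_derivative deriv (euler_prod 1) (nome z)) (at (nome z))"
    by (rule holomorphic_derivI[OF euler_prod_holomorphic]) (use q in auto)
  have "((\<lambda>z. exp (of_real pi * \<i> * z / 12) * euler_prod 1 (nome z)) has_field_derivative
      of_real pi * \<i> / 12 * exp (of_real pi * \<i> * z / 12) * euler_prod 1 (nome z) +
      exp (of_real pi * \<i> * z / 12) * (deriv (euler_prod 1) (nome z) * (2 * of_real pi * \<i> * nome z))) (at z)"
    by (rule derivative_eq_intros DERIV_chain2[where f = "euler_prod 1" and g = "\<lambda>z. nome z", OF E] refl | simp)+
  also have "of_real pi * \<i> / 12 * exp (of_real pi * \<i> * z / 12) * euler_prod 1 (nome z) +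
      exp (of_real pi * \<i> * z / 12) * (deriv (euler_prod 1) (nome z) * (2 * of_real pi * \<i> * nome z)) =
      exp (of_real pi * \<i> * z / 12) * of_real pi * \<i> *
        (1 / 12 * euler_prod 1 (nome z) + 2 * (nome z * deriv (euler_prod 1) (nome z)))"
    by (simp add: algebra_simps)
  also have "\<dots> = of_real pi * \<i> / 12 * eisE2 z * dedekind_eta z"
    unfolding euler_prod_logderiv[OF q] dedekind_eta_euler_prod eisE2_def by (simp add: algebra_simps)
  finally show ?thesis
    unfolding dedekind_eta_euler_prod [symmetric] .
qed

lemma dedekind_eta_holomorphic: "dedekind_eta holomorphic_on upper_half_plane"
  using has_field_derivative_dedekind_eta
  by (auto simp: holomorphic_on_open[OF open_upper_half_plane])

lemma Im_moebius:
  fixes a b c d :: real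
  assumes "a * d - b * c = 1"
  shows "Im ((of_real a * z + of_real b) / (of_real c * z + of_real d)) = Im z / norm (of_real c * z + of_real d) ^ 2"
proof -
  have "Im ((of_real a * z + of_real b) / (of_real c * z + of_real d)) =
        ((a * d - b * c) * Im z) / norm (of_real c * z + of_real d) ^ 2"
    unfolding Im_divide cmod_power2 by (simp add: algebra_simps)
  thus ?thesis using assms by simp
qed

lemma Im_neg_inverse: "Im z > 0 \<Longrightarrow> Im (- 1 / z) > 0"
  using Im_moebius[of 0 0 "-1" 1 z] by (cases "z = 0") auto

text \<open>Since \<open>\<eta>'/\<eta> = (\<pi>i/12) E2\<close>, the inversion formula for \<open>E2\<close> says that the quotient of the two sides has
derivative 0; the anomaly of \<open>E2\<close> is what the square root contributes. At the fixed point \<open>\<i>\<close> of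
the inversion the quotient is 1.\<close>
theorem dedekind_eta_inversion:
  assumes z: "Im z > 0"
  shows "dedekind_eta (- 1 / z) = csqrt (- \<i> * z) * dedekind_eta z"
proof -
  define R where "R = (\<lambda>z. dedekind_eta (- 1 / z) / (csqrt (- \<i> * z) * dedekind_eta z))"
  have dR: "(R has_field_derivative 0) (at z)" if z: "Im z > 0" for z
  proof -
    have z0: "z \<noteq> 0" using z by auto
    have nr: "- \<i> * z \<notin> \<real>\<^sub>\<le>\<^sub>0" using z by (auto simp: complex_nonpos_Reals_iff)
    define N D s where "N = dedekind_eta (- 1 / z)" and "D = dedekind_eta z" and "s = csqrt (- \<i> * z)"
    have s2: "s * s = - \<i> * z" unfolding s_def by (metis power2_csqrt power2_eq_square)
    have nz: "D \<noteq> 0" "s \<noteq> 0" using dedekind_eta_nonzero[OF z] z0 by (auto simp: D_def s_def)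
    have "((\<lambda>z. - 1 / z) has_field_derivative 1 / z ^ 2) (at z)"
      by (rule derivative_eq_intros refl | use z0 in \<open>simp add: power2_eq_square\<close>)+
    from DERIV_chain2[OF has_field_derivative_dedekind_eta[OF Im_neg_inverse[OF z]] this]
    have d1: "((\<lambda>z. dedekind_eta (- 1 / z)) has_field_derivative
            of_real pi * \<i> / 12 * eisE2 (- 1 / z) * N * (1 / z ^ 2)) (at z)"
      unfolding N_def .
    have d2: "((\<lambda>z. csqrt (- \<i> * z) * dedekind_eta z) has_field_derivative
            (- \<i> / (2 * s) * D + s * (of_real pi * \<i> / 12 * eisE2 z * D))) (at z)"
      unfolding s_def D_def
      by (rule derivative_eq_intros has_field_derivative_dedekind_eta z nr refl | simp)+
    have d3: "(R has_field_derivative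
       (of_real pi * \<i> / 12 * eisE2 (- 1 / z) * N * (1 / z ^ 2) * (s * D) -
        N * (- \<i> / (2 * s) * D + s * (of_real pi * \<i> / 12 * eisE2 z * D))) / ((s * D) * (s * D))) (at z)"
      unfolding R_def using DERIV_divide[OF d1 d2] nz by (simp add: N_def D_def s_def)
    have h: "- \<i> / (2 * s) = s * (1 / (2 * z))"
      using nz z0 s2 by (simp add: divide_simps)
    have k: "of_real pi * \<i> / 12 * eisE2 (- 1 / z) * (1 / z ^ 2) = of_real pi * \<i> / 12 * eisE2 z + 1 / (2 * z)"
      unfolding eisE2_inversion[OF z] using z0 by (simp add: divide_simps) (simp add: algebra_simps power2_eq_square)
    have "of_real pi * \<i> / 12 * eisE2 (- 1 / z) * N * (1 / z ^ 2) * (s * D) = 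
          (of_real pi * \<i> / 12 * eisE2 (- 1 / z) * (1 / z ^ 2)) * (N * s * D)"
      by (simp only: mult_ac)
    also have "\<dots> = N * (- \<i> / (2 * s) * D + s * (of_real pi * \<i> / 12 * eisE2 z * D))"
      unfolding k h by (simp only: ring_distribs mult_ac add_ac)
    finally show ?thesis using d3 by simp
  qed
  have "R constant_on upper_half_plane"
  proof (rule DERIV_zero_connected_constant_on[where K = "{}"])
    show "continuous_on upper_half_plane R"
      by (auto intro!: continuous_at_imp_continuous_on dest: dR[THEN DERIV_isCont])
  qed (use dR open_upper_half_plane connected_upper_half_plane in auto)
  then obtain c where c: "\<And>z. Im z > 0 \<Longrightarrow> R z = c"
    unfolding constant_on_def by blast
  have "R \<i> = 1"
    using dedekind_eta_nonzero[of \<i>] by (simp add: R_def)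
  with c[of \<i>] c[OF z] have "R z = 1" by simp
  thus ?thesis
    using dedekind_eta_nonzero[OF z] z by (auto simp: R_def divide_eq_1_iff)
qed

definition zeta24 :: "int \<Rightarrow> complex" where
  "zeta24 k = exp (of_int k * (of_real pi * \<i> / 12))"

lemma zeta24_add: "zeta24 (j + k) = zeta24 j * zeta24 k"
  by (simp add: zeta24_def ring_distribs exp_add add_divide_distrib)

lemma zeta24_0 [simp]: "zeta24 0 = 1"
  by (simp add: zeta24_def)

lemma zeta24_24: "zeta24 (24 * k) = 1"
proof -
  have "zeta24 (24 * k) = exp (2 * of_int k * of_real pi * \<i>)"
    unfolding zeta24_def by (rule arg_cong[where f = exp]) simp
  moreover have "exp (2 * of_int k * of_real pi * \<i>) = 1"
    by (auto simp: exp_eq_1 intro!: exI[of _ k])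
  ultimately show ?thesis by simp
qed

lemma zeta24_cong: "j mod 24 = k mod 24 \<Longrightarrow> zeta24 j = zeta24 k"
  by (metis mult_div_mod_eq mult_1 zeta24_24 zeta24_add)

lemma zeta24_nonzero [simp]: "zeta24 k \<noteq> 0"
  by (simp add: zeta24_def)

lemma dedekind_eta_add_int: "dedekind_eta (z + of_int n) = zeta24 n * dedekind_eta z"
proof -
  have "exp (of_real pi * \<i> * (z + of_int n) / 12) = zeta24 n * exp (of_real pi * \<i> * z / 12)"
    unfolding zeta24_def exp_add [symmetric] by (rule arg_cong[where f = exp]) (simp add: field_simps)
  thus ?thesis unfolding dedekind_eta_euler_prod nome_add_int by simp
qed

lemma Im_csqrt_less_Re:
  assumes "Re p > 0"
  shows "\<bar>Im (csqrt p)\<bar> < Re (csqrt p)"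
proof -
  define u where "u = csqrt p"
  have "Re (u ^ 2) = Re p" by (simp add: u_def)
  hence "\<not> (Re u) ^ 2 \<le> (Im u) ^ 2"
    using assms by (simp only: Re_power2)
  hence "\<not> \<bar>Re u\<bar> \<le> \<bar>Im u\<bar>"
    by (simp only: abs_le_square_iff) simp
  moreover have "Re u \<ge> 0" using csqrt_principal[of p] by (auto simp only: u_def)
  ultimately show ?thesis unfolding u_def [symmetric] by linarith
qed

text \<open>Both sides have the same square. Square roots of numbers in the right half plane have argument less
than \<open>\<pi>/4\<close> in absolute value, so \<open>csqrt x * csqrt y\<close> lies in the right half plane, and so does
\<open>csqrt w\<close> turned by \<open>\<pi>/4\<close>. This excludes the opposite sign and makes the multiplier of \<open>\<eta>\<close>
computable without case distinctions.\<close>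
lemma csqrt_mult_quarter_turn:
  assumes "Re x > 0" "Re y > 0" "Re w > 0" "x * y = \<i> * w"
  shows "csqrt x * csqrt y = zeta24 3 * csqrt w"
proof -
  have z3: "zeta24 3 = exp (\<i> * of_real (pi / 4))"
    unfolding zeta24_def by (rule arg_cong[where f = exp]) simp
  have z3': "zeta24 3 = of_real (sqrt 2 / 2) * (1 + \<i>)"
    unfolding z3 exp_Euler cos_of_real sin_of_real cos_45 sin_45 by (simp add: algebra_simps)
  have "(zeta24 3) ^ 2 = \<i>"
    unfolding z3' by (simp add: power2_eq_square algebra_simps complex_eq_iff)
  moreover define X Y W where "X = csqrt x" and "Y = csqrt y" and "W = csqrt w"
  have sq: "X ^ 2 = x" "Y ^ 2 = y" "W ^ 2 = w" by (simp_all add: X_def Y_def W_def)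
  ultimately have "(X * Y) ^ 2 = (zeta24 3 * W) ^ 2"
    using assms(4) unfolding power_mult_distrib sq by simp
  hence or: "X * Y = zeta24 3 * W \<or> X * Y = - (zeta24 3 * W)"
    by (simp only: power2_eq_iff)
  have b: "\<bar>Im X\<bar> < Re X" "\<bar>Im Y\<bar> < Re Y" "\<bar>Im W\<bar> < Re W"
    unfolding X_def Y_def W_def by (intro Im_csqrt_less_Re assms)+
  have "\<bar>Im X\<bar> * \<bar>Im Y\<bar> < Re X * Re Y"
    using b by (intro mult_strict_mono) auto
  hence 1: "Re (X * Y) > 0"
    using abs_ge_self[of "Im X * Im Y"] by (simp add: abs_mult)
  have "Re (zeta24 3 * W) = sqrt 2 / 2 * (Re W - Im W)"
    unfolding z3' by (simp add: algebra_simps)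
  also have "\<dots> > 0" using b(3) by simp
  finally have 2: "Re (zeta24 3 * W) > 0" .
  have "X * Y \<noteq> - (zeta24 3 * W)"
  proof
    assume "X * Y = - (zeta24 3 * W)"
    hence "Re (X * Y) = - Re (zeta24 3 * W)" by (simp only: uminus_complex.sel)
    with 1 2 show False by linarith
  qed
  with or show ?thesis unfolding X_def [symmetric] Y_def [symmetric] W_def [symmetric] by auto
qed

text \<open>The 24th root of unity in the transformation law of \<open>\<eta>\<close>, as an exponent. The recursion is the
Euclidean algorithm on the first column: with \<open>k = a div c\<close>, translation by \<open>k\<close> contributes \<open>k\<close>, and
an inversion contributes 3 by \<open>csqrt_mult_quarter_turn\<close>. The last inversion needs no
comparison of square roots and contributes nothing. Only \<open>c > 0\<close> is meaningful; the value 0 for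
\<open>c \<le> 0\<close> is a dummy.\<close>
function eta_phase :: "int \<Rightarrow> int \<Rightarrow> int \<Rightarrow> int \<Rightarrow> int" where
  "eta_phase a b c d =
     (if c \<le> 0 then 0
      else if a mod c = 0 then a div c + d
      else a div c + 3 + eta_phase (- c) (- d) (a mod c) (b - (a div c) * d))"
  by auto
termination
proof (relation "Wellfounded.measure (\<lambda>(a, b, c, d). nat c)")
  fix a b c d :: int
  assume "\<not> c \<le> 0"
  thus "((- c, - d, a mod c, b - a div c * d), a, b, c, d) \<in> Wellfounded.measure (\<lambda>(a, b, c, d). nat c)"
    using pos_mod_bound[of c a] pos_mod_sign[of c a] by auto
qed auto

declare eta_phase.simps [simp del]

theorem dedekind_eta_modular:
  assumes "a * d - b * c = 1" "c > 0" "Im z > 0"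
  shows "dedekind_eta ((of_int a * z + of_int b) / (of_int c * z + of_int d)) =
         zeta24 (eta_phase a b c d) * csqrt (- \<i> * (of_int c * z + of_int d)) * dedekind_eta z"
  using assms
proof (induction a b c d rule: eta_phase.induct)
  case (1 a b c d)
  define k a' b' where "k = a div c" and "a' = a mod c" and "b' = b - (a div c) * d"
  have a: "a = k * c + a'" by (simp add: k_def a'_def)
  have b: "b = k * d + b'" by (simp add: k_def b'_def)
  have a': "0 \<le> a'" using 1 by (simp add: a'_def)
  have det: "a' * d - b' * c = 1" using "1.prems"(1) unfolding a b by (simp add: algebra_simps)
  define W where "W = of_int c * z + of_int d"
  have W: "W \<noteq> 0" "Im W > 0"
    using 1 by (auto simp: W_def complex_eq_iff)
  have split: "(of_int a * z + of_int b) / W = (of_int a' * z + of_int b') / W + of_int k"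
    using W unfolding a b by (simp add: field_simps) (simp add: W_def algebra_simps)
  have shift: "dedekind_eta ((of_int a * z + of_int b) / W) = zeta24 k * dedekind_eta ((of_int a' * z + of_int b') / W)"
    unfolding split by (rule dedekind_eta_add_int)
  show ?case
  proof (cases "a' = 0")
    case True
    \<comment> \<open>Here \<open>c = 1\<close>, and the matrix is \<open>T^k S T^d\<close> with \<open>T\<close> the translation by 1 and \<open>S\<close> the inversion.\<close>
    have bc: "b' * c = - 1" using det True by simp
    hence "c dvd 1" by (metis dvd_minus_iff dvd_triv_right)
    hence c: "c = 1" using 1 by simp
    hence b'1: "b' = - 1" using bc by simp
    have "dedekind_eta (- 1 / W) = csqrt (- \<i> * W) * dedekind_eta W"
      by (rule dedekind_eta_inversion[OF W(2)])
    also have "dedekind_eta W = zeta24 d * dedekind_eta z"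
      unfolding W_def c using dedekind_eta_add_int[of z d] by simp
    finally show ?thesis
      using shift True c b'1 "1.prems" unfolding W_def [symmetric] eta_phase.simps[of a b c d]
      by (simp add: a'_def k_def zeta24_add mult_ac)
  next
    case False
    hence a'pos: "a' > 0" using a' by simp
    define V where "V = of_int a' * z + of_int b'"
    have V: "V \<noteq> 0" "Im V > 0"
      using 1 a'pos by (auto simp: V_def complex_eq_iff)
    define w where "w = (of_int (- c) * z + of_int (- d)) / V"
    have detR: "real_of_int (- c) * real_of_int b' - real_of_int (- d) * real_of_int a' = 1"
    proof -
      have "real_of_int (a' * d - b' * c) = 1" unfolding det by simp
      thus ?thesis by (simp add: algebra_simps)
    qed
    have "Im w = Im z / norm V ^ 2"
      using Im_moebius[OF detR, of z] by (simp add: w_def V_def)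
    hence w: "Im w > 0" using V 1 by simp
    have IH: "dedekind_eta w = zeta24 (eta_phase (- c) (- d) a' b') * csqrt (- \<i> * V) * dedekind_eta z"
      unfolding w_def V_def a'_def b'_def
    proof (rule "1.IH")
      show "\<not> c \<le> 0" "a mod c \<noteq> 0" using "1.prems" False by (auto simp: a'_def)
      show "- c * (b - a div c * d) - - d * (a mod c) = 1"
        using det by (simp add: a'_def b'_def algebra_simps)
    qed (use a'pos "1.prems" in \<open>simp_all add: a'_def\<close>)
    have wV: "w = - W / V" by (simp add: w_def W_def)
    have "V / W = - 1 / w"
      using V W by (simp add: wV)
    hence "(of_int a' * z + of_int b') / W = - 1 / w" by (simp only: V_def)
    hence "dedekind_eta ((of_int a' * z + of_int b') / W) = csqrt (- \<i> * w) * dedekind_eta w"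
      using dedekind_eta_inversion[OF w] by simp
    also have "\<dots> = zeta24 (eta_phase (- c) (- d) a' b') * (csqrt (- \<i> * w) * csqrt (- \<i> * V)) * dedekind_eta z"
      unfolding IH by (simp only: mult_ac)
    also have "csqrt (- \<i> * w) * csqrt (- \<i> * V) = zeta24 3 * csqrt (- \<i> * W)"
    proof (rule csqrt_mult_quarter_turn)
      have "w * V = - W" using V by (simp add: wV)
      moreover have "- \<i> * w * (- \<i> * V) = - (w * V)"
        by (simp add: complex_eq_iff)
      ultimately show "- \<i> * w * (- \<i> * V) = \<i> * (- \<i> * W)" by simp
    qed (use w V W in simp_all)
    finally show ?thesis
      using False "1.prems" shift unfolding W_def [symmetric] eta_phase.simps[of a b c d]
      by (simp add: a'_def b'_def k_def zeta24_add mult_ac)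
  qed
qed

section \<open>Sums of two products and Besge's formula\<close>
text \<open>The divisor sum with the value 0 at 0, where the set of divisors is infinite. The values
are coefficients of power series whose constant term is treated separately.\<close>
definition divsum :: "nat \<Rightarrow> nat \<Rightarrow> nat" where
  "divsum k n = (if n = 0 then 0 else \<Sum>d | d dvd n. d ^ k)"

definition bilinear_quads :: "nat \<Rightarrow> (nat \<times> nat \<times> nat \<times> nat) set" where
  "bilinear_quads n = {(a, x, b, y). 0 < a \<and> 0 < x \<and> 0 < b \<and> 0 < y \<and> a * x + b * y = n}"

lemma finite_bilinear_quads: "finite (bilinear_quads n)"
proof (rule finite_subset)
  show "bilinear_quads n \<subseteq> {..n} \<times> {..n} \<times> {..n} \<times> {..n}"
  proof
    fix p assume "p \<in> bilinear_quads n"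
    then obtain a x b y where p: "p = (a, x, b, y)"
      and *: "0 < a" "0 < x" "0 < b" "0 < y" "a * x + b * y = n" by (auto simp: bilinear_quads_def)
    have "a \<le> a * x" "x \<le> a * x" "b \<le> b * y" "y \<le> b * y"
      using * by simp_all
    hence "a \<le> n" "x \<le> n" "b \<le> n" "y \<le> n" using *(5) by linarith+
    thus "p \<in> {..n} \<times> {..n} \<times> {..n} \<times> {..n}" by (simp add: p)
  qed
qed auto

lemma sum_bilinear_quads_split:
  fixes f :: "nat \<times> nat \<times> nat \<times> nat \<Rightarrow> int" and u v :: "nat \<times> nat \<times> nat \<times> nat \<Rightarrow> nat"
  shows "sum f (bilinear_quads n) = sum f {p \<in> bilinear_quads n. u p < v p} +
           sum f {p \<in> bilinear_quads n. u p = v p} + sum f {p \<in> bilinear_quads n. u p > v p}"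
proof -
  have "bilinear_quads n = ({p \<in> bilinear_quads n. u p < v p} \<union> {p \<in> bilinear_quads n. u p = v p}) \<union> {p \<in> bilinear_quads n. u p > v p}"
    by auto
  also have "sum f \<dots> = sum f ({p \<in> bilinear_quads n. u p < v p} \<union> {p \<in> bilinear_quads n. u p = v p}) + sum f {p \<in> bilinear_quads n. u p > v p}"
    by (rule sum.union_disjoint) (use finite_bilinear_quads in auto)
  also have "sum f ({p \<in> bilinear_quads n. u p < v p} \<union> {p \<in> bilinear_quads n. u p = v p}) =
     sum f {p \<in> bilinear_quads n. u p < v p} + sum f {p \<in> bilinear_quads n. u p = v p}"
    by (rule sum.union_disjoint) (use finite_bilinear_quads in auto)
  finally show ?thesis .
qed

lemma sum_divsum_convolution:
  "int (\<Sum>i\<le>n. divsum 1 i * divsum 1 (n - i)) = (\<Sum>(a, x, b, y)\<in>bilinear_quads n. int a * int b)"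
proof -
  define D where "D = (\<lambda>i::nat. if i = 0 then {} else {d. d dvd i})"
  have fin: "finite (D i)" for i by (auto simp: D_def finite_divisors_nat)
  have ds: "int (divsum 1 i) = (\<Sum>d\<in>D i. int d)" for i
    by (simp add: divsum_def D_def)
  have "int (\<Sum>i\<le>n. divsum 1 i * divsum 1 (n - i)) = (\<Sum>i\<le>n. \<Sum>(a, b)\<in>D i \<times> D (n - i). int a * int b)"
    by (simp only: of_nat_sum of_nat_mult ds sum_product sum.cartesian_product)
  also have "\<dots> = (\<Sum>(i, (a, b))\<in>(SIGMA i:{..n}. D i \<times> D (n - i)). int a * int b)"
    by (subst sum.Sigma) (auto simp: fin)
  also have "\<dots> = (\<Sum>(a, x, b, y)\<in>bilinear_quads n. int a * int b)"
    by (rule sum.reindex_bij_witness[of _ "\<lambda>(a, x, b, y). (a * x, (a, b))" "\<lambda>(i, (a, b)). (a, i div a, b, (n - i) div b)"])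
       (auto simp: bilinear_quads_def D_def elim!: dvdE split: if_splits intro!: Nat.gr0I)
  finally show ?thesis .
qed

lemma six_sum_squares: "6 * (\<Sum>l = 1..<d. int l ^ 2) = 2 * int d ^ 3 - 3 * int d ^ 2 + int d"
proof (induction d)
  case (Suc d)
  show ?case
  proof (cases "d = 0")
    case False
    hence "{1..<Suc d} = insert d {1..<d}" by auto
    thus ?thesis using Suc by (simp add: algebra_simps power2_eq_square power3_eq_cube)
  qed auto
qed auto

text \<open>Following Liouville, the convolution is \<open>\<Sum> a b\<close> over the solutions of \<open>a x + b y = n\<close> in positive integers, and
\<open>4 a b = (a + b)^2 - (a - b)^2\<close>. The identity \<open>a x + b y = a (x - y) + (a + b) y\<close> maps solutions with \<open>x > y\<close>
to solutions with \<open>a < b\<close> and replaces \<open>a + b\<close> by \<open>b\<close>; read backwards it replaces \<open>b - a\<close> by \<open>b\<close>.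
Together with the analogous maps for the other regions it turns both sums of squares into sums of \<open>b^2\<close> over parts of the
solution set. These cancel, and what is left comes from the diagonals \<open>x = y\<close> and \<open>a = b\<close>, where the
sums run over divisors of \<open>n\<close>.\<close>
theorem besge_identity:
  "12 * int (\<Sum>i\<le>n. divsum 1 i * divsum 1 (n - i)) = 5 * int (divsum 3 n) + int (divsum 1 n) - 6 * int n * int (divsum 1 n)"
proof (cases "n = 0")
  case True
  thus ?thesis by (simp add: divsum_def)
next
  case False
  define S where "S = bilinear_quads n"
  note S = S_def bilinear_quads_def
  define X where "X = {(a, x, b, y). (a, x, b, y) \<in> S \<and> y < x}"
  define X' where "X' = {(a, x, b, y). (a, x, b, y) \<in> S \<and> x < y}"
  define X0 where "X0 = {(a, x, b, y). (a, x, b, y) \<in> S \<and> x = y}"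
  define A where "A = {(a, x, b, y). (a, x, b, y) \<in> S \<and> a < b}"
  define A' where "A' = {(a, x, b, y). (a, x, b, y) \<in> S \<and> b < a}"
  define A0 where "A0 = {(a, x, b, y). (a, x, b, y) \<in> S \<and> a = b}"
  have splitX: "sum f S = sum f X' + sum f X0 + sum f X" for f :: "_ \<Rightarrow> int"
    unfolding S_def sum_bilinear_quads_split[of f n "\<lambda>(a, x, b, y). x" "\<lambda>(a, x, b, y). y"] X_def X'_def X0_def
    by (intro arg_cong2[where f = "(+)"] sum.cong) auto
  have splitA: "sum f S = sum f A + sum f A0 + sum f A'" for f :: "_ \<Rightarrow> int"
    unfolding S_def sum_bilinear_quads_split[of f n "\<lambda>(a, x, b, y). a" "\<lambda>(a, x, b, y). b"] A_def A'_def A0_def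
    by (intro arg_cong2[where f = "(+)"] sum.cong) auto
  define B where "B = (\<Sum>(a, x, b, y)\<in>A. int b ^ 2)"
  have e1: "(\<Sum>(a, x, b, y)\<in>X. (int a + int b) ^ 2) = B"
    unfolding B_def
    by (rule sum.reindex_bij_witness[of _ "\<lambda>(a, x, b, y). (a, x + y, b - a, y)" "\<lambda>(a, x, b, y). (a, x - y, a + b, y)"])
       (auto simp: X_def A_def S algebra_simps dest!: less_imp_Suc_add)
  have e2: "(\<Sum>(a, x, b, y)\<in>X'. (int a + int b) ^ 2) = B"
    unfolding B_def
    by (rule sum.reindex_bij_witness[of _ "\<lambda>(a, x, b, y). (b - a, y, a, x + y)" "\<lambda>(a, x, b, y). (b, y - x, a + b, x)"])
       (auto simp: X'_def A_def S algebra_simps dest!: less_imp_Suc_add)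
  have e3: "(\<Sum>(a, x, b, y)\<in>A. (int a - int b) ^ 2) = (\<Sum>(a, x, b, y)\<in>X. int b ^ 2)"
    by (rule sum.reindex_bij_witness[of _ "\<lambda>(a, x, b, y). (a, x - y, a + b, y)" "\<lambda>(a, x, b, y). (a, x + y, b - a, y)"])
       (auto simp: X_def A_def S algebra_simps power2_eq_square of_nat_diff dest!: less_imp_Suc_add)
  have e4: "(\<Sum>(a, x, b, y)\<in>A'. (int a - int b) ^ 2) = (\<Sum>(a, x, b, y)\<in>X. int b ^ 2)"
    by (rule sum.reindex_bij_witness[of _ "\<lambda>(a, x, b, y). (a + b, y, a, x - y)" "\<lambda>(a, x, b, y). (b, x + y, a - b, x)"])
       (auto simp: X_def A'_def S algebra_simps power2_eq_square of_nat_diff dest!: less_imp_Suc_add)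
  \<comment> \<open>Comparing two splittings of \<open>\<Sum> b^2\<close>: the parts \<open>b < a\<close> and \<open>x < y\<close> agree, hence the parts
      \<open>x > y\<close> and \<open>a < b\<close> differ only by diagonal terms.\<close>
  have e5: "(\<Sum>(a, x, b, y)\<in>A'. int b ^ 2) = (\<Sum>(a, x, b, y)\<in>X'. int b ^ 2)"
    by (rule sum.reindex_bij_witness[of _ "\<lambda>(a, x, b, y). (a + b, x, b, y - x)" "\<lambda>(a, x, b, y). (a - b, x, b, x + y)"])
       (auto simp: X'_def A'_def S algebra_simps dest!: less_imp_Suc_add)
  have e6: "(\<Sum>(a, x, b, y)\<in>A0. (int a - int b) ^ 2) = 0"
    by (intro sum.neutral) (auto simp: A0_def)
  have diag: "(\<Sum>(a, x, b, y)\<in>X0. f a b) = (\<Sum>d | d dvd n. \<Sum>a = 1..<d. f a (d - a))" for f :: "nat \<Rightarrow> nat \<Rightarrow> int"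
  proof -
    have "(\<Sum>d | d dvd n. \<Sum>a = 1..<d. f a (d - a)) = (\<Sum>(d, a)\<in>(SIGMA d:{d. d dvd n}. {1..<d}). f a (d - a))"
      by (subst sum.Sigma) (use False in \<open>auto simp: finite_divisors_nat\<close>)
    also have "\<dots> = (\<Sum>(a, x, b, y)\<in>X0. f a b)"
      by (rule sum.reindex_bij_witness[of _ "\<lambda>(a, x, b, y). (a + b, a)" "\<lambda>(d, a). (a, n div d, d - a, n div d)"])
         (use False in \<open>auto simp: X0_def S simp flip: distrib_right elim!: dvdE\<close>)
    finally show ?thesis ..
  qed
  have e7: "(\<Sum>(a, x, b, y)\<in>A0. int b ^ 2) = (\<Sum>d | d dvd n. int n * int d - int d ^ 2)"
  proof -
    have "(\<Sum>d | d dvd n. int n * int d - int d ^ 2) = (\<Sum>d | d dvd n. \<Sum>x = 1..<n div d. int d ^ 2)"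
    proof (rule sum.cong)
      fix d assume "d \<in> {d. d dvd n}"
      then obtain c where c: "n = d * c" by (auto elim: dvdE)
      hence "c > 0" "d > 0" using False by auto
      thus "int n * int d - int d ^ 2 = (\<Sum>x = 1..<n div d. int d ^ 2)"
        by (simp add: c of_nat_diff algebra_simps power2_eq_square)
    qed auto
    also have "\<dots> = (\<Sum>(d, x)\<in>(SIGMA d:{d. d dvd n}. {1..<n div d}). int d ^ 2)"
      by (subst sum.Sigma) (use False in \<open>auto simp: finite_divisors_nat\<close>)
    also have "\<dots> = (\<Sum>(a, x, b, y)\<in>A0. int b ^ 2)"
      by (rule sum.reindex_bij_witness[of _ "\<lambda>(a, x, b, y). (a, x)" "\<lambda>(d, x). (d, x, d, n div d - x)"])
         (use False in \<open>auto simp: A0_def S elim!: dvdE simp flip: distrib_left\<close>)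
    finally show ?thesis ..
  qed
  have e8: "(\<Sum>(a, x, b, y)\<in>X0. int b ^ 2) = (\<Sum>d | d dvd n. \<Sum>l = 1..<d. int l ^ 2)"
  proof -
    have "(\<Sum>a = 1..<d. int (d - a) ^ 2) = (\<Sum>l = 1..<d. int l ^ 2)" for d
      by (rule sum.reindex_bij_witness[of _ "\<lambda>l. d - l" "\<lambda>l. d - l"]) auto
    thus ?thesis using diag[of "\<lambda>a b. int b ^ 2"] by simp
  qed
  have e9: "(\<Sum>(a, x, b, y)\<in>X0. (int a + int b) ^ 2) = (\<Sum>d | d dvd n. int d ^ 3 - int d ^ 2)"
  proof -
    have "(\<Sum>a = 1..<d. (int a + int (d - a)) ^ 2) = int d ^ 3 - int d ^ 2" if "d dvd n" for d
    proof -
      have "d > 0" using that False by (auto intro: Nat.gr0I)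
      have "(\<Sum>a = 1..<d. (int a + int (d - a)) ^ 2) = (\<Sum>a = 1..<d. int d ^ 2)"
        by (intro sum.cong) auto
      thus ?thesis using \<open>d > 0\<close> by (simp add: of_nat_diff algebra_simps power2_eq_square power3_eq_cube)
    qed
    thus ?thesis using diag[of "\<lambda>a b. (int a + int b) ^ 2"] by simp
  qed
  have lin: "12 * u = 3 * p - 6 * v + 6 * w" if "4 * u = 2 * B + p - 2 * (B + v - w)" for u p v w :: int
  proof -
    have "12 * u = 3 * (4 * u)" by simp
    thus ?thesis unfolding that by simp
  qed
  have "4 * (\<Sum>(a, x, b, y)\<in>S. int a * int b) = (\<Sum>(a, x, b, y)\<in>S. (int a + int b) ^ 2) - (\<Sum>(a, x, b, y)\<in>S. (int a - int b) ^ 2)"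
    unfolding sum_distrib_left sum_subtractf [symmetric]
    by (intro sum.cong) (auto simp: algebra_simps power2_eq_square)
  also have "(\<Sum>(a, x, b, y)\<in>S. (int a + int b) ^ 2) = 2 * B + (\<Sum>d | d dvd n. int d ^ 3 - int d ^ 2)"
    unfolding splitX e1 e2 e9 by simp
  also have "(\<Sum>(a, x, b, y)\<in>S. (int a - int b) ^ 2) = 2 * (\<Sum>(a, x, b, y)\<in>X. int b ^ 2)"
    unfolding splitA e3 e4 e6 by simp
  also have "(\<Sum>(a, x, b, y)\<in>X. int b ^ 2) = B + (\<Sum>d | d dvd n. int n * int d - int d ^ 2) - (\<Sum>d | d dvd n. \<Sum>l = 1..<d. int l ^ 2)"
    using splitX[of "\<lambda>(a, x, b, y). int b ^ 2"] splitA[of "\<lambda>(a, x, b, y). int b ^ 2"]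
    unfolding e5 e7 e8 B_def by simp
  finally have "12 * (\<Sum>(a, x, b, y)\<in>S. int a * int b) = 3 * (\<Sum>d | d dvd n. int d ^ 3 - int d ^ 2)
      - 6 * (\<Sum>d | d dvd n. int n * int d - int d ^ 2) + 6 * (\<Sum>d | d dvd n. \<Sum>l = 1..<d. int l ^ 2)"
    by (rule lin)
  also have "6 * (\<Sum>d | d dvd n. \<Sum>l = 1..<d. int l ^ 2) = (\<Sum>d | d dvd n. 6 * (\<Sum>l = 1..<d. int l ^ 2))"
    by (rule sum_distrib_left)
  also have "3 * (\<Sum>d | d dvd n. int d ^ 3 - int d ^ 2) - 6 * (\<Sum>d | d dvd n. int n * int d - int d ^ 2) +
      (\<Sum>d | d dvd n. 6 * (\<Sum>l = 1..<d. int l ^ 2)) = (\<Sum>d | d dvd n. 5 * int d ^ 3 + int d - 6 * int n * int d)"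
    unfolding six_sum_squares unfolding sum_distrib_left sum_subtractf [symmetric] sum.distrib [symmetric]
    by (intro sum.cong) (auto simp: algebra_simps)
  also have "\<dots> = 5 * int (divsum 3 n) + int (divsum 1 n) - 6 * int n * int (divsum 1 n)"
    using False by (simp add: divsum_def sum.distrib sum_subtractf sum_distrib_left)
  finally show ?thesis
    unfolding sum_divsum_convolution S_def .
qed

section \<open>Expansions in the nome\<close>
text \<open>The function on the upper half plane with the given Fourier series. Requiring the radius of
convergence at least 1 makes the relation closed under the ring operations without further
conditions.\<close>
definition qexp :: "(complex \<Rightarrow> complex) \<Rightarrow> complex fps \<Rightarrow> bool" where
  "qexp f F \<longleftrightarrow> fps_conv_radius F \<ge> 1 \<and> (\<forall>z. Im z > 0 \<longrightarrow> f z = eval_fps F (nome z))"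

lemma nome_surj:
  assumes "norm q < 1" "q \<noteq> 0"
  obtains z where "Im z > 0" "nome z = q"
proof
  define z where "z = Ln q / (2 * of_real pi * \<i>)"
  show e: "nome z = q" using assms by (simp add: z_def)
  have "norm q = exp (- 2 * pi * Im z)" by (subst e[symmetric]) simp
  thus "Im z > 0" using assms(1) by (simp add: zero_less_mult_iff)
qed

lemma nome_in_radius:
  assumes "qexp f F" "Im z > 0"
  shows "ereal (norm (nome z)) < fps_conv_radius F"
proof -
  have "ereal (norm (nome z)) < 1" using assms(2) by (simp add: one_ereal_def)
  also have "1 \<le> fps_conv_radius F" using assms(1) by (simp add: qexp_def)
  finally show ?thesis .
qed

lemma qexp_eval: "qexp f F \<Longrightarrow> Im z > 0 \<Longrightarrow> f z = eval_fps F (nome z)"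
  by (simp add: qexp_def)

lemma qexp_imp_sums:
  assumes "qexp f F" "Im z > 0"
  shows "(\<lambda>n. fps_nth F n * nome z ^ n) sums f z"
  using sums_eval_fps[OF nome_in_radius[OF assms]] qexp_eval[OF assms] by simp

lemma qexp_sumsI:
  assumes "\<And>z. Im z > 0 \<Longrightarrow> (\<lambda>n. fps_nth F n * nome z ^ n) sums f z"
  shows "qexp f F"
  unfolding qexp_def
proof (intro conjI allI impI)
  show "fps_conv_radius F \<ge> 1"
    unfolding fps_conv_radius_def
  proof (rule conv_radius_geI_ex)
    fix r :: real assume r: "0 < r" "ereal r < 1"
    obtain z where z: "Im z > 0" "nome z = of_real r"
      by (rule nome_surj[of "of_real r"]) (use r in \<open>auto simp: one_ereal_def\<close>)
    from sums_summable[OF assms[OF z(1)]] show "\<exists>w::complex. norm w = r \<and> summable (\<lambda>n. fps_nth F n * w ^ n)"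
      unfolding z(2) using r by (intro exI[of _ "of_real r"]) auto
  qed
  fix z :: complex assume "Im z > 0"
  thus "f z = eval_fps F (nome z)" using assms by (simp add: eval_fps_def sums_iff)
qed

lemma qexp_cong: "qexp f F \<Longrightarrow> (\<And>z. Im z > 0 \<Longrightarrow> f z = g z) \<Longrightarrow> qexp g F"
  by (simp add: qexp_def)

lemma qexp_const: "qexp (\<lambda>_. c) (fps_const c)"
  by (simp add: qexp_def)

lemma qexp_add:
  assumes "qexp f F" "qexp g G"
  shows "qexp (\<lambda>z. f z + g z) (F + G)"
  unfolding qexp_def
  using assms nome_in_radius[OF assms(1)] nome_in_radius[OF assms(2)] order.trans[OF _ fps_conv_radius_add[of F G]]
  by (auto simp: qexp_def eval_fps_add)

lemma qexp_diff:
  assumes "qexp f F" "qexp g G"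
  shows "qexp (\<lambda>z. f z - g z) (F - G)"
  unfolding qexp_def
  using assms nome_in_radius[OF assms(1)] nome_in_radius[OF assms(2)] order.trans[OF _ fps_conv_radius_diff[of F G]]
  by (auto simp: qexp_def eval_fps_diff)

lemma qexp_mult:
  assumes "qexp f F" "qexp g G"
  shows "qexp (\<lambda>z. f z * g z) (F * G)"
  unfolding qexp_def
  using assms nome_in_radius[OF assms(1)] nome_in_radius[OF assms(2)] order.trans[OF _ fps_conv_radius_mult[of F G]]
  by (auto simp: qexp_def eval_fps_mult)

lemma qexp_cmult: "qexp f F \<Longrightarrow> qexp (\<lambda>z. c * f z) (fps_const c * F)"
  by (intro qexp_mult qexp_const)

lemma qexp_power: "qexp f F \<Longrightarrow> qexp (\<lambda>z. f z ^ n) (F ^ n)"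
proof (induction n)
  case 0
  show ?case using qexp_const[of 1] by simp
qed (simp add: qexp_mult)

definition fps_dilate :: "nat \<Rightarrow> complex fps \<Rightarrow> complex fps" where
  "fps_dilate d F = Abs_fps (\<lambda>n. if d dvd n then fps_nth F (n div d) else 0)"

lemma qexp_dilate:
  assumes "qexp f F" "d > 0"
  shows "qexp (\<lambda>z. f (of_nat d * z)) (fps_dilate d F)"
proof (rule qexp_sumsI)
  fix z :: complex assume z: "Im z > 0"
  have "Im (of_nat d * z) > 0" using z assms by simp
  from qexp_imp_sums[OF assms(1) this]
  have "(\<lambda>n. fps_nth F n * nome z ^ (d * n)) sums f (of_nat d * z)"
    by (simp only: nome_of_nat_mult power_mult)
  also have "(\<lambda>n. fps_nth F n * nome z ^ (d * n)) = (\<lambda>n. fps_nth (fps_dilate d F) (d * n) * nome z ^ (d * n))"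
    using assms by (auto simp: fps_dilate_def)
  finally show "(\<lambda>n. fps_nth (fps_dilate d F) n * nome z ^ n) sums f (of_nat d * z)"
    by (subst (asm) sums_mono_reindex)
       (use assms in \<open>auto simp: strict_mono_def fps_dilate_def image_iff elim!: dvdE\<close>)
qed

lemma qexp_has_field_derivative:
  assumes "qexp f F" "Im z > 0"
  shows "(f has_field_derivative 2 * of_real pi * \<i> * eval_fps (fps_X * fps_deriv F) (nome z)) (at z)"
proof -
  have "(eval_fps F has_field_derivative eval_fps (fps_deriv F) (nome z)) (at (nome z))"
    by (rule has_field_derivative_eval_fps) (rule nome_in_radius[OF assms])
  moreover have "((\<lambda>z. nome z) has_field_derivative 2 * of_real pi * \<i> * nome z) (at z)"
    by (rule derivative_eq_intros refl | simp)+
  ultimately have "((\<lambda>z. eval_fps F (nome z)) has_field_derivative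
      eval_fps (fps_deriv F) (nome z) * (2 * of_real pi * \<i> * nome z)) (at z)"
    by (rule DERIV_chain2)
  moreover have "eval_fps (fps_X * fps_deriv F) (nome z) = nome z * eval_fps (fps_deriv F) (nome z)"
    using nome_in_radius[OF assms] less_le_trans[OF _ fps_conv_radius_deriv[of F]] by (subst eval_fps_mult) auto
  ultimately have "((\<lambda>z. eval_fps F (nome z)) has_field_derivative 2 * of_real pi * \<i> * eval_fps (fps_X * fps_deriv F) (nome z)) (at z)"
    by (simp add: mult_ac)
  thus ?thesis
    by (rule has_field_derivative_transform_within_open[OF _ open_upper_half_plane])
       (use assms in \<open>auto simp: qexp_def\<close>)
qed

lemma qexp_theta:
  assumes "qexp f F" "\<And>z. Im z > 0 \<Longrightarrow> (f has_field_derivative f' z) (at z)"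
  shows "qexp (\<lambda>z. f' z / (2 * of_real pi * \<i>)) (fps_X * fps_deriv F)"
  unfolding qexp_def
proof (intro conjI allI impI)
  have "1 \<le> min (fps_conv_radius (fps_X :: complex fps)) (fps_conv_radius (fps_deriv F))"
    using assms(1) order.trans[OF _ fps_conv_radius_deriv[of F]] by (auto simp: qexp_def)
  also have "\<dots> \<le> fps_conv_radius (fps_X * fps_deriv F)" by (rule fps_conv_radius_mult)
  finally show "1 \<le> fps_conv_radius (fps_X * fps_deriv F)" .
  fix z :: complex assume z: "Im z > 0"
  from DERIV_unique[OF assms(2)[OF z] qexp_has_field_derivative[OF assms(1) z]]
  show "f' z / (2 * of_real pi * \<i>) = eval_fps (fps_X * fps_deriv F) (nome z)" by simp
qed

lemma qexp_holomorphic: "qexp f F \<Longrightarrow> f holomorphic_on upper_half_plane"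
  using qexp_has_field_derivative by (auto simp: holomorphic_on_open[OF open_upper_half_plane])

lemma qexp_zero_iff:
  assumes "qexp f F" "\<And>z. Im z > 0 \<Longrightarrow> f z = 0"
  shows "F = 0"
proof (rule eval_fps_eqD)
  show "fps_conv_radius F > 0" using assms(1) by (auto simp: qexp_def intro: less_le_trans[of 0 1])
  have F1: "eval_fps F q = 0" if q: "norm q < 1" "q \<noteq> 0" for q
    using nome_surj[OF q] assms by (metis qexp_eval)
  have F0: "eval_fps F 0 = 0"
  proof -
    have "isCont (eval_fps F) 0"
      using assms(1) by (intro continuous_eval_fps) (auto simp: qexp_def zero_ereal_def[symmetric] intro: less_le_trans[of 0 1])
    hence "(eval_fps F \<longlongrightarrow> eval_fps F 0) (at 0)" by (simp add: isCont_def)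
    moreover have "eventually (\<lambda>q. eval_fps F q = 0) (at 0)"
      unfolding eventually_at by (intro exI[of _ 1]) (auto intro: F1)
    hence "(eval_fps F \<longlongrightarrow> 0) (at 0)" by (rule tendsto_eventually)
    ultimately show ?thesis by (rule tendsto_unique[rotated]) simp
  qed
  have "eventually (\<lambda>q. q \<in> ball 0 1) (nhds (0 :: complex))"
    by (rule eventually_nhds_in_open) auto
  thus "eventually (\<lambda>q. eval_fps F q = eval_fps 0 q) (nhds 0)"
    by eventually_elim (use F0 F1 in force)
qed simp

lemma qexp_eqI:
  assumes "qexp f F" "qexp f G"
  shows "F = G"
  using qexp_zero_iff[OF qexp_diff[OF assms]] by simp

text \<open>The filter of neighbourhoods of the cusp at infinity, uniformly in the real part.\<close>
definition at_i_infinity :: "complex filter" where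
  "at_i_infinity = filtercomap Im at_top"

lemma eventually_at_i_infinity_upper: "eventually (\<lambda>z. Im z > c) at_i_infinity"
  unfolding at_i_infinity_def by (intro eventually_filtercomapI eventually_gt_at_top)

lemma at_i_infinity_neq_bot: "at_i_infinity \<noteq> bot"
proof -
  have "surj Im" by (rule surjI[of _ "\<lambda>y. Complex 0 y"]) simp
  thus ?thesis unfolding at_i_infinity_def by (intro filtercomap_neq_bot_surj) auto
qed
lemma nome_tendsto_0: "((\<lambda>z. nome z) \<longlongrightarrow> 0) at_i_infinity"
proof -
  have "((\<lambda>y. exp (- (2 * pi) * y)) \<longlongrightarrow> 0) at_top"
    by (rule filterlim_compose[OF exp_at_bot]) (real_asymp | simp add: filterlim_tendsto_neg_mult_at_bot)
  hence "((\<lambda>z. exp (- (2 * pi) * Im z)) \<longlongrightarrow> 0) at_i_infinity"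
    unfolding at_i_infinity_def by (rule filterlim_compose[OF _ filterlim_filtercomap])
  hence "((\<lambda>z. norm (nome z)) \<longlongrightarrow> 0) at_i_infinity" by simp
  thus ?thesis by (rule tendsto_norm_zero_cancel)
qed

lemma tendsto_disc_function:
  assumes "isCont g 0"
  shows "((\<lambda>z. g (nome z)) \<longlongrightarrow> g 0) at_i_infinity"
  using isCont_tendsto_compose[OF assms nome_tendsto_0] .

lemma euler_prod_nome_tendsto: "((\<lambda>z. euler_prod 1 (nome z)) \<longlongrightarrow> 1) at_i_infinity"
  using tendsto_disc_function[of "euler_prod 1"] holomorphic_on_imp_continuous_on[OF euler_prod_holomorphic]
  by (simp add: continuous_on_eq_continuous_at euler_prod_0)
lemma qexp_tendsto:
  assumes "qexp f F"
  shows "(f \<longlongrightarrow> fps_nth F 0) at_i_infinity"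
proof -
  have "isCont (eval_fps F) 0"
    using assms(1) by (intro continuous_eval_fps) (auto simp: qexp_def zero_ereal_def[symmetric] intro: less_le_trans[of 0 1])
  from tendsto_disc_function[OF this] have "((\<lambda>z. eval_fps F (nome z)) \<longlongrightarrow> fps_nth F 0) at_i_infinity"
    by (simp add: eval_fps_at_0)
  thus ?thesis
    by (rule Lim_transform_eventually)
       (use eventually_at_i_infinity_upper[of 0] in eventually_elim, use assms in \<open>simp add: qexp_def\<close>)
qed

lemma qexp_shift:
  assumes "qexp f F" "\<And>i. i < m \<Longrightarrow> fps_nth F i = 0"
  shows "qexp (\<lambda>z. f z / nome z ^ m) (fps_shift m F)"
  unfolding qexp_def
proof (intro conjI allI impI)
  show "1 \<le> fps_conv_radius (fps_shift m F)" using assms(1) by (simp add: qexp_def)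
  fix z :: complex assume z: "Im z > 0"
  have "eval_fps F (nome z) = eval_fps (fps_shift m F * fps_X ^ m) (nome z)"
  proof -
    have "fps_shift m F * fps_X ^ m = F"
      by (rule fps_ext) (use assms(2) in \<open>auto simp: fps_X_power_mult_right_nth\<close>)
    thus ?thesis by simp
  qed
  also have "\<dots> = eval_fps (fps_shift m F) (nome z) * nome z ^ m"
    using nome_in_radius[OF assms(1) z] by (subst eval_fps_mult) auto
  finally show "f z / nome z ^ m = eval_fps (fps_shift m F) (nome z)"
    using qexp_eval[OF assms(1) z] by simp
qed

lemma qexp_order_bound:
  assumes "qexp f F" "\<And>i. i < m \<Longrightarrow> fps_nth F i = 0"
  shows "f \<in> O[at_i_infinity](\<lambda>z. nome z ^ m)"
  using qexp_tendsto[OF qexp_shift[OF assms]] by (rule bigoI_tendsto) auto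

section \<open>The cosets of the congruence subgroup of level 42\<close>
definition level_divisors :: "int list" where
  "level_divisors = [1, 2, 3, 6, 7, 14, 21, 42]"

text \<open>As 42 is squarefree, its divisors \<open>e\<close> are the widths of the cusps of \<open>\<Gamma>\<^sub>0(42)\<close>, one cusp for each; the
cosets over that cusp are indexed by \<open>j\<close> modulo \<open>e\<close>. At the coset \<open>(e, j)\<close> a function \<open>h(\<delta> z)\<close> becomes a
multiple of \<open>h\<close> at \<open>M z\<close>, where \<open>M\<close> has rows \<open>(a, a j)\<close> and \<open>(0, d)\<close> with \<open>d = gcd \<delta> e\<close> and
\<open>a = \<delta>/d\<close>. The inversion \<open>z \<mapsto> -1/z\<close> sends the coset \<open>(e, j)\<close> to \<open>(inv_width e j, inv_shift e j)\<close>; the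
Chinese remainder theorem determines the shift from its residues modulo the two factors of
\<open>inv_width e j\<close>.\<close>
definition inv_width :: "int \<Rightarrow> int \<Rightarrow> int" where
  "inv_width e j = (42 div e) * (e div gcd e j)"

definition inv_shift :: "int \<Rightarrow> int \<Rightarrow> int" where
  "inv_shift e j = hd (filter (\<lambda>x. x mod (42 div e) = 0 \<and> (j * x + 1) mod (e div gcd e j) = 0) [0..inv_width e j - 1])"

text \<open>These equations state that \<open>M S = \<gamma> M'\<close>, where \<open>S\<close> is the inversion, \<open>M\<close> and \<open>M'\<close> are the triangular
matrices with entries \<open>a, a j, d\<close> and \<open>a', a' j', d'\<close>, and \<open>\<gamma>\<close> has the entries \<open>A, B, C, D\<close> and determinant 1.\<close>
definition gamma_ok :: "int \<Rightarrow> int \<Rightarrow> int \<Rightarrow> int \<Rightarrow> int \<Rightarrow> int \<Rightarrow> int \<Rightarrow> int \<Rightarrow> int \<Rightarrow> int \<Rightarrow> bool" where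
  "gamma_ok a d a' d' j j' A B C D \<longleftrightarrow>
     A * D - B * C = 1 \<and> C > 0 \<and> A * a' = a * j \<and> A * a' * j' + B * d' = - a \<and> C * a' = d \<and> C * a' * j' + D * d' = 0"

text \<open>The entries passed to \<open>F\<close> are those of \<open>M S M'^(-1)\<close> for the divisor \<open>\<delta>\<close>. The divisions are exact in
the cases of interest, which is part of what \<open>gamma_ok\<close> verifies.\<close>
definition with_gamma where
  "with_gamma F e j e' j' \<delta> =
    (let d = gcd \<delta> e; a = \<delta> div d; d' = gcd \<delta> e'; a' = \<delta> div d' in
     F a d a' d' j j' (a * j * d' div \<delta>) (- a * a' * (j * j' + 1) div \<delta>) (d * d' div \<delta>) (- d * a' * j' div \<delta>))"
  for F :: "int \<Rightarrow> int \<Rightarrow> int \<Rightarrow> int \<Rightarrow> int \<Rightarrow> int \<Rightarrow> int \<Rightarrow> int \<Rightarrow> int \<Rightarrow> int \<Rightarrow> 'a"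

definition phase_at :: "int \<Rightarrow> int \<Rightarrow> int \<Rightarrow> int \<Rightarrow> int \<Rightarrow> int" where
  "phase_at = with_gamma (\<lambda>a d a' d' j j'. eta_phase)"

definition dot :: "int list \<Rightarrow> int list \<Rightarrow> int" where
  "dot x p = sum_list (map2 (*) x p)"

text \<open>An eta quotient is given by its exponents along \<open>level_divisors\<close>. The second list consists of
exponents, at the primes 2, 3 and 7, of the sign by which the expansion at the cosets of width \<open>e\<close>
differs from the normalised product; the sign is multiplicative in \<open>e\<close>.\<close>
definition eta_data :: "(int list \<times> int list) list" where
  "eta_data = [
     ([5, -1, 0, 0, 5, -1, 0, 0], [0, 0, 0]),
     ([2, 2, 0, 0, 2, 2, 0, 0], [0, 0, 0]),
     ([6, -2, 0, 0, -2, 6, 0, 0], [0, 0, 0]),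
     ([-2, 6, 0, 0, 6, -2, 0, 0], [0, 0, 0]),
     ([2, 2, 2, 2, 0, 0, 0, 0], [0, 0, 0]),
     ([0, 1, 3, 0, 1, 0, 0, 3], [1, 0, 1]),
     ([1, 0, 0, 3, 0, 1, 3, 0], [1, 0, 1]),
     ([0, 0, 0, 0, 2, 2, 2, 2], [0, 0, 0]),
     ([0, 0, 1, 1, 3, 3, 0, 0], [1, 0, 1]),
     ([0, 2, 0, 2, 2, 0, 2, 0], [0, 0, 0]),
     ([1, 1, 0, 0, 0, 0, 3, 3], [1, 0, 1]),
     ([3, 0, 0, 1, 0, 3, 1, 0], [1, 0, 1]),
     ([3, 3, 0, 0, 0, 0, 1, 1], [1, 0, 1]),
     ([0, 2, 0, 0, -2, 2, 6, 0], [0, 1, 1]),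
     ([0, 6, 2, -2, 0, 0, 2, 0], [0, 1, 1]),
     ([-1, 5, 0, 0, 0, 0, 5, -1], [1, 1, 0]),
     ([0, 0, -2, 6, 0, 0, 6, -2], [0, 0, 0]),
     ([0, 0, -1, 3, 1, 1, 4, 0], [1, 0, 1]),
     ([0, 0, 2, 2, 0, 0, 2, 2], [0, 0, 0]),
     ([0, 0, 4, -2, -2, 4, 2, 2], [0, 1, 1])]"

definition al_sign :: "int list \<Rightarrow> int \<Rightarrow> int" where
  "al_sign t e = 12 * dot t (map (\<lambda>p. if p dvd e then 1 else 0) [2, 3, 7])"

definition sign_ok :: "int list \<Rightarrow> int \<Rightarrow> int \<Rightarrow> int list \<times> int list \<Rightarrow> bool" where
  "sign_ok ph e e' xt = ((al_sign (snd xt) e + dot (fst xt) ph - al_sign (snd xt) e') mod 24 = 0)"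

definition inversion_check_at :: "int \<Rightarrow> int \<Rightarrow> int \<Rightarrow> int \<Rightarrow> bool" where
  "inversion_check_at e j e' j' \<longleftrightarrow> list_all (with_gamma gamma_ok e j e' j') level_divisors \<and>
    list_all (sign_ok (map (phase_at e j e' j') level_divisors) e e') eta_data \<and>
    e' \<in> set level_divisors \<and> 0 \<le> j' \<and> j' < e' \<and> inv_width e' j' = e \<and> inv_shift e' j' = j"

definition inversion_check :: "int \<Rightarrow> int \<Rightarrow> bool" where
  "inversion_check e j = inversion_check_at e j (inv_width e j) (inv_shift e j)"

text \<open>The order of \<open>\<eta>(\<delta> z)\<close> at the cusp of width \<open>e\<close>, in units of \<open>1/24\<close>.\<close>
definition cusp_order :: "int \<Rightarrow> int \<Rightarrow> int" where
  "cusp_order e \<delta> = (\<delta> div gcd \<delta> e) * (e div gcd \<delta> e)"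

text \<open>The order of the quotient at the cusp of width \<open>e\<close> is a nonnegative integer. Integrality gives the
period \<open>e\<close> in the shift \<open>j\<close>, nonnegativity boundedness at the cusp.\<close>
definition width_check :: "int \<Rightarrow> int list \<times> int list \<Rightarrow> bool" where
  "width_check e xt \<longleftrightarrow> dot (fst xt) (map (cusp_order e) level_divisors) mod 24 = 0 \<and>
     dot (fst xt) (map (cusp_order e) level_divisors) \<ge> 0"

text \<open>For each of the 96 cosets and each divisor of 42 the matrix \<open>\<gamma>\<close> is integral, and for each eta quotient
the phases of the factors add up to the change of its sign. Beyond this, the inversion is
checked to be an involution of the cosets.\<close>
lemma inversion_checks:
  "list_all (inversion_check 1) [0..0]" "list_all (inversion_check 2) [0..1]"
  "list_all (inversion_check 3) [0..2]" "list_all (inversion_check 6) [0..5]"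
  "list_all (inversion_check 7) [0..6]" "list_all (inversion_check 14) [0..13]"
  "list_all (inversion_check 21) [0..20]" "list_all (inversion_check 42) [0..41]"
  by code_simp+

lemma inversion_check_holds:
  assumes "e \<in> set level_divisors" "0 \<le> j" "j < e"
  shows "inversion_check e j"
proof (cases "e = 1")
  case True
  hence "j = 0" using assms by simp
  thus ?thesis using inversion_checks(1) True by simp
next
  case False
  thus ?thesis
    using inversion_checks assms unfolding list_all_iff level_divisors_def by auto
qed

lemma width_check_holds:
  assumes "e \<in> set level_divisors" "xt \<in> set eta_data"
  shows "width_check e xt"
proof -
  have "list_all (\<lambda>e. list_all (width_check e) eta_data) level_divisors"
    by code_simp
  thus ?thesis using assms by (auto simp: list_all_iff)
qed

lemma eta_data_lengths:
  assumes "xt \<in> set eta_data"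
  shows "length (fst xt) = length level_divisors" "sum_list (fst xt) = 8"
  using assms by (auto simp: eta_data_def level_divisors_def)

definition level_arg :: "int \<Rightarrow> int \<Rightarrow> int \<Rightarrow> complex \<Rightarrow> complex" where
  "level_arg \<delta> e j z = of_int (\<delta> div gcd \<delta> e) * (z + of_int j) / of_int (gcd \<delta> e)"

text \<open>The factor \<open>\<eta>(\<delta> z)\<close> at the coset \<open>(e, j)\<close>. Division by the square root of \<open>d = gcd \<delta> e\<close> removes the
ratio of the automorphy factors \<open>C M' z + D = (d/d') z\<close>, so that inversion multiplies by a root of
unity and the square root of \<open>-\<i> z\<close> at every coset.\<close>
definition eta_at :: "int \<Rightarrow> int \<Rightarrow> int \<Rightarrow> complex \<Rightarrow> complex" where
  "eta_at \<delta> e j z = dedekind_eta (level_arg \<delta> e j z) / of_real (sqrt (of_int (gcd \<delta> e)))"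

definition level_ratio :: "int \<Rightarrow> int \<Rightarrow> real" where
  "level_ratio \<delta> e = of_int (\<delta> div gcd \<delta> e) / of_int (gcd \<delta> e)"

definition eis_at :: "int \<Rightarrow> int \<Rightarrow> int \<Rightarrow> complex \<Rightarrow> complex" where
  "eis_at \<delta> e j z = of_real (level_ratio \<delta> e) * eisE2 (level_arg \<delta> e j z)"

text \<open>The expansion of \<open>\<delta>^2 E4(\<delta> z)\<close>, expressed as \<open>L^2 - (6/\<pi>i) L'\<close> in terms of the expansion \<open>L\<close> of
\<open>\<delta> E2(\<delta> z)\<close>. In this form its modularity follows from that of \<open>\<eta>\<close>.\<close>
definition quad_at :: "int \<Rightarrow> int \<Rightarrow> int \<Rightarrow> complex \<Rightarrow> complex" where
  "quad_at \<delta> e j z = eis_at \<delta> e j z ^ 2 -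
     6 / (of_real pi * \<i>) * (of_real (level_ratio \<delta> e) ^ 2 * deriv eisE2 (level_arg \<delta> e j z))"

lemma level_quotients_pos:
  assumes "\<delta> > 0"
  shows "gcd \<delta> e > 0" "\<delta> div gcd \<delta> e > 0" "level_ratio \<delta> e > 0"
proof -
  show 1: "gcd \<delta> e > 0" using assms by (simp add: gcd_pos_int)
  show 2: "\<delta> div gcd \<delta> e > 0"
    using assms 1 gcd_le1_int[of \<delta> e] by (simp add: pos_imp_zdiv_pos_iff)
  show "level_ratio \<delta> e > 0" using 1 2 by (simp add: level_ratio_def)
qed

lemma level_divisors_pos: "\<delta> \<in> set level_divisors \<Longrightarrow> \<delta> > 0"
  by (auto simp: level_divisors_def)

lemma level_arg_altdef: "level_arg \<delta> e j z = of_real (level_ratio \<delta> e) * (z + of_int j)"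
  by (simp add: level_arg_def level_ratio_def)

lemma Im_level_arg: "Im (level_arg \<delta> e j z) = level_ratio \<delta> e * Im z"
  by (simp add: level_arg_altdef)

lemma Im_level_arg_pos: "\<delta> > 0 \<Longrightarrow> Im z > 0 \<Longrightarrow> Im (level_arg \<delta> e j z) > 0"
  using level_quotients_pos[of \<delta> e] by (simp add: Im_level_arg)

lemma level_arg_has_field_derivative:
  "(level_arg \<delta> e j has_field_derivative of_real (level_ratio \<delta> e)) (at z)"
  unfolding level_arg_altdef [abs_def] by (rule derivative_eq_intros refl | simp)+

definition sigma_fps :: "nat \<Rightarrow> complex fps" where
  "sigma_fps k = Abs_fps (\<lambda>n. of_nat (divsum k n))"

definition E2_fps :: "complex fps" where
  "E2_fps = 1 - fps_const 24 * sigma_fps 1"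

definition E4_fps :: "complex fps" where
  "E4_fps = 1 + fps_const 240 * sigma_fps 3"

lemma qexp_eisE2: "qexp eisE2 E2_fps"
proof -
  have "qexp (\<lambda>z. lambert_square (nome z)) (sigma_fps 1)"
  proof (rule qexp_sumsI)
    fix z :: complex assume "Im z > 0"
    hence "norm (nome z) < 1" by simp
    from lambert_square_power_series[OF this]
    show "(\<lambda>n. fps_nth (sigma_fps 1) n * nome z ^ n) sums lambert_square (nome z)"
      unfolding sigma_fps_def divsum_def fps_nth_Abs_fps power_one_right .
  qed
  from qexp_diff[OF qexp_const[of 1] qexp_cmult[OF this, of 24]] show ?thesis
    by (simp add: eisE2_def [abs_def] E2_fps_def)
qed

lemma eisE2_has_field_derivative:
  "Im z > 0 \<Longrightarrow> (eisE2 has_field_derivative deriv eisE2 z) (at z)"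
  using holomorphic_derivI[OF qexp_holomorphic[OF qexp_eisE2] open_upper_half_plane] by simp

lemma qexp_theta_E2: "qexp (\<lambda>z. deriv eisE2 z / (2 * of_real pi * \<i>)) (fps_X * fps_deriv E2_fps)"
  by (rule qexp_theta[OF qexp_eisE2 eisE2_has_field_derivative])
lemma eta_at_has_field_derivative:
  assumes "\<delta> > 0" "Im z > 0"
  shows "(eta_at \<delta> e j has_field_derivative (of_real pi * \<i> / 12 * eis_at \<delta> e j z * eta_at \<delta> e j z)) (at z)"
proof -
  from DERIV_cdivide[OF DERIV_chain2[OF has_field_derivative_dedekind_eta[OF Im_level_arg_pos[OF assms]] level_arg_has_field_derivative],
      where c = "of_real (sqrt (of_int (gcd \<delta> e)))"]
  show ?thesis unfolding eta_at_def [abs_def] eis_at_def by (simp add: mult_ac)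
qed

lemma eis_at_has_field_derivative:
  assumes "\<delta> > 0" "Im z > 0"
  shows "(eis_at \<delta> e j has_field_derivative (of_real (level_ratio \<delta> e) ^ 2 * deriv eisE2 (level_arg \<delta> e j z))) (at z)"
proof -
  from DERIV_cmult[OF DERIV_chain2[OF eisE2_has_field_derivative[OF Im_level_arg_pos[OF assms]] level_arg_has_field_derivative],
      where c = "of_real (level_ratio \<delta> e)"]
  show ?thesis unfolding eis_at_def [abs_def] by (simp add: mult_ac power2_eq_square)
qed

lemma eta_at_nonzero:
  assumes "\<delta> > 0" "Im z > 0"
  shows "eta_at \<delta> e j z \<noteq> 0"
  using dedekind_eta_nonzero[OF Im_level_arg_pos[OF assms]] level_quotients_pos[OF assms(1), of e]
  by (simp add: eta_at_def)

lemma csqrt_of_real_times: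
  assumes "t \<ge> 0"
  shows "csqrt (of_real t * w) = of_real (sqrt t) * csqrt w"
proof (rule csqrt_unique)
  show "(of_real (sqrt t) * csqrt w)\<^sup>2 = of_real t * w"
    using assms by (simp add: power_mult_distrib flip: of_real_power)
  define u where "u = csqrt w"
  have "0 < Re u \<or> Re u = 0 \<and> 0 \<le> Im u" using csqrt_principal[of w] by (simp only: u_def)
  thus "0 < Re (of_real (sqrt t) * csqrt w) \<or> Re (of_real (sqrt t) * csqrt w) = 0 \<and> 0 \<le> Im (of_real (sqrt t) * csqrt w)"
    using assms unfolding u_def [symmetric] by (cases "t = 0") auto
qed

lemma eta_at_inversion:
  assumes \<delta>: "\<delta> > 0" and ok: "with_gamma gamma_ok e j e' j' \<delta>" and z: "Im z > 0"
  shows "eta_at \<delta> e j (- 1 / z) = zeta24 (phase_at e j e' j' \<delta>) * csqrt (- \<i> * z) * eta_at \<delta> e' j' z"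
proof -
  define d where "d = gcd \<delta> e"
  define a where "a = \<delta> div d"
  define d' where "d' = gcd \<delta> e'"
  define a' where "a' = \<delta> div d'"
  define A where "A = a * j * d' div \<delta>"
  define B where "B = - a * a' * (j * j' + 1) div \<delta>"
  define C where "C = d * d' div \<delta>"
  define D where "D = - d * a' * j' div \<delta>"
  note defs = d_def a_def d'_def a'_def A_def B_def C_def D_def
  have "gamma_ok a d a' d' j j' A B C D"
    using ok by (simp add: with_gamma_def Let_def defs)
  hence g: "A * D - B * C = 1" "C > 0" "A * a' = a * j" "A * a' * j' + B * d' = - a" "C * a' = d" "C * a' * j' + D * d' = 0"
    by (auto simp: gamma_ok_def)
  have ph: "phase_at e j e' j' \<delta> = eta_phase A B C D"
    by (simp add: phase_at_def with_gamma_def Let_def defs)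
  have pos: "d > 0" "d' > 0" "a > 0" "a' > 0"
    using level_quotients_pos[OF \<delta>] by (auto simp: defs)
  have z0: "z \<noteq> 0" using z by auto
  define w where "w = level_arg \<delta> e' j' z"
  have w: "of_int d' * w = of_int a' * (z + of_int j')"
    using pos by (simp add: w_def level_arg_def a'_def [symmetric] d'_def [symmetric])
  have Imw: "Im w > 0" unfolding w_def by (rule Im_level_arg_pos[OF \<delta> z])
  have num: "of_int d' * (of_int A * w + of_int B) = of_int a * (of_int j * z - 1)"
  proof -
    have "of_int d' * (of_int A * w + of_int B) = of_int A * (of_int d' * w) + of_int (B * d')"
      by (simp add: algebra_simps)
    also have "\<dots> = of_int (A * a') * z + of_int (A * a' * j' + B * d')"
      unfolding w by (simp add: algebra_simps)
    finally show ?thesis unfolding g(4) unfolding g(3) by (simp add: algebra_simps)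
  qed
  have den: "of_int d' * (of_int C * w + of_int D) = of_int d * z"
  proof -
    have "of_int d' * (of_int C * w + of_int D) = of_int C * (of_int d' * w) + of_int (D * d')"
      by (simp add: algebra_simps)
    also have "\<dots> = of_int (C * a') * z + of_int (C * a' * j' + D * d')"
      unfolding w by (simp add: algebra_simps)
    finally show ?thesis unfolding g(6) unfolding g(5) by simp
  qed
  have den': "of_int C * w + of_int D = of_real (of_int d / of_int d') * z"
    using den pos by (simp add: field_simps)
  have "level_arg \<delta> e j (- 1 / z) = (of_int a * (of_int j * z - 1)) / (of_int d * z)"
    using z0 pos by (simp add: level_arg_def a_def [symmetric] d_def [symmetric] field_simps)
  also have "\<dots> = (of_int A * w + of_int B) / (of_int C * w + of_int D)"
    unfolding num [symmetric] den [symmetric] using pos by simp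
  finally have "dedekind_eta (level_arg \<delta> e j (- 1 / z)) =
      zeta24 (eta_phase A B C D) * csqrt (- \<i> * (of_int C * w + of_int D)) * dedekind_eta w"
    using dedekind_eta_modular[OF g(1,2) Imw] by simp
  also have "csqrt (- \<i> * (of_int C * w + of_int D)) = csqrt (of_real (of_int d / of_int d') * (- \<i> * z))"
    unfolding den' by (simp only: mult_ac)
  also have "\<dots> = of_real (sqrt (of_int d / of_int d')) * csqrt (- \<i> * z)"
    using pos by (intro csqrt_of_real_times) simp
  finally show ?thesis
    using pos unfolding eta_at_def ph w_def [symmetric] d_def [symmetric] d'_def [symmetric]
    by (simp add: real_sqrt_divide field_simps)
qed

text \<open>The logarithmic derivative of the law for \<open>f\<close>: the factor \<open>c\<close> disappears, and the square root produces
an anomaly that is the same for all functions of this kind.\<close>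
lemma eis_inversion_of_eta_inversion:
  fixes f g Lf Lg :: "complex \<Rightarrow> complex"
  assumes df: "\<And>z. Im z > 0 \<Longrightarrow> (f has_field_derivative (of_real pi * \<i> / 12 * Lf z * f z)) (at z)"
    and dg: "\<And>z. Im z > 0 \<Longrightarrow> (g has_field_derivative (of_real pi * \<i> / 12 * Lg z * g z)) (at z)"
    and eq: "\<And>z. Im z > 0 \<Longrightarrow> f (- 1 / z) = c * csqrt (- \<i> * z) * g z"
    and nz: "f (- 1 / z) \<noteq> 0" and z: "Im z > 0"
  shows "Lf (- 1 / z) = z ^ 2 * Lg z + 6 * z / (of_real pi * \<i>)"
proof -
  define k where "k = of_real pi * \<i> / 12"
  define s where "s = csqrt (- \<i> * z)"
  have z0: "z \<noteq> 0" using z by auto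
  have k0: "k \<noteq> 0" by (simp add: k_def)
  have s2: "s * s = - \<i> * z" unfolding s_def by (metis power2_csqrt power2_eq_square)
  have s0: "s \<noteq> 0" using z0 by (simp add: s_def)
  have nr: "- \<i> * z \<notin> \<real>\<^sub>\<le>\<^sub>0" using z by (auto simp: complex_nonpos_Reals_iff)
  have h: "- \<i> / (2 * s) = s * (1 / (2 * z))"
    using s0 z0 s2 by (simp add: divide_simps)
  have "((\<lambda>z. - 1 / z) has_field_derivative 1 / z ^ 2) (at z)"
    by (rule derivative_eq_intros refl | use z0 in \<open>simp add: power2_eq_square\<close>)+
  from DERIV_chain2[OF df[OF Im_neg_inverse[OF z]] this]
  have "((\<lambda>z. f (- 1 / z)) has_field_derivative (k * Lf (- 1 / z) * f (- 1 / z)) * (1 / z ^ 2)) (at z)"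
    by (simp add: k_def)
  moreover have "((\<lambda>z. f (- 1 / z)) has_field_derivative
      c * (- \<i> / (2 * s) * g z + s * (k * Lg z * g z))) (at z)"
  proof (rule has_field_derivative_transform_within_open[OF _ open_upper_half_plane])
    have "((\<lambda>z. c * (csqrt (- \<i> * z) * g z)) has_field_derivative
        c * (- \<i> / (2 * s) * g z + s * (k * Lg z * g z))) (at z)"
      unfolding s_def k_def
      by (rule derivative_eq_intros dg z nr refl | simp)+
    thus "((\<lambda>z. c * csqrt (- \<i> * z) * g z) has_field_derivative
        c * (- \<i> / (2 * s) * g z + s * (k * Lg z * g z))) (at z)"
      by (simp only: mult.assoc)
  qed (use z eq in auto)
  ultimately have "(k * Lf (- 1 / z) * f (- 1 / z)) * (1 / z ^ 2) = c * (- \<i> / (2 * s) * g z + s * (k * Lg z * g z))"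
    by (rule DERIV_unique)
  also have "\<dots> = (c * s * g z) * (1 / (2 * z) + k * Lg z)"
    unfolding h by (simp only: ring_distribs mult_ac)
  also have "c * s * g z = f (- 1 / z)" using eq[OF z] by (simp add: s_def)
  finally have "f (- 1 / z) * (k * Lf (- 1 / z) * (1 / z ^ 2)) = f (- 1 / z) * (1 / (2 * z) + k * Lg z)"
    by (simp only: mult_ac)
  hence "k * Lf (- 1 / z) * (1 / z ^ 2) = 1 / (2 * z) + k * Lg z"
    using nz by (simp only: mult_left_cancel simp_thms)
  hence "Lf (- 1 / z) = z ^ 2 / k * (1 / (2 * z) + k * Lg z)"
    using k0 z0 by (simp add: field_simps)
  also have "\<dots> = z ^ 2 * Lg z + z / (2 * k)"
    using k0 z0 by (simp add: field_simps power2_eq_square)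
  also have "z / (2 * k) = 6 * z / (of_real pi * \<i>)"
    by (simp add: k_def mult_ac)
  finally show ?thesis .
qed

text \<open>Squaring the law for \<open>f\<close> and differentiating it yield the same anomalous terms, up to the factor \<open>6/(\<pi>i)\<close>.\<close>
lemma quad_inversion_of_eis_inversion:
  fixes f g df dg :: "complex \<Rightarrow> complex"
  assumes df: "\<And>z. Im z > 0 \<Longrightarrow> (f has_field_derivative df z) (at z)"
    and dg: "\<And>z. Im z > 0 \<Longrightarrow> (g has_field_derivative dg z) (at z)"
    and eq: "\<And>z. Im z > 0 \<Longrightarrow> f (- 1 / z) = z ^ 2 * g z + 6 * z / (of_real pi * \<i>)"
    and z: "Im z > 0"
  shows "f (- 1 / z) ^ 2 - 6 / (of_real pi * \<i>) * df (- 1 / z) = z ^ 4 * (g z ^ 2 - 6 / (of_real pi * \<i>) * dg z)"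
proof -
  define c where "c = 6 / (of_real pi * \<i>)"
  have z0: "z \<noteq> 0" using z by auto
  have "((\<lambda>z. - 1 / z) has_field_derivative 1 / z ^ 2) (at z)"
    by (rule derivative_eq_intros refl | use z0 in \<open>simp add: power2_eq_square\<close>)+
  from DERIV_chain2[OF df[OF Im_neg_inverse[OF z]] this]
  have "((\<lambda>z. f (- 1 / z)) has_field_derivative df (- 1 / z) * (1 / z ^ 2)) (at z)" .
  moreover have "((\<lambda>z. f (- 1 / z)) has_field_derivative (2 * z * g z + z ^ 2 * dg z + c)) (at z)"
  proof (rule has_field_derivative_transform_within_open[OF _ open_upper_half_plane])
    show "((\<lambda>z. z ^ 2 * g z + c * z) has_field_derivative (2 * z * g z + z ^ 2 * dg z + c)) (at z)"
      by (rule derivative_eq_intros dg z refl | simp)+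
  qed (use z eq in \<open>auto simp: c_def\<close>)
  ultimately have "df (- 1 / z) * (1 / z ^ 2) = 2 * z * g z + z ^ 2 * dg z + c"
    by (rule DERIV_unique)
  hence d: "df (- 1 / z) = z ^ 2 * (2 * z * g z + z ^ 2 * dg z + c)"
    using z0 by (simp add: field_simps)
  have e: "f (- 1 / z) = z ^ 2 * g z + c * z" using eq[OF z] by (simp add: c_def)
  show ?thesis
    unfolding d e c_def [symmetric] by (simp add: algebra_simps power2_eq_square power4_eq_xxxx)
qed

lemma eis_at_inversion:
  assumes \<delta>: "\<delta> > 0" and ok: "with_gamma gamma_ok e j e' j' \<delta>" and z: "Im z > 0"
  shows "eis_at \<delta> e j (- 1 / z) = z ^ 2 * eis_at \<delta> e' j' z + 6 * z / (of_real pi * \<i>)"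
  by (rule eis_inversion_of_eta_inversion[OF eta_at_has_field_derivative[OF \<delta>] eta_at_has_field_derivative[OF \<delta>]
        eta_at_inversion[OF \<delta> ok] eta_at_nonzero[OF \<delta> Im_neg_inverse[OF z]] z])

lemma quad_at_inversion:
  assumes \<delta>: "\<delta> > 0" and ok: "with_gamma gamma_ok e j e' j' \<delta>" and z: "Im z > 0"
  shows "quad_at \<delta> e j (- 1 / z) = z ^ 4 * quad_at \<delta> e' j' z"
  unfolding quad_at_def
  by (rule quad_inversion_of_eis_inversion[OF eis_at_has_field_derivative[OF \<delta>] eis_at_has_field_derivative[OF \<delta>]
        eis_at_inversion[OF \<delta> ok] z])

text \<open>A product over the divisors of the level, so that products of values, of constants and of phases
obey the same rules.\<close>
definition eta_prod :: "(int \<Rightarrow> complex) \<Rightarrow> int list \<Rightarrow> complex" where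
  "eta_prod h x = prod_list (map2 (\<lambda>\<delta> k. h \<delta> powi k) level_divisors x)"

lemma map2_cong_set:
  "(\<And>x y. x \<in> set xs \<Longrightarrow> y \<in> set ys \<Longrightarrow> f x y = g x y) \<Longrightarrow> map2 f xs ys = map2 g xs ys"
  by (induction xs ys rule: list_induct2') auto

lemma eta_prod_cong:
  "(\<And>\<delta>. \<delta> \<in> set level_divisors \<Longrightarrow> h \<delta> = h' \<delta>) \<Longrightarrow> eta_prod h x = eta_prod h' x"
  unfolding eta_prod_def by (intro arg_cong[where f = prod_list] map2_cong_set) auto

lemma eta_prod_mult: "eta_prod (\<lambda>\<delta>. g \<delta> * h \<delta>) x = eta_prod g x * eta_prod h x"
proof -
  have "prod_list (map2 (\<lambda>\<delta> k. (g \<delta> * h \<delta>) powi k) ds x) =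
        prod_list (map2 (\<lambda>\<delta> k. g \<delta> powi k) ds x) * prod_list (map2 (\<lambda>\<delta> k. h \<delta> powi k) ds x)" for ds
    by (induction ds x rule: list_induct2') (simp_all add: power_int_mult_distrib)
  thus ?thesis by (simp add: eta_prod_def)
qed

lemma eta_prod_const:
  assumes "c \<noteq> 0" "length x = length level_divisors"
  shows "eta_prod (\<lambda>_. c) x = c powi sum_list x"
proof -
  have "length x = length ds \<Longrightarrow> prod_list (map2 (\<lambda>\<delta> k. c powi k) ds x) = c powi sum_list x" for ds :: "int list"
    by (induction x ds rule: list_induct2) (use assms(1) in \<open>simp_all add: power_int_add\<close>)
  thus ?thesis using assms(2) by (simp add: eta_prod_def)
qed

lemma zeta24_powi: "zeta24 p powi k = zeta24 (k * p)"
proof -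
  have nat: "zeta24 p ^ n = zeta24 (int n * p)" for n
    by (induction n) (simp_all add: ring_distribs zeta24_add)
  have neg: "zeta24 (- p) = inverse (zeta24 p)" for p
    using inverse_unique[of "zeta24 p" "zeta24 (- p)"] zeta24_add[of p "- p"] by simp
  show ?thesis
    by (cases k rule: int_cases2) (simp_all add: nat neg power_int_minus)
qed

lemma eta_prod_zeta24: "eta_prod (\<lambda>\<delta>. zeta24 (p \<delta>)) x = zeta24 (dot x (map p level_divisors))"
proof -
  have "prod_list (map2 (\<lambda>\<delta> k. zeta24 (p \<delta>) powi k) ds x) = zeta24 (sum_list (map2 (*) x (map p ds)))" for ds
    by (induction ds x rule: list_induct2') (simp_all add: zeta24_powi zeta24_add)
  thus ?thesis by (simp add: eta_prod_def dot_def)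
qed

definition eta_form_at :: "int list \<times> int list \<Rightarrow> int \<Rightarrow> int \<Rightarrow> complex \<Rightarrow> complex" where
  "eta_form_at xt e j z = zeta24 (al_sign (snd xt) e) * eta_prod (\<lambda>\<delta>. eta_at \<delta> e j z) (fst xt)"

text \<open>The exponents of each quotient add up to 8, so that the square roots of \<open>-\<i> z\<close> combine to
\<open>(-\<i> z)^4 = z^4\<close>.\<close>
lemma eta_form_at_inversion:
  assumes "xt \<in> set eta_data" "inversion_check_at e j e' j'" "Im z > 0"
  shows "eta_form_at xt e j (- 1 / z) = z ^ 4 * eta_form_at xt e' j' z"
proof -
  define s where "s = csqrt (- \<i> * z)"
  have s0: "s \<noteq> 0" using assms by (auto simp: s_def)
  have s8: "s powi 8 = z ^ 4"
  proof -
    have "s powi 8 = (s ^ 2) ^ 4" by (simp flip: power_mult)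
    also have "\<dots> = (- \<i>) ^ 4 * z ^ 4" unfolding s_def power2_csqrt power_mult_distrib ..
    also have "(- \<i>) ^ 4 = (1 :: complex)" by (simp add: power4_eq_xxxx)
    finally show ?thesis by simp
  qed
  note len = eta_data_lengths[OF assms(1)]
  have "eta_prod (\<lambda>\<delta>. eta_at \<delta> e j (- 1 / z)) (fst xt) =
        eta_prod (\<lambda>\<delta>. zeta24 (phase_at e j e' j' \<delta>) * s * eta_at \<delta> e' j' z) (fst xt)"
    unfolding s_def using assms(2,3) level_divisors_pos
    by (intro eta_prod_cong eta_at_inversion) (auto simp: inversion_check_at_def list_all_iff)
  also have "\<dots> = zeta24 (dot (fst xt) (map (phase_at e j e' j') level_divisors)) * z ^ 4 * eta_prod (\<lambda>\<delta>. eta_at \<delta> e' j' z) (fst xt)"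
    unfolding eta_prod_mult eta_prod_zeta24 eta_prod_const[OF s0 len(1)] len(2) s8 ..
  finally have "eta_form_at xt e j (- 1 / z) = z ^ 4 *
      (zeta24 (al_sign (snd xt) e + dot (fst xt) (map (phase_at e j e' j') level_divisors)) * eta_prod (\<lambda>\<delta>. eta_at \<delta> e' j' z) (fst xt))"
    unfolding eta_form_at_def zeta24_add by (simp only: mult_ac)
  also have "zeta24 (al_sign (snd xt) e + dot (fst xt) (map (phase_at e j e' j') level_divisors)) = zeta24 (al_sign (snd xt) e')"
  proof (rule zeta24_cong)
    have "sign_ok (map (phase_at e j e' j') level_divisors) e e' xt"
      using assms(1,2) by (simp add: inversion_check_at_def list_all_iff)
    thus "(al_sign (snd xt) e + dot (fst xt) (map (phase_at e j e' j') level_divisors)) mod 24 = al_sign (snd xt) e' mod 24"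
      by (simp add: sign_ok_def mod_eq_dvd_iff mod_eq_0_iff_dvd)
  qed
  finally show ?thesis by (simp add: eta_form_at_def)
qed

lemma level_arg_shift: "level_arg \<delta> e j (z + 1) = level_arg \<delta> e (j + 1) z"
  by (simp add: level_arg_def add_ac)

lemma level_arg_period: "\<delta> > 0 \<Longrightarrow> level_arg \<delta> e (j + e) z = level_arg \<delta> e j z + of_int (cusp_order e \<delta>)"
proof -
  assume "\<delta> > 0"
  hence d: "gcd \<delta> e > 0" by (rule level_quotients_pos)
  have "e = gcd \<delta> e * (e div gcd \<delta> e)" by simp
  hence "of_int e = (of_int (gcd \<delta> e) * of_int (e div gcd \<delta> e) :: complex)"
    by (metis of_int_mult)
  thus ?thesis
    using d by (simp add: level_arg_def cusp_order_def field_simps)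
qed

lemma eis_at_shift: "eis_at \<delta> e j (z + 1) = eis_at \<delta> e (j + 1) z"
  by (simp add: eis_at_def level_arg_shift)

lemma quad_at_shift: "quad_at \<delta> e j (z + 1) = quad_at \<delta> e (j + 1) z"
  by (simp add: quad_at_def eis_at_shift level_arg_shift)

lemma eta_form_at_shift: "eta_form_at xt e j (z + 1) = eta_form_at xt e (j + 1) z"
  by (simp add: eta_form_at_def eta_at_def level_arg_shift)

lemma eisE2_add_int: "eisE2 (z + of_int n) = eisE2 z"
  unfolding eisE2_def nome_add_int ..

lemma deriv_eisE2_add_int:
  assumes "Im z > 0"
  shows "deriv eisE2 (z + of_int n) = deriv eisE2 z"
proof (rule DERIV_unique)
  have "((\<lambda>z. eisE2 (z + of_int n)) has_field_derivative deriv eisE2 (z + of_int n) * 1) (at z)"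
    by (rule DERIV_chain2[OF eisE2_has_field_derivative]) (use assms in \<open>auto intro!: derivative_eq_intros\<close>)
  thus "(eisE2 has_field_derivative deriv eisE2 (z + of_int n)) (at z)"
    by (simp add: eisE2_add_int)
qed (rule eisE2_has_field_derivative[OF assms])

lemma eis_at_period: "\<delta> > 0 \<Longrightarrow> eis_at \<delta> e (j + e) z = eis_at \<delta> e j z"
  by (simp add: eis_at_def level_arg_period eisE2_add_int)

lemma quad_at_period: "\<delta> > 0 \<Longrightarrow> Im z > 0 \<Longrightarrow> quad_at \<delta> e (j + e) z = quad_at \<delta> e j z"
  by (simp add: quad_at_def eis_at_period level_arg_period deriv_eisE2_add_int Im_level_arg_pos)

lemma eta_form_at_period:
  assumes "xt \<in> set eta_data" "e \<in> set level_divisors"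
  shows "eta_form_at xt e (j + e) z = eta_form_at xt e j z"
proof -
  have "eta_prod (\<lambda>\<delta>. eta_at \<delta> e (j + e) z) (fst xt) =
        eta_prod (\<lambda>\<delta>. zeta24 (cusp_order e \<delta>) * eta_at \<delta> e j z) (fst xt)"
    by (intro eta_prod_cong) (simp add: eta_at_def level_arg_period level_divisors_pos dedekind_eta_add_int)
  also have "\<dots> = zeta24 (dot (fst xt) (map (cusp_order e) level_divisors)) * eta_prod (\<lambda>\<delta>. eta_at \<delta> e j z) (fst xt)"
    unfolding eta_prod_mult eta_prod_zeta24 ..
  also have "zeta24 (dot (fst xt) (map (cusp_order e) level_divisors)) = zeta24 0"
    using width_check_holds[OF assms(2,1)] by (intro zeta24_cong) (simp add: width_check_def)
  finally show ?thesis by (simp add: eta_form_at_def)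
qed

text \<open>At the coset \<open>(1, 0)\<close>, the cusp at infinity, this is a combination of \<open>(L\<^sub>r - L\<^sub>s)^2\<close>, the functions
\<open>\<delta>^2 E4(\<delta> z)\<close> and the eta quotients. Keeping \<open>L\<^sub>r\<close> and \<open>L\<^sub>s\<close> together in a difference is what
cancels their anomalies.\<close>
definition form_at :: "int \<Rightarrow> int \<Rightarrow> complex \<Rightarrow> complex list \<Rightarrow> complex list \<Rightarrow> int \<Rightarrow> int \<Rightarrow> complex \<Rightarrow> complex" where
  "form_at r s \<alpha> \<beta> \<gamma> e j z = \<alpha> * (eis_at r e j z - eis_at s e j z) ^ 2
     + sum_list (map2 (\<lambda>\<delta> b. b * quad_at \<delta> e j z) level_divisors \<beta>)
     + sum_list (map2 (\<lambda>xt c. c * eta_form_at xt e j z) eta_data \<gamma>)"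

lemma sum_list_map2_cmult:
  fixes f g :: "'a \<Rightarrow> 'b \<Rightarrow> complex"
  assumes "\<And>x y. x \<in> set xs \<Longrightarrow> f x y = c * g x y"
  shows "sum_list (map2 f xs ys) = c * sum_list (map2 g xs ys)"
  using assms by (induction xs ys rule: list_induct2') (auto simp: ring_distribs)

lemma form_at_inversion:
  assumes rs: "r \<in> set level_divisors" "s \<in> set level_divisors"
    and ck: "inversion_check_at e j e' j'" and z: "Im z > 0"
  shows "form_at r s \<alpha> \<beta> \<gamma> e j (- 1 / z) = z ^ 4 * form_at r s \<alpha> \<beta> \<gamma> e' j' z"
proof -
  have ok: "with_gamma gamma_ok e j e' j' \<delta>" if "\<delta> \<in> set level_divisors" for \<delta>
    using ck that by (simp add: inversion_check_at_def list_all_iff)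
  have 1: "eis_at r e j (- 1 / z) - eis_at s e j (- 1 / z) = z ^ 2 * (eis_at r e' j' z - eis_at s e' j' z)"
    unfolding eis_at_inversion[OF level_divisors_pos[OF rs(1)] ok[OF rs(1)] z]
      eis_at_inversion[OF level_divisors_pos[OF rs(2)] ok[OF rs(2)] z] by (simp add: algebra_simps)
  have 2: "sum_list (map2 (\<lambda>\<delta> b. b * quad_at \<delta> e j (- 1 / z)) level_divisors \<beta>) =
      z ^ 4 * sum_list (map2 (\<lambda>\<delta> b. b * quad_at \<delta> e' j' z) level_divisors \<beta>)"
    by (rule sum_list_map2_cmult) (subst quad_at_inversion[OF level_divisors_pos ok z]; simp)
  have 3: "sum_list (map2 (\<lambda>xt c. c * eta_form_at xt e j (- 1 / z)) eta_data \<gamma>) =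
      z ^ 4 * sum_list (map2 (\<lambda>xt c. c * eta_form_at xt e' j' z) eta_data \<gamma>)"
    by (rule sum_list_map2_cmult) (subst eta_form_at_inversion[OF _ ck z]; simp)
  have "\<alpha> * (z ^ 2 * (eis_at r e' j' z - eis_at s e' j' z)) ^ 2 = z ^ 4 * (\<alpha> * (eis_at r e' j' z - eis_at s e' j' z) ^ 2)"
    by (simp add: power_mult_distrib flip: power_mult)
  thus ?thesis unfolding form_at_def 1 2 3 by (simp only: ring_distribs)
qed

lemma form_at_shift: "form_at r s \<alpha> \<beta> \<gamma> e j (z + 1) = form_at r s \<alpha> \<beta> \<gamma> e (j + 1) z"
  by (simp add: form_at_def eis_at_shift quad_at_shift eta_form_at_shift)

lemma form_at_period:
  assumes "r \<in> set level_divisors" "s \<in> set level_divisors" "e \<in> set level_divisors" "Im z > 0"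
  shows "form_at r s \<alpha> \<beta> \<gamma> e (j + e) z = form_at r s \<alpha> \<beta> \<gamma> e j z"
proof -
  have 2: "map2 (\<lambda>\<delta> b. b * quad_at \<delta> e (j + e) z) level_divisors \<beta> = map2 (\<lambda>\<delta> b. b * quad_at \<delta> e j z) level_divisors \<beta>"
    using assms(4) by (intro map2_cong_set) (simp add: quad_at_period level_divisors_pos)
  have 3: "map2 (\<lambda>xt c. c * eta_form_at xt e (j + e) z) eta_data \<gamma> = map2 (\<lambda>xt c. c * eta_form_at xt e j z) eta_data \<gamma>"
    using assms(3) by (intro map2_cong_set) (simp add: eta_form_at_period)
  show ?thesis unfolding form_at_def 2 3 using assms(1,2) by (simp add: eis_at_period level_divisors_pos)
qed

section \<open>Behaviour at the cusps\<close>
lemma filterlim_level_arg: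
  assumes "\<delta> > 0"
  shows "filterlim (level_arg \<delta> e j) at_i_infinity at_i_infinity"
proof -
  have "filterlim (\<lambda>y. level_ratio \<delta> e * y) at_top at_top"
    using level_quotients_pos[OF assms, of e]
    by (intro filterlim_tendsto_pos_mult_at_top[OF tendsto_const]) (auto intro: filterlim_ident)
  hence "filterlim (\<lambda>z. level_ratio \<delta> e * Im z) at_top at_i_infinity"
    unfolding at_i_infinity_def by (rule filterlim_compose[OF _ filterlim_filtercomap])
  hence "filterlim (\<lambda>z. Im (level_arg \<delta> e j z)) at_top at_i_infinity"
    by (simp add: Im_level_arg)
  thus ?thesis
    unfolding at_i_infinity_def by (simp add: filterlim_filtercomap_iff o_def)
qed

lemma eisE2_tendsto: "(eisE2 \<longlongrightarrow> 1) at_i_infinity"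
  using qexp_tendsto[OF qexp_eisE2] by (simp add: E2_fps_def sigma_fps_def divsum_def)

lemma deriv_eisE2_tendsto: "(deriv eisE2 \<longlongrightarrow> 0) at_i_infinity"
proof -
  have "((\<lambda>z. deriv eisE2 z / (2 * of_real pi * \<i>)) \<longlongrightarrow> 0) at_i_infinity"
    using qexp_tendsto[OF qexp_theta_E2] by simp
  from tendsto_mult_right_zero[OF this, of "2 * of_real pi * \<i>"] show ?thesis by simp
qed

lemma bigo_1_of_tendsto:
  fixes f :: "complex \<Rightarrow> complex"
  shows "(f \<longlongrightarrow> c) F \<Longrightarrow> f \<in> O[F](\<lambda>_. 1 :: complex)"
  by (rule bigoI_tendsto[where c = c]) auto

lemma eis_at_bounded:
  assumes "\<delta> > 0"
  shows "eis_at \<delta> e j \<in> O[at_i_infinity](\<lambda>_. 1 :: complex)"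
  unfolding eis_at_def [abs_def]
  by (rule bigo_1_of_tendsto[OF tendsto_mult[OF tendsto_const
        filterlim_compose[OF eisE2_tendsto filterlim_level_arg[OF assms]]]])

lemma quad_at_bounded:
  assumes "\<delta> > 0"
  shows "quad_at \<delta> e j \<in> O[at_i_infinity](\<lambda>_. 1 :: complex)"
  unfolding quad_at_def [abs_def] eis_at_def
  by (rule bigo_1_of_tendsto[OF tendsto_diff[OF
        tendsto_power[OF tendsto_mult[OF tendsto_const filterlim_compose[OF eisE2_tendsto filterlim_level_arg[OF assms]]]]
        tendsto_mult[OF tendsto_const tendsto_mult[OF tendsto_const
          filterlim_compose[OF deriv_eisE2_tendsto filterlim_level_arg[OF assms]]]]]])

lemma cusp_order_ratio:
  assumes "\<delta> > 0"
  shows "of_int (cusp_order e \<delta>) = level_ratio \<delta> e * of_int e"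
proof -
  have "e = gcd \<delta> e * (e div gcd \<delta> e)" by simp
  hence "real_of_int e = of_int (gcd \<delta> e) * of_int (e div gcd \<delta> e)"
    by (metis of_int_mult)
  thus ?thesis
    using level_quotients_pos[OF assms, of e] by (simp add: level_ratio_def cusp_order_def)
qed

lemma eta_prod_exp: "eta_prod (\<lambda>\<delta>. exp (w \<delta>)) x = exp (sum_list (map2 (\<lambda>\<delta> k. of_int k * w \<delta>) level_divisors x))"
proof -
  have "prod_list (map2 (\<lambda>\<delta> k. exp (w \<delta>) powi k) ds x) = exp (sum_list (map2 (\<lambda>\<delta> k. of_int k * w \<delta>) ds x))" for ds :: "int list"
    by (induction ds x rule: list_induct2') (simp_all add: exp_add exp_power_int)
  thus ?thesis by (simp add: eta_prod_def)
qed

lemma dot_cusp_order: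
  assumes "\<And>\<delta>. \<delta> \<in> set ds \<Longrightarrow> \<delta> > 0"
  shows "sum_list (map2 (\<lambda>\<delta> k. of_int k * level_ratio \<delta> e) ds x) * of_int e = of_int (dot x (map (cusp_order e) ds))"
  using assms
  by (induction ds x rule: list_induct2') (simp_all add: dot_def cusp_order_ratio algebra_simps)

text \<open>Splitting each \<open>\<eta>\<close> into its exponential factor and its Euler product, the Euler products tend to 1 and
the exponentials multiply to one whose exponent is the order at the cusp, nonnegative by
\<open>width_check_holds\<close>.\<close>
lemma eta_form_at_bounded:
  assumes xt: "xt \<in> set eta_data" and e: "e \<in> set level_divisors"
  shows "eta_form_at xt e j \<in> O[at_i_infinity](\<lambda>_. 1 :: complex)"
proof -
  define u where "u = (\<lambda>\<delta> z. euler_prod 1 (nome (level_arg \<delta> e j z)) / of_real (sqrt (of_int (gcd \<delta> e))))"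
  define E where "E = (\<lambda>z. eta_prod (\<lambda>\<delta>. exp (of_real pi * \<i> / 12 * level_arg \<delta> e j z)) (fst xt))"
  define U where "U = (\<lambda>z. eta_prod (\<lambda>\<delta>. u \<delta> z) (fst xt))"
  have eq: "eta_form_at xt e j z = zeta24 (al_sign (snd xt) e) * (E z * U z)" for z
    unfolding eta_form_at_def E_def U_def eta_prod_mult [symmetric] eta_at_def dedekind_eta_euler_prod u_def by simp
  define R where "R = sum_list (map2 (\<lambda>\<delta> k. of_int k * level_ratio \<delta> e) level_divisors (fst xt))"
  have "R * of_int e = of_int (dot (fst xt) (map (cusp_order e) level_divisors))"
    unfolding R_def by (rule dot_cusp_order) (rule level_divisors_pos)
  also have "\<dots> \<ge> 0" using width_check_holds[OF e xt] by (simp add: width_check_def)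
  finally have R: "R \<ge> 0" using level_divisors_pos[OF e] by (simp add: zero_le_mult_iff)
  have ReE: "Re (sum_list (map2 (\<lambda>\<delta> k. of_int k * (of_real pi * \<i> / 12 * level_arg \<delta> e j z)) ds x)) =
        - (pi / 12 * Im z) * sum_list (map2 (\<lambda>\<delta> k. of_int k * level_ratio \<delta> e) ds x)" for z ds x
    by (induction ds x rule: list_induct2') (simp_all add: Im_level_arg algebra_simps)
  have "norm (E z) \<le> 1" if "Im z > 0" for z
    unfolding E_def eta_prod_exp norm_exp_eq_Re ReE R_def [symmetric] using R that by simp
  hence "E \<in> O[at_i_infinity](\<lambda>_. 1 :: complex)"
    by (intro bigoI[where c = 1] eventually_mono[OF eventually_at_i_infinity_upper[of 0]]) auto
  moreover have "U \<in> O[at_i_infinity](\<lambda>_. 1 :: complex)"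
  proof -
    have "(u \<delta> \<longlongrightarrow> 1 / of_real (sqrt (of_int (gcd \<delta> e)))) at_i_infinity" if "\<delta> \<in> set level_divisors" for \<delta>
    proof -
      from filterlim_compose[OF euler_prod_nome_tendsto filterlim_level_arg[OF level_divisors_pos[OF that], of e j]]
      show ?thesis unfolding u_def using level_quotients_pos(1)[OF level_divisors_pos[OF that], of e]
        by (intro tendsto_divide tendsto_const) auto
    qed
    hence "\<exists>c. ((\<lambda>z. prod_list (map2 (\<lambda>\<delta> k. u \<delta> z powi k) ds x)) \<longlongrightarrow> c) at_i_infinity"
      if "set ds \<subseteq> set level_divisors" for ds x
      using that
    proof (induction ds x rule: list_induct2')
      case (4 \<delta> ds k x)
      then obtain c where c: "((\<lambda>z. prod_list (map2 (\<lambda>\<delta> k. u \<delta> z powi k) ds x)) \<longlongrightarrow> c) at_i_infinity" by auto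
      have "((\<lambda>z. u \<delta> z powi k) \<longlongrightarrow> (1 / of_real (sqrt (of_int (gcd \<delta> e)))) powi k) at_i_infinity"
        using 4 level_quotients_pos(1)[OF level_divisors_pos, of \<delta> e] by (intro tendsto_power_int) auto
      from tendsto_mult[OF this c] show ?case by auto
    qed (auto intro: tendsto_const)
    then obtain c where "(U \<longlongrightarrow> c) at_i_infinity"
      unfolding U_def eta_prod_def by blast
    thus ?thesis by (rule bigo_1_of_tendsto)
  qed
  ultimately have "(\<lambda>z. E z * U z) \<in> O[at_i_infinity](\<lambda>_. 1 * 1 :: complex)"
    by (rule landau_o.big.mult)
  thus ?thesis unfolding eq [abs_def] by simp
qed

lemma sum_list_map2_bounded:
  fixes f :: "'a \<Rightarrow> complex \<Rightarrow> complex"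
  assumes "\<And>x. x \<in> set xs \<Longrightarrow> f x \<in> O[F](\<lambda>_. 1 :: complex)"
  shows "(\<lambda>z. sum_list (map2 (\<lambda>x b. b * f x z) xs bs)) \<in> O[F](\<lambda>_. 1 :: complex)"
  using assms
proof (induction xs bs rule: list_induct2')
  case (4 x xs b bs)
  have "(\<lambda>z. b * f x z) \<in> O[F](\<lambda>_. 1 * 1 :: complex)"
    using 4 by (intro landau_o.big.mult bigo_1_of_tendsto[OF tendsto_const]) auto
  moreover have "(\<lambda>z. sum_list (map2 (\<lambda>x b. b * f x z) xs bs)) \<in> O[F](\<lambda>_. 1 :: complex)"
    using 4 by auto
  ultimately show ?case by (simp add: sum_in_bigo)
qed auto

lemma form_at_bounded:
  assumes "r \<in> set level_divisors" "s \<in> set level_divisors" "e \<in> set level_divisors"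
  shows "form_at r s \<alpha> \<beta> \<gamma> e j \<in> O[at_i_infinity](\<lambda>_. 1 :: complex)"
proof -
  have "(\<lambda>z. eis_at r e j z - eis_at s e j z) \<in> O[at_i_infinity](\<lambda>_. 1 :: complex)"
    using assms by (intro sum_in_bigo eis_at_bounded level_divisors_pos)
  from landau_o.big_power[OF this, of 2]
  have "(\<lambda>z. (eis_at r e j z - eis_at s e j z) ^ 2) \<in> O[at_i_infinity](\<lambda>_. 1 :: complex)" by simp
  from landau_o.big.mult[OF bigo_1_of_tendsto[OF tendsto_const] this]
  have "(\<lambda>z. \<alpha> * (eis_at r e j z - eis_at s e j z) ^ 2) \<in> O[at_i_infinity](\<lambda>_. 1 :: complex)" by simp
  thus ?thesis
    unfolding form_at_def [abs_def] using assms
    by (intro sum_in_bigo sum_list_map2_bounded quad_at_bounded eta_form_at_bounded level_divisors_pos)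
qed

section \<open>A form of high order at one cusp vanishes\<close>
text \<open>Translate into the strip \<open>|Re w| \<le> 1/2\<close>. If then \<open>Im w < 1/2\<close>, one has \<open>|w|^2 \<le> 1/2\<close> and the inversion
at least doubles the imaginary part. The bound \<open>1/2\<close>, smaller than the optimal \<open>sqrt 3 / 2\<close>, is
what makes this gain uniform and the induction finite.\<close>
lemma exists_reduced_point:
  fixes P :: "complex \<Rightarrow> 'a"
  assumes shift: "\<And>z. Im z > 0 \<Longrightarrow> P (z + 1) = P z"
    and inv: "\<And>z. Im z > 0 \<Longrightarrow> P (- 1 / z) = P z"
    and z: "Im z > 0"
  shows "\<exists>w. \<bar>Re w\<bar> \<le> 1 / 2 \<and> Im w \<ge> 1 / 2 \<and> P w = P z"
proof -
  have shift_nat: "P (z + of_nat n) = P z" if "Im z > 0" for z n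
    using that by (induction n) (simp_all add: shift add.assoc [symmetric] add.commute[of 1])
  have shift_int: "P (z + of_int k) = P z" if "Im z > 0" for z k
  proof (cases k rule: int_cases2)
    case (nonneg n)
    thus ?thesis using shift_nat[OF that] by simp
  next
    case (nonpos n)
    thus ?thesis using shift_nat[of "z + of_int k" n] that by simp
  qed
  have "\<exists>w. \<bar>Re w\<bar> \<le> 1 / 2 \<and> Im w \<ge> 1 / 2 \<and> P w = P z" if "Im z > 0" "Im z * 2 ^ n \<ge> 1 / 2" for n z
    using that
  proof (induction n arbitrary: z)
    case (0 z)
    have "\<bar>Re (z + of_int (- round (Re z)))\<bar> \<le> 1 / 2"
      using of_int_round_abs_le[of "Re z"] by (simp add: abs_minus_commute)
    moreover have "P (z + of_int (- round (Re z))) = P z" using 0 by (intro shift_int)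
    ultimately show ?case using 0 by (intro exI[of _ "z + of_int (- round (Re z))"]) simp
  next
    case (Suc n z)
    define w where "w = z + of_int (- round (Re z))"
    have w: "\<bar>Re w\<bar> \<le> 1 / 2" "Im w = Im z" "P w = P z"
      using of_int_round_abs_le[of "Re z"] shift_int[OF Suc.prems(1), of "- round (Re z)"]
      by (simp_all add: w_def abs_minus_commute)
    show ?case
    proof (cases "Im w \<ge> 1 / 2")
      case False
      have "Re w ^ 2 \<le> (1 / 2) ^ 2" "Im w ^ 2 \<le> (1 / 2) ^ 2"
        using w False Suc.prems by (auto simp: abs_le_square_iff [symmetric])
      hence le: "Re w ^ 2 + Im w ^ 2 \<le> 1 / 2" by (simp add: power2_eq_square)
      have pos: "Re w ^ 2 + Im w ^ 2 > 0" using w Suc.prems by (simp add: add_nonneg_pos)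
      have "Im (- 1 / w) = Im w / (Re w ^ 2 + Im w ^ 2)" by (simp add: Im_divide)
      also have "\<dots> \<ge> Im w * 2"
        using le pos w Suc.prems by (simp add: pos_le_divide_eq mult.assoc)
      finally have Im2: "Im (- 1 / w) \<ge> Im z * 2" using w by simp
      have "Im z * 2 * 2 ^ n \<le> Im (- 1 / w) * 2 ^ n"
        using Im2 by (intro mult_right_mono) auto
      hence "\<exists>v. \<bar>Re v\<bar> \<le> 1 / 2 \<and> Im v \<ge> 1 / 2 \<and> P v = P (- 1 / w)"
        using Im2 Suc.prems by (intro Suc.IH) (auto simp: mult.assoc)
      thus ?thesis using inv[of w] w Suc.prems by auto
    qed (use w in blast)
  qed
  moreover obtain n where "1 / 2 < Im z * 2 ^ n"
    using real_arch_pow[of 2 "1 / 2 / Im z"] z by (auto simp: field_simps)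
  ultimately show ?thesis using z by (meson less_imp_le)
qed

text \<open>The modulus is invariant and tends to 0 at the cusp, so if it does not vanish it attains its supremum
on a compact part of the strip. By the maximum principle the function is then constant, and the constant is its
limit 0.\<close>
lemma modular_function_vanishes:
  assumes holo: "P holomorphic_on upper_half_plane"
    and shift: "\<And>z. Im z > 0 \<Longrightarrow> norm (P (z + 1)) = norm (P z)"
    and inv: "\<And>z. Im z > 0 \<Longrightarrow> norm (P (- 1 / z)) = norm (P z)"
    and lim: "(P \<longlongrightarrow> 0) at_i_infinity" and z0: "Im z0 > 0"
  shows "P z0 = 0"
proof (rule ccontr)
  assume nz: "P z0 \<noteq> 0"
  have "eventually (\<lambda>z. norm (P z) < norm (P z0)) at_i_infinity"
    using lim nz by (auto simp: tendsto_iff)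
  then obtain Y where Y: "\<And>z. Im z \<ge> Y \<Longrightarrow> norm (P z) < norm (P z0)"
    unfolding at_i_infinity_def eventually_filtercomap eventually_at_top_linorder by blast
  have red: "\<exists>w. \<bar>Re w\<bar> \<le> 1 / 2 \<and> Im w \<ge> 1 / 2 \<and> norm (P w) = norm (P z)" if "Im z > 0" for z
    by (rule exists_reduced_point[where P = "\<lambda>z. norm (P z)"]) (use shift inv that in auto)
  define K where "K = cbox (Complex (- 1 / 2) (1 / 2)) (Complex (1 / 2) Y)"
  have K: "z \<in> K \<longleftrightarrow> \<bar>Re z\<bar> \<le> 1 / 2 \<and> 1 / 2 \<le> Im z \<and> Im z \<le> Y" for z
    by (auto simp: K_def in_cbox_complex_iff)
  have "compact K" by (simp add: K_def compact_cbox)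
  obtain w0 where w0: "\<bar>Re w0\<bar> \<le> 1 / 2" "Im w0 \<ge> 1 / 2" "norm (P w0) = norm (P z0)"
    using red[OF z0] by blast
  have "w0 \<in> K" using Y[of w0] w0 by (auto simp: K intro: ccontr)
  have "continuous_on K (\<lambda>z. norm (P z))"
    by (intro continuous_intros continuous_on_subset[OF holomorphic_on_imp_continuous_on[OF holo]]) (auto simp: K)
  then obtain z1 where z1: "z1 \<in> K" "\<And>z. z \<in> K \<Longrightarrow> norm (P z) \<le> norm (P z1)"
    using continuous_attains_sup[OF \<open>compact K\<close>] \<open>w0 \<in> K\<close> by blast
  have le: "norm (P z) \<le> norm (P z1)" if zI: "Im z > 0" for z
  proof -
    obtain w where w: "\<bar>Re w\<bar> \<le> 1 / 2" "Im w \<ge> 1 / 2" "norm (P w) = norm (P z)"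
      using red[OF zI] by blast
    show ?thesis
    proof (cases "Im w \<le> Y")
      case True
      thus ?thesis using z1(2)[of w] w by (simp add: K)
    next
      case False
      hence "norm (P z) < norm (P z0)" using Y[of w] w by simp
      also have "\<dots> \<le> norm (P z1)" using z1(2)[OF \<open>w0 \<in> K\<close>] w0 by simp
      finally show ?thesis by simp
    qed
  qed
  have "P constant_on upper_half_plane"
  proof (rule maximum_modulus_principle[OF holo open_upper_half_plane connected_upper_half_plane open_upper_half_plane order.refl])
    show "z1 \<in> upper_half_plane" using z1 by (auto simp: K)
  qed (use le in auto)
  then obtain c where c: "\<And>z. Im z > 0 \<Longrightarrow> P z = c" unfolding constant_on_def by blast
  show False using Y[of "\<i> * of_real (max Y 1)"] c[of "\<i> * of_real (max Y 1)"] c[OF z0] by simp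
qed

text \<open>Holomorphic functions on a connected open set form an integral domain.\<close>
lemma holomorphic_prod_zero:
  assumes "finite I" "open S" "connected S" "S \<noteq> {}"
    and "\<And>i. i \<in> I \<Longrightarrow> f i holomorphic_on S" "\<And>z. z \<in> S \<Longrightarrow> (\<Prod>i\<in>I. f i z) = 0"
  shows "\<exists>i\<in>I. \<forall>z\<in>S. f i z = 0"
  using assms(1,5,6)
proof (induction I rule: finite_induct)
  case empty
  thus ?case using assms(4) by auto
next
  case (insert i I)
  show ?case
  proof (cases "\<forall>z\<in>S. f i z = 0")
    case False
    then obtain \<xi> where \<xi>: "\<xi> \<in> S" "f i \<xi> \<noteq> 0" by blast
    define U where "U = {z \<in> S. f i z \<noteq> 0}"
    have "continuous_on S (f i)" using insert.prems(1)[of i] by (auto intro: holomorphic_on_imp_continuous_on)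
    hence "open U"
      using continuous_openin_preimage_gen[of S "f i" "- {0}"] assms(2) unfolding U_def
      by (auto simp: openin_open_eq vimage_def Int_def)
    have "(\<Prod>k\<in>I. f k z) = 0" if "z \<in> S" for z
    proof (rule analytic_continuation[of "\<lambda>z. \<Prod>k\<in>I. f k z" S U \<xi>])
      show "(\<lambda>z. \<Prod>k\<in>I. f k z) holomorphic_on S" using insert.prems(1) by (auto intro!: holomorphic_intros)
      show "\<xi> islimpt U" using \<open>open U\<close> \<xi> by (intro interior_limit_point) (simp add: interior_open U_def)
      show "(\<Prod>k\<in>I. f k z) = 0" if "z \<in> U" for z
        using insert.prems(2)[of z] insert.hyps that by (auto simp: U_def)
    qed (use assms \<xi> that in \<open>auto simp: U_def\<close>)
    hence "\<exists>i\<in>I. \<forall>z\<in>S. f i z = 0" using insert.IH insert.prems(1) by blast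
    thus ?thesis by blast
  qed auto
qed

definition cusp_indices :: "(int \<times> int) set" where
  "cusp_indices = (SIGMA e:set level_divisors. {0..<e})"

lemma finite_cusp_indices: "finite cusp_indices"
  by (simp add: cusp_indices_def)

lemma card_cusp_indices: "card cusp_indices = 96"
  by (simp add: cusp_indices_def card_SigmaI level_divisors_def)

lemma quad_at_holomorphic:
  assumes "\<delta> > 0"
  shows "quad_at \<delta> e j holomorphic_on upper_half_plane"
proof -
  have "level_arg \<delta> e j holomorphic_on upper_half_plane"
    unfolding level_arg_altdef [abs_def] by (intro holomorphic_intros)
  moreover have "deriv eisE2 holomorphic_on upper_half_plane"
    by (intro holomorphic_deriv qexp_holomorphic[OF qexp_eisE2] open_upper_half_plane)
  ultimately have "(deriv eisE2 \<circ> level_arg \<delta> e j) holomorphic_on upper_half_plane"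
    by (rule holomorphic_on_compose_gen) (use Im_level_arg_pos[OF assms] in auto)
  moreover have "eis_at \<delta> e j holomorphic_on upper_half_plane"
    using eis_at_has_field_derivative[OF assms] by (auto simp: holomorphic_on_open[OF open_upper_half_plane])
  ultimately show ?thesis
    unfolding quad_at_def [abs_def] by (intro holomorphic_intros) (simp_all add: o_def)
qed

lemma form_at_holomorphic:
  assumes "r \<in> set level_divisors" "s \<in> set level_divisors"
  shows "form_at r s \<alpha> \<beta> \<gamma> e j holomorphic_on upper_half_plane"
proof -
  have eis: "eis_at \<delta> e j holomorphic_on upper_half_plane" if "\<delta> \<in> set level_divisors" for \<delta>
    using eis_at_has_field_derivative[OF level_divisors_pos[OF that]] by (auto simp: holomorphic_on_open[OF open_upper_half_plane])
  have eta: "eta_at \<delta> e j holomorphic_on upper_half_plane" if "\<delta> \<in> set level_divisors" for \<delta>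
    using eta_at_has_field_derivative[OF level_divisors_pos[OF that]] by (auto simp: holomorphic_on_open[OF open_upper_half_plane])
  have prods: "(\<lambda>z. prod_list (map2 (\<lambda>\<delta> k. eta_at \<delta> e j z powi k) ds x)) holomorphic_on upper_half_plane"
    if "set ds \<subseteq> set level_divisors" for ds x
    using that
  proof (induction ds x rule: list_induct2')
    case (4 \<delta> ds k x)
    thus ?case using eta[of \<delta>] eta_at_nonzero[OF level_divisors_pos[of \<delta>]]
      by (auto intro!: holomorphic_intros)
  qed (auto intro!: holomorphic_intros)
  have sums: "(\<lambda>z. sum_list (map2 (\<lambda>x b. b * h x z) xs bs)) holomorphic_on upper_half_plane"
    if "\<And>x. x \<in> set xs \<Longrightarrow> h x holomorphic_on upper_half_plane" for h :: "'b \<Rightarrow> complex \<Rightarrow> complex" and xs bs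
    using that by (induction xs bs rule: list_induct2') (auto intro!: holomorphic_intros)
  have "eta_form_at xt e j holomorphic_on upper_half_plane" for xt
    unfolding eta_form_at_def [abs_def] eta_prod_def by (intro holomorphic_intros prods) simp
  thus ?thesis unfolding form_at_def [abs_def] using assms
    by (intro holomorphic_intros eis sums quad_at_holomorphic level_divisors_pos)
qed

lemma norm_zeta24 [simp]: "norm (zeta24 k) = 1"
  by (simp add: zeta24_def norm_exp_eq_Re)

text \<open>The number 33 is the valence bound: the product over the 96 cosets is a form of weight 384 for the full modular group,
and a nonzero form of that weight has order at most \<open>384/12 = 32\<close> at the cusp.
The product being 0, the expansion at some coset is 0. Translations and the inversion act
transitively on the cosets, so the expansion at infinity is 0 too.\<close>
theorem form_at_vanishes:
  assumes rs: "r \<in> set level_divisors" "s \<in> set level_divisors"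
    and order: "form_at r s \<alpha> \<beta> \<gamma> 1 0 \<in> O[at_i_infinity](\<lambda>z. nome z ^ 33)"
    and z: "Im z > 0"
  shows "form_at r s \<alpha> \<beta> \<gamma> 1 0 z = 0"
proof -
  define f where "f = (\<lambda>p. form_at r s \<alpha> \<beta> \<gamma> (fst p) (snd p))"
  define N where "N = (\<lambda>z. \<Prod>p\<in>cusp_indices. f p z)"
  define P where "P = (\<lambda>z. N z / dedekind_eta z ^ 768)"
  define \<sigma> where "\<sigma> = (\<lambda>p. (inv_width (fst p) (snd p), inv_shift (fst p) (snd p)))"
  define \<tau> where "\<tau> = (\<lambda>p::int \<times> int. (fst p, (snd p + 1) mod fst p))"
  have ck: "inversion_check_at e j (inv_width e j) (inv_shift e j)" if "(e, j) \<in> cusp_indices" for e j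
    using inversion_check_holds[of e j] that by (auto simp: cusp_indices_def inversion_check_def)
  have \<sigma>: "\<sigma> p \<in> cusp_indices" "\<sigma> (\<sigma> p) = p" if "p \<in> cusp_indices" for p
    using ck[of "fst p" "snd p"] that by (auto simp: \<sigma>_def inversion_check_at_def cusp_indices_def)
  have f_inv: "f p (- 1 / z) = z ^ 4 * f (\<sigma> p) z" if "p \<in> cusp_indices" "Im z > 0" for p z
    unfolding f_def \<sigma>_def fst_conv snd_conv
    by (rule form_at_inversion[OF rs ck that(2)]) (use that in simp)
  have f_shift: "f p (z + 1) = f (\<tau> p) z" if pI: "p \<in> cusp_indices" and z: "Im z > 0" for p z
  proof -
    obtain e j where p: "p = (e, j)" "e \<in> set level_divisors" "0 \<le> j" "j < e"
      using pI by (auto simp: cusp_indices_def)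
    have "f p (z + 1) = form_at r s \<alpha> \<beta> \<gamma> e (j + 1) z" by (simp add: f_def p form_at_shift)
    also have "\<dots> = form_at r s \<alpha> \<beta> \<gamma> e ((j + 1) mod e) z"
    proof (cases "j + 1 = e")
      case True
      thus ?thesis using form_at_period[OF rs p(2) z, of \<alpha> \<beta> \<gamma> 0] by simp
    next
      case False
      thus ?thesis using p by simp
    qed
    finally show ?thesis by (simp add: f_def p \<tau>_def)
  qed
  have \<tau>: "bij_betw \<tau> cusp_indices cusp_indices"
  proof (rule bij_betwI[where g = "\<lambda>p. (fst p, (snd p - 1) mod fst p)"])
    show "\<tau> \<in> cusp_indices \<rightarrow> cusp_indices" "(\<lambda>p. (fst p, (snd p - 1) mod fst p)) \<in> cusp_indices \<rightarrow> cusp_indices"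
      by (auto simp: \<tau>_def cusp_indices_def level_divisors_pos)
  qed (auto simp: \<tau>_def cusp_indices_def mod_simps)
  have \<sigma>': "bij_betw \<sigma> cusp_indices cusp_indices"
    by (rule bij_betwI[where g = \<sigma>]) (use \<sigma> in auto)
  have holo: "f p holomorphic_on upper_half_plane" for p
    unfolding f_def by (rule form_at_holomorphic[OF rs])
  \<comment> \<open>\<open>P\<close> is the norm divided by \<open>\<Delta>^32\<close>; only its modulus is claimed to be invariant, so that the
      24th roots of unity in the laws for \<open>\<eta>\<close> do not matter.\<close>
  have P0: "P z = 0" if "Im z > 0" for z
  proof (rule modular_function_vanishes[OF _ _ _ _ that])
    show "P holomorphic_on upper_half_plane"
      unfolding P_def N_def using dedekind_eta_nonzero
      by (auto intro!: holomorphic_intros holo dedekind_eta_holomorphic)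
    fix z :: complex assume z: "Im z > 0"
    have "N (z + 1) = (\<Prod>p\<in>cusp_indices. f (\<tau> p) z)" unfolding N_def by (intro prod.cong f_shift z refl)
    also have "\<dots> = N z" unfolding N_def by (rule prod.reindex_bij_betw[OF \<tau>])
    finally show "norm (P (z + 1)) = norm (P z)"
      using dedekind_eta_add_int[of z 1] by (simp add: P_def norm_divide norm_mult norm_power)
    have "N (- 1 / z) = (\<Prod>p\<in>cusp_indices. z ^ 4 * f (\<sigma> p) z)" unfolding N_def by (intro prod.cong f_inv z refl)
    also have "\<dots> = (z ^ 4) ^ 96 * N z"
      unfolding N_def prod.distrib prod_constant card_cusp_indices prod.reindex_bij_betw[OF \<sigma>', of "\<lambda>p. f p z"] ..
    finally have "norm (N (- 1 / z)) = norm z ^ 384 * norm (N z)"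
      by (simp add: norm_mult norm_power flip: power_mult)
    moreover have "norm (dedekind_eta (- 1 / z) ^ 768) = norm z ^ 384 * norm (dedekind_eta z ^ 768)"
    proof -
      define c where "c = csqrt (- \<i> * z)"
      have "c ^ 2 = - \<i> * z" by (simp add: c_def)
      hence "norm c ^ 2 = norm z" by (metis norm_ii norm_minus_cancel norm_mult mult_1 norm_power)
      hence "norm c ^ 768 = norm z ^ 384" using power_mult[of "norm c" 2 384] by simp
      thus ?thesis unfolding dedekind_eta_inversion[OF z] c_def [symmetric] power_mult_distrib norm_mult norm_power by simp
    qed
    ultimately show "norm (P (- 1 / z)) = norm (P z)"
      using z by (auto simp: P_def norm_divide)
  next
    have I0: "(1, 0) \<in> cusp_indices" by (simp add: cusp_indices_def level_divisors_def)
    have "(\<lambda>z. \<Prod>p\<in>A. f p z) \<in> O[at_i_infinity](\<lambda>_. 1 :: complex)" if "A \<subseteq> cusp_indices" "finite A" for A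
      using that(2,1)
    proof (induction A rule: finite_induct)
      case (insert p A)
      have "f p \<in> O[at_i_infinity](\<lambda>_. 1 :: complex)"
        unfolding f_def using insert.prems by (intro form_at_bounded rs) (auto simp: cusp_indices_def)
      from landau_o.big.mult[OF this insert.IH] insert show ?case by simp
    qed simp
    hence "(\<lambda>z. \<Prod>p\<in>cusp_indices - {(1, 0)}. f p z) \<in> O[at_i_infinity](\<lambda>_. 1 :: complex)"
      using finite_cusp_indices by blast
    moreover have "f (1, 0) \<in> O[at_i_infinity](\<lambda>z. nome z ^ 33)" using order by (simp add: f_def)
    ultimately have "(\<lambda>z. f (1, 0) z * (\<Prod>p\<in>cusp_indices - {(1, 0)}. f p z)) \<in> O[at_i_infinity](\<lambda>z. nome z ^ 33 * 1)"
      by (intro landau_o.big.mult)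
    hence N: "N \<in> O[at_i_infinity](\<lambda>z. nome z ^ 33)"
      unfolding N_def prod.remove[OF finite_cusp_indices I0] by simp
    have eta: "dedekind_eta z ^ 768 = nome z ^ 32 * euler_prod 1 (nome z) ^ 768" for z
    proof -
      have "exp (of_real pi * \<i> * z / 12) ^ 768 = nome z ^ 32"
        unfolding exp_of_nat_mult [symmetric] by (rule arg_cong[where f = exp]) simp
      thus ?thesis unfolding dedekind_eta_euler_prod power_mult_distrib by simp
    qed
    have "((\<lambda>z. 1 / euler_prod 1 (nome z) ^ 768) \<longlongrightarrow> 1 / 1 ^ 768) at_i_infinity"
      by (intro tendsto_intros euler_prod_nome_tendsto) auto
    hence "(\<lambda>z. 1 / euler_prod 1 (nome z) ^ 768) \<in> O[at_i_infinity](\<lambda>_. 1 :: complex)"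
      by (rule bigo_1_of_tendsto)
    from landau_o.big.mult[OF N this]
    have "(\<lambda>z. N z * (1 / euler_prod 1 (nome z) ^ 768)) \<in> O[at_i_infinity](\<lambda>z. nome z ^ 33)" by simp
    then obtain C where C: "C > 0" "eventually (\<lambda>z. norm (N z * (1 / euler_prod 1 (nome z) ^ 768)) \<le> C * norm (nome z ^ 33)) at_i_infinity"
      by (auto elim: landau_o.bigE)
    have "eventually (\<lambda>z. norm (P z) \<le> C * norm (nome z)) at_i_infinity"
      using C(2)
    proof eventually_elim
      case (elim z)
      have "norm (P z) = norm (N z * (1 / euler_prod 1 (nome z) ^ 768)) / norm (nome z ^ 32)"
        by (simp add: P_def eta norm_divide norm_mult)
      also have "\<dots> \<le> C * norm (nome z ^ 33) / norm (nome z ^ 32)"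
        by (intro divide_right_mono elim) simp
      also have "\<dots> = C * norm (nome z)"
      proof -
        have "nome z ^ 33 = nome z ^ 32 * nome z" by (simp flip: power_Suc2)
        thus ?thesis by (simp only: norm_mult) simp
      qed
      finally show ?case .
    qed
    moreover have "((\<lambda>z. C * norm (nome z)) \<longlongrightarrow> 0) at_i_infinity"
      by (intro tendsto_mult_right_zero tendsto_norm_zero nome_tendsto_0)
    ultimately show "(P \<longlongrightarrow> 0) at_i_infinity" by (rule Lim_null_comparison)
  qed
  have "N z = 0" if "Im z > 0" for z
    using P0[OF that] dedekind_eta_nonzero[OF that] by (simp add: P_def)
  hence "\<exists>p\<in>cusp_indices. \<forall>z\<in>upper_half_plane. f p z = 0"
    unfolding N_def using holo
    by (intro holomorphic_prod_zero finite_cusp_indices open_upper_half_plane connected_upper_half_plane)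
       (auto intro!: exI[of _ \<i>])
  then obtain e j where p: "(e, j) \<in> cusp_indices" "\<And>z. Im z > 0 \<Longrightarrow> form_at r s \<alpha> \<beta> \<gamma> e j z = 0"
    by (auto simp: f_def)
  \<comment> \<open>From \<open>(e, j)\<close> with \<open>e > 1\<close> one reaches \<open>(1, 0)\<close> by way of \<open>(e, 1)\<close>, which the inversion moves to
      width 42, and of \<open>(42, 0)\<close>.\<close>
  have all_shifts: "form_at r s \<alpha> \<beta> \<gamma> e j' z = 0"
    if "\<And>z. Im z > 0 \<Longrightarrow> form_at r s \<alpha> \<beta> \<gamma> e j z = 0" "Im z > 0" for e j j' z
  proof -
    have "form_at r s \<alpha> \<beta> \<gamma> e j (z + of_int k) = form_at r s \<alpha> \<beta> \<gamma> e (j + k) z" for k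
      by (simp add: form_at_def eis_at_def quad_at_def eta_form_at_def eta_at_def level_arg_def add_ac)
    from this[of "j' - j"] show ?thesis using that by simp
  qed
  have invert: "form_at r s \<alpha> \<beta> \<gamma> (inv_width e j) (inv_shift e j) z = 0"
    if "(e, j) \<in> cusp_indices" "\<And>z. Im z > 0 \<Longrightarrow> form_at r s \<alpha> \<beta> \<gamma> e j z = 0" "Im z > 0" for e j z
    using form_at_inversion[OF rs ck[OF that(1)] that(3), of \<alpha> \<beta> \<gamma>] that(2)[OF Im_neg_inverse[OF that(3)]] that(3) by auto
  show ?thesis
  proof (cases "e = 1")
    case True
    hence "j = 0" using p(1) by (simp add: cusp_indices_def)
    thus ?thesis using True p(2)[OF z] by simp
  next
    case False
    have e: "e \<in> set level_divisors" using p by (auto simp: cusp_indices_def)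
    hence "(e, 1) \<in> cusp_indices" "inv_width e 1 = 42"
      using False by (auto simp: cusp_indices_def inv_width_def level_divisors_def)
    from invert[OF this(1) all_shifts[OF p(2)]] this(2)
    have "form_at r s \<alpha> \<beta> \<gamma> 42 (inv_shift e 1) z = 0" if "Im z > 0" for z using that by simp
    note z42 = all_shifts[OF this, of _ 0]
    have I42: "(42, 0) \<in> cusp_indices" by (simp add: cusp_indices_def level_divisors_def)
    have "\<sigma> (42, 0) = (1, 0)"
      using \<sigma>(1)[OF I42] by (auto simp: \<sigma>_def cusp_indices_def inv_width_def)
    thus ?thesis using invert[OF I42 z42 z] by (simp add: \<sigma>_def)
  qed
qed

section \<open>Coefficients of the forms at infinity\<close>
definition sigma_quot :: "nat \<Rightarrow> int \<Rightarrow> nat \<Rightarrow> int" where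
  "sigma_quot k d n = (if nat d dvd n then int (divsum k (n div nat d)) else 0)"

definition sigma_conv :: "int \<Rightarrow> int \<Rightarrow> nat \<Rightarrow> int" where
  "sigma_conv r s n = (\<Sum>i\<le>n. sigma_quot 1 r i * sigma_quot 1 s (n - i))"

lemma sigma_quot_0 [simp]: "sigma_quot k d 0 = 0"
  by (simp add: sigma_quot_def divsum_def)

lemma divisor_sigma_quotient:
  assumes "d > 0"
  shows "int (divisor_sigma k (rat_of_nat n / rat_of_int d)) = sigma_quot k d n"
proof (cases "nat d dvd n")
  case True
  then obtain c where n: "n = nat d * c" by (auto elim: dvdE)
  have "rat_of_int d = rat_of_nat (nat d)" using assms by simp
  hence "rat_of_nat n / rat_of_int d = rat_of_nat c" using assms by (simp add: n)
  thus ?thesis using assms by (simp add: divisor_sigma_def sigma_quot_def divsum_def n)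
next
  case False
  have "rat_of_nat n / rat_of_int d \<notin> \<int>"
  proof
    assume "rat_of_nat n / rat_of_int d \<in> \<int>"
    then obtain k where "rat_of_nat n / rat_of_int d = of_int k" by (auto elim: Ints_cases)
    hence "rat_of_int (int n) = rat_of_int (k * d)" using assms by (simp add: field_simps)
    hence "int n = k * d" by (simp only: of_int_eq_iff)
    hence "d dvd int n" by simp
    hence "nat d dvd n" using assms by (metis int_nat_eq less_imp_le of_nat_dvd_iff)
    thus False using False by simp
  qed
  thus ?thesis using False by (simp add: divisor_sigma_def sigma_quot_def)
qed

lemma divisor_sigma_of_nat: "divisor_sigma k (rat_of_nat n) = divsum k n"
  by (simp add: divisor_sigma_def divsum_def)

lemma conv_W_eq_sigma_conv:
  assumes "r > 0" "s > 0"
  shows "int (conv_W r s n) = sigma_conv (int r) (int s) n"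
proof -
  have "int (conv_W r s n) = (\<Sum>(l, m)\<in>{(l, m). r * l + s * m = n}. int (divsum 1 l) * int (divsum 1 m))"
    by (simp add: conv_W_def divisor_sigma_of_nat case_prod_unfold)
  also have "\<dots> = (\<Sum>i\<in>{i\<in>{..n}. r dvd i \<and> s dvd n - i}. int (divsum 1 (i div r)) * int (divsum 1 ((n - i) div s)))"
    by (rule sum.reindex_bij_witness[of _ "\<lambda>i. (i div r, (n - i) div s)" "\<lambda>(l, m). r * l"])
       (use assms in auto)
  also have "\<dots> = sigma_conv (int r) (int s) n"
    unfolding sigma_conv_def by (rule sum.mono_neutral_cong_left) (auto simp: sigma_quot_def)
  finally show ?thesis .
qed

lemma fps_X_deriv_nth: "fps_nth (fps_X * fps_deriv F) n = of_nat n * fps_nth F n"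
  by (cases n) simp_all

text \<open>Besge's formula is the statement about the coefficients.\<close>
lemma ramanujan_E2: "E2_fps ^ 2 = E4_fps + fps_const 12 * (fps_X * fps_deriv E2_fps)"
proof (rule fps_ext)
  fix n
  define B where "B = (\<Sum>i\<le>n. divsum 1 i * divsum 1 (n - i))"
  have sq: "fps_nth (sigma_fps 1 * sigma_fps 1) n = of_nat B"
    by (simp add: fps_mult_nth sigma_fps_def B_def atLeast0AtMost)
  have "12 * int B = 5 * int (divsum 3 n) + int (divsum 1 n) - 6 * int n * int (divsum 1 n)"
    unfolding B_def by (rule besge_identity)
  hence "of_int (12 * int B) = (of_int (5 * int (divsum 3 n) + int (divsum 1 n) - 6 * int n * int (divsum 1 n)) :: complex)"
    by (simp only:)
  hence B: "12 * of_nat B = (5 * of_nat (divsum 3 n) + of_nat (divsum 1 n) - 6 * of_nat n * of_nat (divsum 1 n) :: complex)"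
    by simp
  have "E2_fps ^ 2 = 1 - fps_const 48 * sigma_fps 1 + fps_const 576 * (sigma_fps 1 * sigma_fps 1)"
    unfolding E2_fps_def power2_eq_square
    by (simp add: algebra_simps flip: fps_const_mult) (simp flip: mult.assoc)
  hence "fps_nth (E2_fps ^ 2) n = (if n = 0 then 1 else 0) - 48 * of_nat (divsum 1 n) + 48 * (12 * of_nat B)"
    using sq by (simp add: sigma_fps_def)
  also have "\<dots> = fps_nth (E4_fps + fps_const 12 * (fps_X * fps_deriv E2_fps)) n"
    unfolding B fps_add_nth fps_mult_left_const_nth fps_X_deriv_nth
    by (simp add: E2_fps_def E4_fps_def sigma_fps_def divsum_def)
  finally show "fps_nth (E2_fps ^ 2) n = fps_nth (E4_fps + fps_const 12 * (fps_X * fps_deriv E2_fps)) n" .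
qed

lemma level_arg_infinity: "level_arg \<delta> 1 0 z = of_int \<delta> * z"
  by (simp add: level_arg_def)

lemma eis_at_infinity: "\<delta> > 0 \<Longrightarrow> eis_at \<delta> 1 0 z = of_int \<delta> * eisE2 (of_nat (nat \<delta>) * z)"
  by (simp add: eis_at_def level_arg_infinity level_ratio_def)

lemma eta_at_infinity: "eta_at \<delta> 1 0 z = dedekind_eta (of_int \<delta> * z)"
  by (simp add: eta_at_def level_arg_infinity)

definition eis_fps :: "int \<Rightarrow> complex fps" where
  "eis_fps \<delta> = fps_const (of_int \<delta>) * fps_dilate (nat \<delta>) E2_fps"

lemma qexp_eis_at:
  assumes "\<delta> > 0"
  shows "qexp (eis_at \<delta> 1 0) (eis_fps \<delta>)"
  unfolding eis_fps_def
  by (rule qexp_cong[OF qexp_cmult[OF qexp_dilate[OF qexp_eisE2]]]) (use assms in \<open>simp_all add: eis_at_infinity\<close>)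

lemma eis_fps_nth:
  assumes "\<delta> > 0"
  shows "fps_nth (eis_fps \<delta>) n = (if n = 0 then of_int \<delta> else - 24 * of_int \<delta> * of_int (sigma_quot 1 \<delta> n))"
  using assms by (auto simp: eis_fps_def fps_dilate_def E2_fps_def sigma_fps_def sigma_quot_def divsum_def)

lemma qexp_quad_at:
  assumes "\<delta> > 0"
  shows "qexp (quad_at \<delta> 1 0) (fps_const (of_int \<delta> ^ 2) * fps_dilate (nat \<delta>) E4_fps)"
proof -
  have "qexp (\<lambda>z. eisE2 z ^ 2 - 12 * (deriv eisE2 z / (2 * of_real pi * \<i>))) E4_fps"
    using qexp_diff[OF qexp_power[OF qexp_eisE2, of 2] qexp_cmult[OF qexp_theta_E2, of 12]]
    unfolding ramanujan_E2 by simp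
  from qexp_cmult[OF qexp_dilate[OF this, of "nat \<delta>"], of "of_int \<delta> ^ 2"]
  show ?thesis
  proof (rule qexp_cong)
    fix z :: complex
    show "of_int \<delta> ^ 2 * (eisE2 (of_nat (nat \<delta>) * z) ^ 2 - 12 * (deriv eisE2 (of_nat (nat \<delta>) * z) / (2 * of_real pi * \<i>))) = quad_at \<delta> 1 0 z"
      using assms unfolding quad_at_def eis_at_infinity[OF assms] level_arg_infinity level_ratio_def
      by (simp add: power_mult_distrib algebra_simps)
  qed (use assms in simp)
qed

lemma quad_fps_nth:
  assumes "\<delta> > 0"
  shows "fps_nth (fps_const (of_int \<delta> ^ 2) * fps_dilate (nat \<delta>) E4_fps) n =
     (if n = 0 then of_int \<delta> ^ 2 else 240 * of_int \<delta> ^ 2 * of_int (sigma_quot 3 \<delta> n))"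
  using assms by (auto simp: fps_dilate_def E4_fps_def sigma_fps_def sigma_quot_def divsum_def)

text \<open>Ramanujan's identity dilated by \<open>\<delta>\<close>. The dilation commutes with squaring, as one sees on the
functions that the power series represent.\<close>
lemma eis_fps_square_nth:
  assumes "\<delta> > 0"
  shows "fps_nth (eis_fps \<delta> ^ 2) n = (if n = 0 then of_int \<delta> ^ 2 else
     240 * of_int \<delta> ^ 2 * of_int (sigma_quot 3 \<delta> n) - 288 * of_int \<delta> * of_nat n * of_int (sigma_quot 1 \<delta> n))"
proof -
  have "qexp (\<lambda>z. of_int \<delta> ^ 2 * eisE2 (of_nat (nat \<delta>) * z) ^ 2)
          (fps_const (of_int \<delta> ^ 2) * fps_dilate (nat \<delta>) (E2_fps ^ 2))"
    by (intro qexp_cmult qexp_dilate[OF qexp_power[OF qexp_eisE2]]) (use assms in simp)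
  moreover have "qexp (\<lambda>z. of_int \<delta> ^ 2 * eisE2 (of_nat (nat \<delta>) * z) ^ 2) (eis_fps \<delta> ^ 2)"
    using qexp_power[OF qexp_eis_at[OF assms], of 2] by (simp add: eis_at_infinity[OF assms] power_mult_distrib)
  ultimately have eq: "eis_fps \<delta> ^ 2 = fps_const (of_int \<delta> ^ 2) * fps_dilate (nat \<delta>) (E2_fps ^ 2)"
    by (rule qexp_eqI[rotated])
  define G where "G = E2_fps ^ 2"
  have "fps_nth G m = (if m = 0 then 1 else 240 * of_nat (divsum 3 m) - 288 * of_nat m * of_nat (divsum 1 m))" for m
    unfolding G_def ramanujan_E2 fps_add_nth fps_mult_left_const_nth fps_X_deriv_nth
    by (simp add: E2_fps_def E4_fps_def sigma_fps_def divsum_def)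
  moreover have "of_nat n = (of_int \<delta> * of_nat (n div nat \<delta>) :: complex)" if "nat \<delta> dvd n"
  proof -
    have "n = nat \<delta> * (n div nat \<delta>)" using that by simp
    hence "of_nat n = (of_nat (nat \<delta>) * of_nat (n div nat \<delta>) :: complex)" by (metis of_nat_mult)
    thus ?thesis using assms by simp
  qed
  ultimately show ?thesis
    using assms unfolding eq G_def [symmetric] by (auto simp: fps_dilate_def sigma_quot_def power2_eq_square algebra_simps)
qed

lemma eis_fps_product_nth:
  assumes "r > 0" "s > 0"
  shows "fps_nth (eis_fps r * eis_fps s) n = (if n = 0 then of_int r * of_int s else
     of_int r * of_int s * (576 * of_int (sigma_conv r s n) - 24 * of_int (sigma_quot 1 r n) - 24 * of_int (sigma_quot 1 s n)))"
proof -
  define A where "A = (\<lambda>d. Abs_fps (\<lambda>n. of_int (sigma_quot 1 d n) :: complex))"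
  have e: "eis_fps d = fps_const (of_int d) * (1 - fps_const 24 * A d)" if "d > 0" for d
    by (rule fps_ext) (simp add: eis_fps_nth[OF that] A_def)
  have AA: "fps_nth (A r * A s) n = of_int (sigma_conv r s n)"
    by (simp add: fps_mult_nth A_def sigma_conv_def atLeast0AtMost)
  have "eis_fps r * eis_fps s = fps_const (of_int r * of_int s) *
     (1 - fps_const 24 * A r - fps_const 24 * A s + fps_const 576 * (A r * A s))"
  proof -
    have "fps_const (576 :: complex) = fps_const 24 * fps_const 24" by simp
    thus ?thesis unfolding e[OF assms(1)] e[OF assms(2)] fps_const_mult [symmetric] by (simp only: ring_distribs mult_ac) (simp add: algebra_simps)
  qed
  hence "fps_nth (eis_fps r * eis_fps s) n = of_int r * of_int s *
      (fps_nth 1 n - 24 * fps_nth (A r) n - 24 * fps_nth (A s) n + 576 * fps_nth (A r * A s) n)"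
    by (simp only: fps_mult_left_const_nth fps_add_nth fps_sub_nth)
  moreover have "fps_nth (A d) n = of_int (sigma_quot 1 d n)" for d by (simp add: A_def)
  ultimately have "fps_nth (eis_fps r * eis_fps s) n = of_int r * of_int s *
      (fps_nth 1 n - 24 * of_int (sigma_quot 1 r n) - 24 * of_int (sigma_quot 1 s n) + 576 * of_int (sigma_conv r s n))"
    by (simp only: AA)
  thus ?thesis by (simp add: sigma_conv_def)
qed

lemma qexp_sum_list_map2:
  assumes "\<And>x. x \<in> set xs \<Longrightarrow> qexp (f x) (F x)"
  shows "qexp (\<lambda>z. sum_list (map2 (\<lambda>x b. b * f x z) xs bs)) (sum_list (map2 (\<lambda>x b. fps_const b * F x) xs bs))"
  using assms
proof (induction xs bs rule: list_induct2')
  case (4 x xs b bs)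
  have "qexp (\<lambda>z. b * f x z + sum_list (map2 (\<lambda>x b. b * f x z) xs bs))
          (fps_const b * F x + sum_list (map2 (\<lambda>x b. fps_const b * F x) xs bs))"
    using 4 by (intro qexp_add qexp_cmult) auto
  thus ?case by simp
qed (use qexp_const[of 0] in simp_all)

lemma fps_nth_sum_list_map2:
  fixes F :: "'a \<Rightarrow> complex fps"
  shows
  "fps_nth (sum_list (map2 (\<lambda>x b. fps_const b * F x) xs bs)) n = sum_list (map2 (\<lambda>x b. b * fps_nth (F x) n) xs bs)"
  by (induction xs bs rule: list_induct2') (simp_all add: fps_mult_left_const_nth)

lemma sum_list_map2_cong:
  "(\<And>x y. x \<in> set xs \<Longrightarrow> f x y = g x y) \<Longrightarrow> sum_list (map2 f xs ys) = sum_list (map2 g xs ys)"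
  by (induction xs ys rule: list_induct2') auto

lemma eta_form_at_eta_quotient:
  assumes "k \<in> {1..20}"
  shows "eta_form_at (eta_data ! (k - 1)) 1 0 z = eta_quotient k z"
proof -
  consider "k = 1" | "k = 2" | "k = 3" | "k = 4" | "k = 5" | "k = 6" | "k = 7" | "k = 8" | "k = 9" | "k = 10" | "k = 11" | "k = 12" | "k = 13" | "k = 14" | "k = 15" | "k = 16" | "k = 17" | "k = 18" | "k = 19" | "k = 20"
    using assms by (auto simp: atLeastAtMost_iff le_Suc_eq numeral_eq_Suc)
  thus ?thesis
    by cases (simp_all add: eta_form_at_def eta_data_def al_sign_def dot_def eta_prod_def level_divisors_def
        eta_at_infinity eta_quotient_def Let_def power_int_minus divide_inverse mult_ac)
qed

lemma length_eta_data: "length eta_data = 20"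
  by (simp add: eta_data_def)

definition eta_fps :: "nat \<Rightarrow> complex fps" where
  "eta_fps k = Abs_fps (\<lambda>n. of_int (eta_coeff k n))"

lemma qexp_eta_form:
  assumes "k \<in> {1..20}"
  shows "qexp (eta_form_at (eta_data ! (k - 1)) 1 0) (eta_fps k)"
proof (rule qexp_sumsI)
  fix z :: complex assume "Im z > 0"
  thus "(\<lambda>n. fps_nth (eta_fps k) n * nome z ^ n) sums eta_form_at (eta_data ! (k - 1)) 1 0 z"
    using has_q_expansion_eta_coeff[OF assms] unfolding eta_form_at_eta_quotient[OF assms]
    by (simp add: has_q_expansion_def eta_fps_def)
qed

lemma eta_form_at_has_field_derivative:
  assumes z: "Im z > 0"
  shows "(eta_form_at xt e j has_field_derivative
     of_real pi * \<i> / 12 * sum_list (map2 (\<lambda>\<delta> b. b * eis_at \<delta> e j z) level_divisors (map of_int (fst xt))) * eta_form_at xt e j z) (at z)"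
proof -
  define c where "c = of_real pi * \<i> / 12"
  have "((\<lambda>z. prod_list (map2 (\<lambda>\<delta> k. eta_at \<delta> e j z powi k) ds x)) has_field_derivative
          c * sum_list (map2 (\<lambda>\<delta> b. b * eis_at \<delta> e j z) ds (map of_int x)) * prod_list (map2 (\<lambda>\<delta> k. eta_at \<delta> e j z powi k) ds x)) (at z)"
    if "\<And>\<delta>. \<delta> \<in> set ds \<Longrightarrow> \<delta> > 0" for ds x
    using that
  proof (induction ds x rule: list_induct2')
    case (4 \<delta> ds k x)
    have \<delta>: "\<delta> > 0" using 4 by auto
    define h where "h = eta_at \<delta> e j z"
    have h0: "h \<noteq> 0" unfolding h_def by (rule eta_at_nonzero[OF \<delta> z])
    have "((\<lambda>z. eta_at \<delta> e j z powi k) has_field_derivative of_int k * h powi (k - 1) * (c * eis_at \<delta> e j z * h)) (at z)"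
      unfolding h_def c_def
      by (rule DERIV_power_int[OF eta_at_has_field_derivative[OF \<delta> z], THEN DERIV_cong])
         (use eta_at_nonzero[OF \<delta> z] in simp_all)
    also have "of_int k * h powi (k - 1) * (c * eis_at \<delta> e j z * h) = c * (of_int k * eis_at \<delta> e j z) * h powi k"
      using h0 by (simp add: power_int_diff)
    finally have d: "((\<lambda>z. eta_at \<delta> e j z powi k) has_field_derivative c * (of_int k * eis_at \<delta> e j z) * eta_at \<delta> e j z powi k) (at z)"
      by (simp add: h_def)
    from DERIV_mult[OF d 4(1)] 4(2) show ?case
      by (simp add: algebra_simps)
  qed auto
  from DERIV_cmult[OF this[of level_divisors "fst xt"], of "zeta24 (al_sign (snd xt) e)"] show ?thesis
    unfolding eta_form_at_def [abs_def] eta_prod_def c_def [symmetric] using level_divisors_pos by (simp add: mult_ac)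
qed

text \<open>The coefficients of the logarithmic derivative of an eta quotient with exponents \<open>x\<close>, apart from the
constant one.\<close>
definition eta_tau :: "int list \<Rightarrow> nat \<Rightarrow> int" where
  "eta_tau x n = - sum_list (map2 (\<lambda>\<delta> k. k * \<delta> * sigma_quot 1 \<delta> n) level_divisors x)"

text \<open>The operator \<open>\<theta> = q d/dq\<close> multiplies the \<open>n\<close>-th coefficient by \<open>n\<close>, while \<open>\<theta> C = (1/24 \<Sum> x\<^sub>\<delta> L\<^sub>\<delta>) C\<close> for an eta
quotient \<open>C\<close>. The constant term of the bracket is the order \<open>m\<close> of the quotient. For \<open>n < m\<close> the
recurrence gives 0, and for \<open>n = m\<close> it leaves the coefficient undetermined; that it is 1
is read off the product.\<close>
lemma eta_coeff_recurrence:
  assumes k: "k \<in> {1..20}" and x: "x = fst (eta_data ! (k - 1))" and m: "dot x level_divisors = 24 * m"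
  shows "(int n - m) * eta_coeff k n = (\<Sum>i=1..n. eta_tau x i * eta_coeff k (n - i))"
proof -
  define f where "f = eta_form_at (eta_data ! (k - 1)) 1 0"
  define T where "T = sum_list (map2 (\<lambda>\<delta> b. fps_const b * eis_fps \<delta>) level_divisors (map of_int x))"
  have q: "qexp f (eta_fps k)" unfolding f_def by (rule qexp_eta_form[OF k])
  have "qexp (\<lambda>z. of_real pi * \<i> / 12 * sum_list (map2 (\<lambda>\<delta> b. b * eis_at \<delta> 1 0 z) level_divisors (map of_int x)) * f z / (2 * of_real pi * \<i>))
          (fps_X * fps_deriv (eta_fps k))"
    by (rule qexp_theta[OF q]) (unfold f_def x, rule eta_form_at_has_field_derivative)
  moreover have "qexp (\<lambda>z. (1 / 24 * sum_list (map2 (\<lambda>\<delta> b. b * eis_at \<delta> 1 0 z) level_divisors (map of_int x))) * f z)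
          ((fps_const (1 / 24) * T) * eta_fps k)"
    unfolding T_def by (intro qexp_mult qexp_cmult qexp_sum_list_map2 qexp_eis_at q level_divisors_pos)
  hence "qexp (\<lambda>z. of_real pi * \<i> / 12 * sum_list (map2 (\<lambda>\<delta> b. b * eis_at \<delta> 1 0 z) level_divisors (map of_int x)) * f z / (2 * of_real pi * \<i>))
          ((fps_const (1 / 24) * T) * eta_fps k)"
    by (rule qexp_cong) simp
  ultimately have eq: "fps_X * fps_deriv (eta_fps k) = (fps_const (1 / 24) * T) * eta_fps k"
    by (rule qexp_eqI)
  have T0: "fps_nth (fps_const (1 / 24) * T) 0 = of_int m"
  proof -
    have "fps_nth T 0 = sum_list (map2 (\<lambda>\<delta> b. b * of_int \<delta>) level_divisors (map of_int x))"
      unfolding T_def fps_nth_sum_list_map2 by (intro sum_list_map2_cong) (simp add: eis_fps_nth level_divisors_pos)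
    also have "sum_list (map2 (\<lambda>\<delta> b. b * of_int \<delta>) ds (map of_int x)) = (of_int (dot x ds) :: complex)" for ds x
      unfolding dot_def by (induction ds x rule: list_induct2') simp_all
    finally show ?thesis by (simp add: m)
  qed
  have Ti: "fps_nth (fps_const (1 / 24) * T) i = of_int (eta_tau x i)" if "i > 0" for i
  proof -
    have "fps_nth T i = sum_list (map2 (\<lambda>\<delta> b. b * (- 24 * of_int \<delta> * of_int (sigma_quot 1 \<delta> i))) level_divisors (map of_int x))"
      unfolding T_def fps_nth_sum_list_map2 using that by (intro sum_list_map2_cong) (simp add: eis_fps_nth level_divisors_pos)
    also have "sum_list (map2 (\<lambda>\<delta> b. b * (- 24 * of_int \<delta> * of_int (sigma_quot 1 \<delta> i))) ds (map of_int x)) =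
        (24 * of_int (- sum_list (map2 (\<lambda>\<delta> k. k * \<delta> * sigma_quot 1 \<delta> i) ds x)) :: complex)" for ds x
      by (induction ds x rule: list_induct2') (simp_all add: algebra_simps)
    finally show ?thesis by (simp add: eta_tau_def)
  qed
  have "of_nat n * of_int (eta_coeff k n) = fps_nth (fps_X * fps_deriv (eta_fps k)) n"
    unfolding fps_X_deriv_nth by (simp add: eta_fps_def)
  also have "\<dots> = (\<Sum>i=0..n. fps_nth (fps_const (1 / 24) * T) i * of_int (eta_coeff k (n - i)))"
    unfolding eq fps_mult_nth[of "fps_const (1 / 24) * T"] by (simp add: eta_fps_def)
  also have "\<dots> = fps_nth (fps_const (1 / 24) * T) 0 * of_int (eta_coeff k n) +
      (\<Sum>i=1..n. fps_nth (fps_const (1 / 24) * T) i * of_int (eta_coeff k (n - i)))"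
    by (subst sum.atLeast_Suc_atMost) simp_all
  also have "(\<Sum>i=1..n. fps_nth (fps_const (1 / 24) * T) i * of_int (eta_coeff k (n - i))) =
      (\<Sum>i=1..n. of_int (eta_tau x i) * of_int (eta_coeff k (n - i)))"
    by (intro sum.cong refl) (subst Ti; simp)
  also note T0
  finally have "(of_int ((int n - m) * eta_coeff k n) :: complex) = of_int (\<Sum>i=1..n. eta_tau x i * eta_coeff k (n - i))"
    by (simp add: algebra_simps)
  thus ?thesis by (simp only: of_int_eq_iff)
qed

lemma eta_coeff_below_order:
  assumes k: "k \<in> {1..20}" and x: "x = fst (eta_data ! (k - 1))" and m: "dot x level_divisors = 24 * m"
  shows "int n < m \<Longrightarrow> eta_coeff k n = 0"
proof (induction n rule: less_induct)
  case (less n)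
  have "(int n - m) * eta_coeff k n = (\<Sum>i=1..n. eta_tau x i * eta_coeff k (n - i))"
    by (rule eta_coeff_recurrence[OF k x m])
  also have "\<dots> = 0" using less by (intro sum.neutral) auto
  finally show ?case using less.prems by simp
qed

lemma al_sign_1 [simp]: "al_sign t 1 = 0"
proof -
  have "sum_list (map2 (*) t (map (\<lambda>_. 0) ps)) = (0 :: int)" for ps :: "int list"
    by (induction t ps rule: list_induct2') simp_all
  from this[of "[2, 3, 7]"] show ?thesis by (simp add: al_sign_def dot_def)
qed

lemma eta_coeff_leading:
  assumes k: "k \<in> {1..20}" and x: "x = fst (eta_data ! (k - 1))" and m: "dot x level_divisors = 24 * int m"
  shows "eta_coeff k m = 1"
proof -
  define f where "f = eta_form_at (eta_data ! (k - 1)) 1 0"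
  define U where "U = (\<lambda>z. eta_prod (\<lambda>\<delta>. euler_prod 1 (nome (level_arg \<delta> 1 0 z))) x)"
  have q: "qexp f (eta_fps k)" unfolding f_def by (rule qexp_eta_form[OF k])
  have sh: "qexp (\<lambda>z. f z / nome z ^ m) (fps_shift m (eta_fps k))"
    by (rule qexp_shift[OF q]) (simp add: eta_fps_def eta_coeff_below_order[OF k x m])
  have f: "f z = nome z ^ m * U z" for z
  proof -
    have "eta_at \<delta> 1 0 z = exp (of_real pi * \<i> / 12 * of_int \<delta> * z) * euler_prod 1 (nome (level_arg \<delta> 1 0 z))" for \<delta>
      by (simp add: eta_at_def dedekind_eta_euler_prod level_arg_infinity mult_ac)
    hence "f z = eta_prod (\<lambda>\<delta>. exp (of_real pi * \<i> / 12 * of_int \<delta> * z)) x * U z"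
      unfolding f_def U_def eta_form_at_def x eta_prod_mult [symmetric] by simp
    also have "eta_prod (\<lambda>\<delta>. exp (of_real pi * \<i> / 12 * of_int \<delta> * z)) x = nome z ^ m"
    proof -
      have S: "sum_list (map2 (\<lambda>\<delta> k. of_int k * (of_real pi * \<i> / 12 * of_int \<delta> * z)) ds x) = of_real pi * \<i> / 12 * of_int (dot x ds) * z" for ds
        unfolding dot_def by (induction ds x rule: list_induct2') (simp_all add: algebra_simps add_divide_distrib)
      show ?thesis unfolding eta_prod_exp S m exp_of_nat_mult [symmetric] by (simp add: mult_ac)
    qed
    finally show ?thesis .
  qed
  note lim = filterlim_compose[OF euler_prod_nome_tendsto filterlim_level_arg]
  have "((\<lambda>z. prod_list (map2 (\<lambda>\<delta> k. euler_prod 1 (nome (level_arg \<delta> 1 0 z)) powi k) ds x)) \<longlongrightarrow> 1) at_i_infinity"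
    if "\<And>\<delta>. \<delta> \<in> set ds \<Longrightarrow> \<delta> > 0" for ds x
    using that
  proof (induction ds x rule: list_induct2')
    case (4 \<delta> ds k x)
    have "((\<lambda>z. euler_prod 1 (nome (level_arg \<delta> 1 0 z)) powi k) \<longlongrightarrow> 1 powi k) at_i_infinity"
      using 4 by (intro tendsto_power_int lim) auto
    from tendsto_mult[OF this 4(1)] 4(2) show ?case by simp
  qed auto
  hence "(U \<longlongrightarrow> 1) at_i_infinity" unfolding U_def eta_prod_def by (simp add: level_divisors_pos)
  moreover have "(U \<longlongrightarrow> fps_nth (fps_shift m (eta_fps k)) 0) at_i_infinity"
    using qexp_tendsto[OF sh] by (simp add: f)
  moreover have "at_i_infinity \<noteq> bot" by (rule at_i_infinity_neq_bot)
  ultimately have "fps_nth (fps_shift m (eta_fps k)) 0 = 1"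
    using tendsto_unique by blast
  thus ?thesis by (simp add: eta_fps_def)
qed

section \<open>The first coefficients\<close>
definition divisor_term :: "nat \<Rightarrow> int \<Rightarrow> int \<Rightarrow> int" where
  "divisor_term k n d = (if n mod d = 0 then d ^ k else 0)"

definition sigma_at :: "nat \<Rightarrow> int \<Rightarrow> int" where
  "sigma_at k n = sum_list (map (divisor_term k n) [1..n])"

definition sigma_list :: "nat \<Rightarrow> int list" where
  "sigma_list k = map (sigma_at k) [0..32]"

definition quot_at :: "int list \<Rightarrow> int \<Rightarrow> int \<Rightarrow> int" where
  "quot_at T d i = (if i mod d = 0 then T ! nat (i div d) else 0)"

definition quot_list :: "int list \<Rightarrow> int \<Rightarrow> int list" where
  "quot_list T d = map (quot_at T d) [0..32]"

definition axpy :: "int \<Rightarrow> int \<Rightarrow> int \<Rightarrow> int" where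
  "axpy c x y = c * x + y"

fun lincomb :: "int list \<Rightarrow> int list list \<Rightarrow> int list" where
  "lincomb (c # cs) (l # ls) = map2 (axpy c) l (lincomb cs ls)"
| "lincomb _ _ = replicate 33 0"

text \<open>The convolution of two sequences without access by index: \<open>acc\<close> holds the terms of the second
sequence already read, the most recent first, which is the order in which they meet the first sequence.\<close>
fun conv_run :: "int list \<Rightarrow> int list \<Rightarrow> int list \<Rightarrow> int list" where
  "conv_run A acc [] = []"
| "conv_run A acc (b # bs) = sum_list (map2 (*) A (b # acc)) # conv_run A (b # acc) bs"

text \<open>One step of \<open>eta_coeff_recurrence\<close>, where \<open>acc\<close> lists the previous coefficients, the most recent
first; the division is exact.\<close>
definition eta_next :: "int \<Rightarrow> int list \<Rightarrow> int list \<Rightarrow> int \<Rightarrow> int" where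
  "eta_next m t acc n = (if n < m then 0 else if n = m then 1 else sum_list (map2 (*) t acc) div (n - m))"

fun eta_run :: "int \<Rightarrow> int list \<Rightarrow> int list \<Rightarrow> int list \<Rightarrow> int list" where
  "eta_run m t acc [] = rev acc"
| "eta_run m t acc (n # ns) = eta_run m t (eta_next m t acc n # acc) ns"

text \<open>The argument \<open>S\<close> consists of the sequences \<open>\<sigma>(n/\<delta>)\<close> for the divisors \<open>\<delta>\<close> of 42. Omitting the head drops the index 0,
since the recurrence starts with \<open>i = 1\<close>.\<close>
definition eta_list :: "int list list \<Rightarrow> int list \<times> int list \<Rightarrow> int list" where
  "eta_list S xt = eta_run (dot (fst xt) level_divisors div 24)
     (map uminus (tl (lincomb (map2 (*) (fst xt) level_divisors) S))) [] [0..32]"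

text \<open>The first 33 values of \<open>residual\<close>, given \<open>\<sigma>\<close>, the sequences \<open>\<sigma>\<^sub>3(n/\<delta>)\<close> and the coefficients of the
eta quotients.\<close>
definition residual_list :: "int list \<Rightarrow> int list list \<Rightarrow> int list list \<Rightarrow> int \<times> int \<times> int list \<Rightarrow> int list" where
  "residual_list T S E p = (case p of (r, s, g) \<Rightarrow>
     lincomb ([42000, - 1750, - 1750, 10500 div s, 10500 div r] @ map (\<lambda>\<delta>. - 7 * \<delta> * \<delta>) level_divisors @ map uminus g)
       ([conv_run (quot_list T r) [] (quot_list T s), quot_list T r, quot_list T s,
         map2 (*) [0..32] (quot_list T r), map2 (*) [0..32] (quot_list T s)] @ S @ E))"

definition residual_ok :: "int list \<Rightarrow> int list list \<Rightarrow> int list list \<Rightarrow> int \<times> int \<times> int list \<Rightarrow> bool" where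
  "residual_ok T S E p \<longleftrightarrow> residual_list T S E p = replicate 33 0"

text \<open>For each of the four identities, \<open>r\<close>, \<open>s\<close> and the coefficients of \<open>c\<^sub>1, \<dots>, c\<^sub>2\<^sub>0\<close>, multiplied by the
common denominator 42000.\<close>
definition identity_data :: "(int \<times> int \<times> int list) list" where
  "identity_data = [
     (1, 42, [-1200, -855, 0, -300, -7, 51450, -185430, 14357, 5950, -81480, 570150, -35560, 21700, -113400, -8400, 90300, 0, -37800, -945, -6300]),
     (2, 21, [-600, -855, -1500, 600, -7, 68250, -147630, -29743, 14350, -81480, 397950, -34160, 23100, -151200, -4200, 81900, 0, 12600, -945, -18900]),
     (3, 14, [1200, -105, 0, -1200, -7, -38850, 175770, -15043, -5950, 86520, -570150, 36540, -21700, 113400, 8400, -90300, -13500, 37800, -7695, 6300]),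
     (6, 7, [600, -6105, 1500, 900, -1507, -55650, 206970, -44443, -14350, 26520, -397950, 58140, -23100, 151200, 4200, -81900, 13500, -12600, -61695, 18900])]"

lemma residual_check:
  "list_all (residual_ok (sigma_list 1) (map (quot_list (sigma_list 3)) level_divisors)
     (map (eta_list (map (quot_list (sigma_list 1)) level_divisors)) eta_data)) identity_data"
  by code_simp

lemma upto_32: "[0..32] = map int [0..<33]"
  by (rule nth_equalityI) simp_all

lemma divsum_eq_sigma_at: "int (divsum k n) = sigma_at k (int n)"
proof (cases "n = 0")
  case False
  have "sigma_at k (int n) = (\<Sum>d\<in>{1..int n}. divisor_term k (int n) d)"
    unfolding sigma_at_def by (subst interv_sum_list_conv_sum_set_int) simp
  also have "\<dots> = (\<Sum>d\<in>{1..n}. divisor_term k (int n) (int d))"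
    by (rule sum.reindex_bij_witness[of _ int nat]) auto
  also have "\<dots> = (\<Sum>d\<in>{d. d dvd n}. int d ^ k)"
  proof (rule sum.mono_neutral_cong_right)
    show "{d. d dvd n} \<subseteq> {1..n}" using False by (auto dest: dvd_imp_le intro: Nat.gr0I)
  qed (auto simp: divisor_term_def simp flip: zmod_int)
  finally show ?thesis using False by (simp add: divsum_def)
qed (simp add: divsum_def sigma_at_def)

lemma sigma_list_nth: "n < 33 \<Longrightarrow> sigma_list k ! n = int (divsum k n)"
  by (simp add: sigma_list_def divsum_eq_sigma_at upto_32)

lemma length_quot_list [simp]: "length (quot_list T d) = 33"
  by (simp add: quot_list_def)

lemma quot_list_nth:
  assumes "n < 33" "d > 0"
  shows "quot_list (sigma_list k) d ! n = sigma_quot k d n"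
proof -
  have d: "d = int (nat d)" using assms by simp
  have "quot_list (sigma_list k) d ! n = quot_at (sigma_list k) (int (nat d)) (int n)"
    using assms by (simp add: quot_list_def upto_32)
  also have "\<dots> = (if nat d dvd n then sigma_list k ! (n div nat d) else 0)"
    unfolding quot_at_def zmod_int [symmetric] zdiv_int [symmetric] by (simp add: dvd_eq_mod_eq_0)
  also have "n div nat d < 33" using assms(1) div_le_dividend[of n "nat d"] by linarith
  ultimately show ?thesis by (simp add: sigma_quot_def sigma_list_nth)
qed

lemma lincomb_nth:
  assumes "\<And>l. l \<in> set ls \<Longrightarrow> length l = 33"
  shows "length (lincomb cs ls) = 33 \<and> (\<forall>n<33. lincomb cs ls ! n = sum_list (map2 (\<lambda>c l. c * l ! n) cs ls))"
  using assms by (induction cs ls rule: lincomb.induct) (auto simp: axpy_def)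

lemma sum_list_map2_nth:
  fixes xs ys :: "int list"
  assumes "length ys \<le> length xs"
  shows "sum_list (map2 (*) xs ys) = (\<Sum>i<length ys. xs ! i * ys ! i)"
  using assms by (subst sum_list_sum_nth) (simp add: atLeast0LessThan)

lemma length_conv_run: "length (conv_run A acc bs) = length bs"
  by (induction A acc bs rule: conv_run.induct) auto

lemma conv_run_nth:
  assumes "k + m < length B" "length A = length B"
  shows "conv_run A (rev (take k B)) (drop k B) ! m = (\<Sum>i\<le>k + m. A ! i * B ! (k + m - i))"
  using assms(1)
proof (induction m arbitrary: k)
  case 0
  have dr: "drop k B = B ! k # drop (Suc k) B" using 0 by (simp add: Cons_nth_drop_Suc)
  have acc: "B ! k # rev (take k B) = rev (take (Suc k) B)" using 0 by (simp add: take_Suc_conv_app_nth)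
  have "conv_run A (rev (take k B)) (drop k B) ! 0 = sum_list (map2 (*) A (rev (take (Suc k) B)))"
    unfolding dr by (simp add: acc)
  also have "\<dots> = (\<Sum>i<Suc k. A ! i * rev (take (Suc k) B) ! i)"
    using 0 assms(2) by (subst sum_list_map2_nth) auto
  also have "\<dots> = (\<Sum>i\<le>k. A ! i * B ! (k - i))"
    using 0 by (intro sum.cong) (auto simp: rev_nth)
  finally show ?case by simp
next
  case (Suc m)
  have dr: "drop k B = B ! k # drop (Suc k) B" using Suc.prems by (simp add: Cons_nth_drop_Suc)
  have acc: "B ! k # rev (take k B) = rev (take (Suc k) B)" using Suc.prems by (simp add: take_Suc_conv_app_nth)
  have "conv_run A (rev (take k B)) (drop k B) ! Suc m = conv_run A (rev (take (Suc k) B)) (drop (Suc k) B) ! m"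
    unfolding dr by (simp add: acc)
  thus ?case using Suc.IH[of "Suc k"] Suc.prems by simp
qed

lemma eta_run_correct:
  fixes c :: "nat \<Rightarrow> int"
  assumes rec: "\<And>n. (int n - int m) * c n = (\<Sum>i=1..n. \<tau> i * c (n - i))"
    and below: "\<And>n. n < m \<Longrightarrow> c n = 0" and lead: "c m = 1"
    and t: "length t + 1 = N" "\<And>i. i < length t \<Longrightarrow> t ! i = \<tau> (Suc i)"
  shows "k \<le> N \<Longrightarrow> eta_run (int m) t (rev (map c [0..<k])) (map int [k..<N]) = map c [0..<N]"
proof (induction "N - k" arbitrary: k)
  case 0
  thus ?case by simp
next
  case (Suc j)
  hence k: "k < N" by simp
  have "eta_next (int m) t (rev (map c [0..<k])) (int k) = c k"
  proof (cases "k \<le> m")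
    case True
    thus ?thesis using below lead by (auto simp: eta_next_def)
  next
    case False
    have "sum_list (map2 (*) t (rev (map c [0..<k]))) = (\<Sum>i<k. t ! i * rev (map c [0..<k]) ! i)"
      using k t by (subst sum_list_map2_nth) auto
    also have "\<dots> = (\<Sum>i<k. \<tau> (Suc i) * c (k - Suc i))"
      using k t by (intro sum.cong) (auto simp: rev_nth)
    also have "\<dots> = (\<Sum>i=1..k. \<tau> i * c (k - i))"
      by (rule sum.reindex_bij_witness[of _ "\<lambda>i. i - 1" Suc]) auto
    also have "\<dots> = (int k - int m) * c k" by (rule rec [symmetric])
    finally show ?thesis using False by (simp add: eta_next_def)
  qed
  hence "eta_run (int m) t (rev (map c [0..<k])) (map int [k..<N]) =
         eta_run (int m) t (rev (map c [0..<Suc k])) (map int [Suc k..<N])"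
    using k by (simp add: upt_conv_Cons)
  also have "\<dots> = map c [0..<N]"
    using Suc.hyps(1)[of "Suc k"] Suc.hyps(2) k by simp
  finally show ?case .
qed

lemma eta_list_nth:
  assumes k: "k \<in> {1..20}" and n: "n < 33"
  shows "length (eta_list (map (quot_list (sigma_list 1)) level_divisors) (eta_data ! (k - 1))) = 33 \<and>
    eta_list (map (quot_list (sigma_list 1)) level_divisors) (eta_data ! (k - 1)) ! n = eta_coeff k n"
proof -
  define S where "S = map (quot_list (sigma_list 1)) level_divisors"
  define x where "x = fst (eta_data ! (k - 1))"
  have mem: "eta_data ! (k - 1) \<in> set eta_data" using k by (intro nth_mem) (auto simp: length_eta_data)
  have one: "1 \<in> set level_divisors" by (simp add: level_divisors_def)
  have "map (cusp_order 1) level_divisors = level_divisors" by (simp add: cusp_order_def level_divisors_def)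
  hence w: "dot x level_divisors mod 24 = 0" "dot x level_divisors \<ge> 0"
    using width_check_holds[OF one mem] by (simp_all add: width_check_def x_def)
  define m where "m = nat (dot x level_divisors div 24)"
  have m: "dot x level_divisors = 24 * int m" "dot x level_divisors div 24 = int m"
    using w by (auto simp: m_def)
  define L where "L = lincomb (map2 (*) x level_divisors) S"
  have len: "length L = 33" and nth: "\<And>i. i < 33 \<Longrightarrow> L ! i = sum_list (map2 (\<lambda>c l. c * l ! i) (map2 (*) x level_divisors) S)"
  proof -
    have "length l = 33" if "l \<in> set S" for l using that by (auto simp: S_def)
    from lincomb_nth[OF this, of S "map2 (*) x level_divisors"]
    show "length L = 33" "\<And>i. i < 33 \<Longrightarrow> L ! i = sum_list (map2 (\<lambda>c l. c * l ! i) (map2 (*) x level_divisors) S)"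
      unfolding L_def by blast+
  qed
  have L: "L ! i = - eta_tau x i" if "i < 33" for i
  proof -
    have "sum_list (map2 (\<lambda>c l. c * l ! i) (map2 (*) x ds) (map (quot_list (sigma_list 1)) ds)) =
          sum_list (map2 (\<lambda>\<delta> k. k * \<delta> * sigma_quot 1 \<delta> i) ds x)" if "\<And>\<delta>. \<delta> \<in> set ds \<Longrightarrow> \<delta> > 0" for ds
      using that \<open>i < 33\<close> by (induction ds x rule: list_induct2') (simp_all add: quot_list_nth)
    thus ?thesis unfolding nth[OF that] S_def eta_tau_def by (simp add: level_divisors_pos)
  qed
  have "eta_list S (eta_data ! (k - 1)) = eta_run (int m) (map uminus (tl L)) (rev (map (eta_coeff k) [0..<0])) (map int [0..<33])"
    unfolding eta_list_def x_def [symmetric] L_def [symmetric] m(2) upto_32 by simp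
  also have "\<dots> = map (eta_coeff k) [0..<33]"
  proof (rule eta_run_correct[where \<tau> = "eta_tau x"])
    show "(int n - int m) * eta_coeff k n = (\<Sum>i=1..n. eta_tau x i * eta_coeff k (n - i))" for n
      by (rule eta_coeff_recurrence[OF k x_def m(1)])
    show "eta_coeff k n = 0" if "n < m" for n using eta_coeff_below_order[OF k x_def m(1)] that by simp
    show "eta_coeff k m = 1" by (rule eta_coeff_leading[OF k x_def m(1)])
    show "map uminus (tl L) ! i = eta_tau x (Suc i)" if "i < length (map uminus (tl L))" for i
      using that len L by (simp add: nth_tl)
  qed (use len in simp_all)
  finally show ?thesis using n by (simp add: S_def)
qed

section \<open>The identities\<close>
text \<open>42000 times the difference of the two sides of an identity. The common denominator keeps the
computation in the integers; the coefficients of \<open>\<sigma>\<^sub>3(n/\<delta>)\<close> are \<open>7 \<delta>^2 / 42000\<close> in all four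
identities, and those of \<open>n \<sigma>(n/r)\<close> and \<open>n \<sigma>(n/s)\<close> are \<open>-1/(4 s)\<close> and \<open>-1/(4 r)\<close>.\<close>
definition residual :: "int \<Rightarrow> int \<Rightarrow> int list \<Rightarrow> nat \<Rightarrow> int" where
  "residual r s g n = 42000 * sigma_conv r s n
     - (1750 - 10500 div s * int n) * sigma_quot 1 r n - (1750 - 10500 div r * int n) * sigma_quot 1 s n
     - (\<Sum>\<delta>\<in>set level_divisors. 7 * \<delta> ^ 2 * sigma_quot 3 \<delta> n)
     - sum_list (map2 (\<lambda>k c. c * eta_coeff k n) [1..<21] g)"

lemma distinct_level_divisors: "distinct level_divisors"
  by (simp add: level_divisors_def)

lemma map2_map_left: "map2 f (map h xs) ys = map2 (\<lambda>x. f (h x)) xs ys"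
  by (simp add: zip_map1 case_prod_unfold comp_def)

lemma eta_data_enum: "eta_data = map (\<lambda>k. eta_data ! (k - 1)) [1..<21]"
  by (rule nth_equalityI) (simp_all add: length_eta_data)

lemma identity_dataD:
  assumes "(r, s, g) \<in> set identity_data"
  shows "r \<in> set level_divisors" "s \<in> set level_divisors" "length g = 20"
  using assms by (auto simp: identity_data_def level_divisors_def)

lemma residual_vanishes_initially:
  assumes p: "(r, s, g) \<in> set identity_data" and n: "n < 33"
  shows "residual r s g n = 0"
proof -
  define T where "T = sigma_list 1"
  define S where "S = map (quot_list (sigma_list 3)) level_divisors"
  define E where "E = map (eta_list (map (quot_list T) level_divisors)) eta_data"
  note rs = identity_dataD[OF p]
  have pos: "r > 0" "s > 0" using rs level_divisors_pos by auto
  define A where "A = quot_list T r"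
  define B where "B = quot_list T s"
  have A: "A ! i = sigma_quot 1 r i" and B: "B ! i = sigma_quot 1 s i" if "i < 33" for i
    unfolding A_def B_def T_def using that pos by (simp_all add: quot_list_nth)
  have lAB: "length A = 33" "length B = 33" by (simp_all add: A_def B_def)
  have conv: "conv_run A [] B ! n = sigma_conv r s n"
  proof -
    have "conv_run A [] B ! n = (\<Sum>i\<le>n. A ! i * B ! (n - i))"
      using conv_run_nth[of 0 n B A] lAB n by simp
    also have "\<dots> = sigma_conv r s n" unfolding sigma_conv_def using n by (intro sum.cong) (auto simp: A B)
    finally show ?thesis .
  qed
  have lE: "length l = 33" if lI: "l \<in> set E" for l
  proof -
    obtain xt where xt: "xt \<in> set eta_data" "l = eta_list (map (quot_list T) level_divisors) xt"
      using lI by (auto simp: E_def)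
    then obtain i where "i < 20" "xt = eta_data ! i" by (metis in_set_conv_nth length_eta_data)
    thus ?thesis using eta_list_nth[of "Suc i" 0] xt by (simp add: T_def)
  qed
  have l5: "length l = 33"
    if "l \<in> set ([conv_run A [] B, A, B, map2 (*) [0..32] A, map2 (*) [0..32] B] @ S @ E)" for l
    using that lAB lE by (auto simp: length_conv_run S_def)
  have "residual_list T S E (r, s, g) ! n = 0"
  proof -
    have "residual_ok T S E (r, s, g)"
      using residual_check p unfolding list_all_iff T_def S_def E_def by blast
    thus ?thesis using n unfolding residual_ok_def by simp
  qed
  also have "residual_list T S E (r, s, g) ! n = sum_list (map2 (\<lambda>c l. c * l ! n)
      ([42000, - 1750, - 1750, 10500 div s, 10500 div r] @ map (\<lambda>\<delta>. - 7 * \<delta> * \<delta>) level_divisors @ map uminus g)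
       ([conv_run A [] B, A, B, map2 (*) [0..32] A, map2 (*) [0..32] B] @ S @ E))"
    unfolding residual_list_def prod.case A_def [symmetric] B_def [symmetric]
    using lincomb_nth[OF l5] n by blast
  also have "\<dots> = 42000 * sigma_conv r s n - 1750 * sigma_quot 1 r n - 1750 * sigma_quot 1 s n
      + 10500 div s * (int n * sigma_quot 1 r n) + 10500 div r * (int n * sigma_quot 1 s n)
      + sum_list (map2 (\<lambda>c l. c * l ! n) (map (\<lambda>\<delta>. - 7 * \<delta> * \<delta>) level_divisors) S)
      + sum_list (map2 (\<lambda>c l. c * l ! n) (map uminus g) E)"
    using conv n lAB by (simp add: A B upto_32 S_def)
  also have "sum_list (map2 (\<lambda>c l. c * l ! n) (map (\<lambda>\<delta>. - 7 * \<delta> * \<delta>) level_divisors) S) =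
      - (\<Sum>\<delta>\<in>set level_divisors. 7 * \<delta> ^ 2 * sigma_quot 3 \<delta> n)"
  proof -
    have "sum_list (map2 (\<lambda>c l. c * l ! n) (map (\<lambda>\<delta>. - 7 * \<delta> * \<delta>) ds) (map (quot_list (sigma_list 3)) ds)) =
        - sum_list (map (\<lambda>\<delta>. 7 * \<delta> ^ 2 * sigma_quot 3 \<delta> n) ds)" if "\<And>\<delta>. \<delta> \<in> set ds \<Longrightarrow> \<delta> > 0" for ds
      using that n by (induction ds) (simp_all add: quot_list_nth power2_eq_square algebra_simps)
    thus ?thesis
      unfolding S_def by (simp add: level_divisors_pos sum_list_distinct_conv_sum_set[OF distinct_level_divisors])
  qed
  also have "sum_list (map2 (\<lambda>c l. c * l ! n) (map uminus g) E) = - sum_list (map2 (\<lambda>k c. c * eta_coeff k n) [1..<21] g)"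
  proof -
    have "sum_list (map2 (\<lambda>c l. c * l ! n) (map uminus g) (map (eta_list (map (quot_list T) level_divisors)) (map (\<lambda>k. eta_data ! (k - 1)) ks))) =
        - sum_list (map2 (\<lambda>k c. c * eta_coeff k n) ks g)" if "\<And>k. k \<in> set ks \<Longrightarrow> k \<in> {1..20}" for ks
      using that
    proof (induction ks g rule: list_induct2')
      case (4 k ks c g)
      have "eta_list (map (quot_list T) level_divisors) (eta_data ! (k - 1)) ! n = eta_coeff k n"
        using eta_list_nth[of k n] n 4 unfolding T_def by auto
      thus ?case using 4 by simp
    qed simp_all
    from this[of "[1..<21]"] show ?thesis unfolding E_def eta_data_enum [symmetric] by simp
  qed
  finally show ?thesis by (simp add: residual_def algebra_simps)
qed

text \<open>For \<open>n \<ge> 1\<close> the residual is 42000 times a coefficient of a form \<open>F\<close> of level 42, whose constant term is 0 as well.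
Since the residual is 0 for \<open>n < 33\<close>, the form vanishes to order 33 and is therefore 0.\<close>
theorem residual_vanishes:
  assumes p: "(r, s, g) \<in> set identity_data" and "n \<ge> 1"
  shows "residual r s g n = 0"
proof -
  note rs = identity_dataD[OF p]
  have pos: "r > 0" "s > 0" using rs level_divisors_pos by auto
  \<comment> \<open>The cross term of the square contributes \<open>- 2 \<alpha> r s \<cdot> 576 W\<close>, whence the value of \<open>\<alpha>\<close>. The two
      squares contain \<open>\<alpha> r^2 E4(r z)\<close> and \<open>\<alpha> s^2 E4(s z)\<close>, which the last term of \<open>b\<close> cancels; the
      remaining \<open>-1/1440000\<close> equals \<open>-7/(240 \<cdot> 42000)\<close> and accounts for the \<open>\<sigma>\<^sub>3\<close>.\<close>
  define \<alpha> :: complex where "\<alpha> = - 1 / (1152 * of_int r * of_int s)"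
  define b :: "int \<Rightarrow> complex" where "b = (\<lambda>\<delta>. - 1 / 1440000 - \<alpha> * ((if \<delta> = r then 1 else 0) + (if \<delta> = s then 1 else 0)))"
  define h :: "int \<Rightarrow> complex" where "h = (\<lambda>c. - of_int c / 42000)"
  define q where "q = (\<lambda>\<delta>. fps_const (of_int \<delta> ^ 2) * fps_dilate (nat \<delta>) E4_fps)"
  define F where "F = fps_const \<alpha> * (eis_fps r - eis_fps s) ^ 2
     + sum_list (map2 (\<lambda>\<delta> b. fps_const b * q \<delta>) level_divisors (map b level_divisors))
     + sum_list (map2 (\<lambda>k c. fps_const c * eta_fps k) [1..<21] (map h g))"
  define f where "f = form_at r s \<alpha> (map b level_divisors) (map h g) 1 0"
  have qf: "qexp f F"
  proof -
    have "f = (\<lambda>z. \<alpha> * (eis_at r 1 0 z - eis_at s 1 0 z) ^ 2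
        + sum_list (map2 (\<lambda>\<delta> b. b * quad_at \<delta> 1 0 z) level_divisors (map b level_divisors))
        + sum_list (map2 (\<lambda>k c. c * eta_form_at (eta_data ! (k - 1)) 1 0 z) [1..<21] (map h g)))"
      unfolding f_def form_at_def by (subst eta_data_enum) (simp only: map2_map_left)
    moreover have "qexp \<dots> F"
      unfolding F_def q_def
      by (intro qexp_add qexp_cmult qexp_power qexp_diff qexp_sum_list_map2 qexp_eis_at qexp_quad_at qexp_eta_form pos level_divisors_pos) auto
    ultimately show ?thesis by simp
  qed
  have sumb: "fps_nth (sum_list (map2 (\<lambda>\<delta> b. fps_const b * q \<delta>) level_divisors (map b level_divisors))) n =
      - (1 / 1440000) * (\<Sum>\<delta>\<in>set level_divisors. fps_nth (q \<delta>) n) - \<alpha> * (fps_nth (q r) n + fps_nth (q s) n)" for n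
  proof -
    have "sum_list (map2 (\<lambda>\<delta> b. b * fps_nth (q \<delta>) n) ds (map b ds)) = sum_list (map (\<lambda>\<delta>. b \<delta> * fps_nth (q \<delta>) n) ds)" for ds
      by (induction ds) simp_all
    hence "fps_nth (sum_list (map2 (\<lambda>\<delta> b. fps_const b * q \<delta>) level_divisors (map b level_divisors))) n =
        (\<Sum>\<delta>\<in>set level_divisors. b \<delta> * fps_nth (q \<delta>) n)"
      unfolding fps_nth_sum_list_map2 by (simp add: sum_list_distinct_conv_sum_set[OF distinct_level_divisors])
    also have "\<dots> = (\<Sum>\<delta>\<in>set level_divisors. - (1 / 1440000) * fps_nth (q \<delta>) n
        - \<alpha> * ((if \<delta> = r then fps_nth (q \<delta>) n else 0) + (if \<delta> = s then fps_nth (q \<delta>) n else 0)))"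
      by (intro sum.cong) (auto simp: b_def algebra_simps)
    also have "\<dots> = - (1 / 1440000) * (\<Sum>\<delta>\<in>set level_divisors. fps_nth (q \<delta>) n) - \<alpha> * (fps_nth (q r) n + fps_nth (q s) n)"
      using rs by (simp add: sum_subtractf sum.distrib sum_negf flip: sum_distrib_left sum_divide_distrib)
    finally show ?thesis .
  qed
  have sumh: "fps_nth (sum_list (map2 (\<lambda>k c. fps_const c * eta_fps k) [1..<21] (map h g))) n =
      - of_int (sum_list (map2 (\<lambda>k c. c * eta_coeff k n) [1..<21] g)) / 42000" for n
  proof -
    have "sum_list (map2 (\<lambda>k c. c * fps_nth (eta_fps k) n) ks (map h g)) = - of_int (sum_list (map2 (\<lambda>k c. c * eta_coeff k n) ks g)) / 42000" for ks
      by (induction ks g rule: list_induct2') (simp_all add: h_def eta_fps_def field_simps)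
    thus ?thesis unfolding fps_nth_sum_list_map2 .
  qed
  have sq: "fps_nth ((eis_fps r - eis_fps s) ^ 2) n = fps_nth (eis_fps r ^ 2) n + fps_nth (eis_fps s ^ 2) n - 2 * fps_nth (eis_fps r * eis_fps s) n" for n
  proof -
    have "(eis_fps r - eis_fps s) ^ 2 = eis_fps r ^ 2 + eis_fps s ^ 2 - fps_const 2 * (eis_fps r * eis_fps s)"
      by (simp add: power2_eq_square algebra_simps flip: numeral_fps_const) 
    thus ?thesis by (simp add: fps_mult_left_const_nth)
  qed
  have div: "of_int (10500 div d) = (10500 / of_int d :: complex)" if "d \<in> set level_divisors" for d
    using that by (auto simp: level_divisors_def)
  have F0: "fps_nth F 0 = 0"
  proof -
    have e0: "eta_coeff k 0 = 0" if "k \<in> {1..20}" for k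
      using has_q_expansion_eta_coeff[OF that] by (simp add: has_q_expansion_def)
    have "sum_list (map2 (\<lambda>k c. c * eta_coeff k 0) [1..<21] g) = sum_list (map2 (\<lambda>k c. 0) [1..<21] g)"
      by (intro sum_list_map2_cong) (simp add: e0)
    also have "\<dots> = 0" by (induction g) (simp_all add: case_prod_unfold)
    finally have h0: "sum_list (map2 (\<lambda>k c. c * eta_coeff k 0) [1..<21] g) = 0" .
    have q0: "fps_nth (q \<delta>) 0 = of_int \<delta> ^ 2" if "\<delta> > 0" for \<delta>
      unfolding q_def quad_fps_nth[OF that] by simp
    have "(\<Sum>\<delta>\<in>set level_divisors. fps_nth (q \<delta>) 0) = (\<Sum>\<delta>\<in>set level_divisors. of_int \<delta> ^ 2)"
      by (intro sum.cong) (simp_all add: q0 level_divisors_pos)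
    \<comment> \<open>The sum of the squares of the divisors of 42, matching \<open>2500/1440000 = 1/576\<close>.\<close>
    also have "\<dots> = 2500" by (simp add: level_divisors_def)
    finally have q2500: "(\<Sum>\<delta>\<in>set level_divisors. fps_nth (q \<delta>) 0) = 2500" .
    have "fps_nth F 0 = \<alpha> * (of_int r ^ 2 + of_int s ^ 2 - 2 * (of_int r * of_int s)) - 2500 / 1440000 - \<alpha> * (of_int r ^ 2 + of_int s ^ 2)"
      unfolding F_def fps_add_nth fps_mult_left_const_nth sumb sumh sq h0 q2500
        eis_fps_square_nth[OF pos(1)] eis_fps_square_nth[OF pos(2)] eis_fps_product_nth[OF pos] q0[OF pos(1)] q0[OF pos(2)] by simp
    also have "\<dots> = - 2 * \<alpha> * (of_int r * of_int s) - 1 / 576"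
      by (simp add: algebra_simps)
    also have "\<dots> = 0" using pos by (simp add: \<alpha>_def)
    finally show ?thesis .
  qed
  have Fn: "42000 * fps_nth F n = of_int (residual r s g n)" if "n \<ge> 1" for n
  proof -
    have qn: "fps_nth (q \<delta>) n = 240 * of_int \<delta> ^ 2 * of_int (sigma_quot 3 \<delta> n)" if "\<delta> > 0" for \<delta>
      unfolding q_def quad_fps_nth[OF that] using \<open>n \<ge> 1\<close> by simp
    have qs: "(\<Sum>\<delta>\<in>set level_divisors. fps_nth (q \<delta>) n) = 240 / 7 * of_int (\<Sum>\<delta>\<in>set level_divisors. 7 * \<delta> ^ 2 * sigma_quot 3 \<delta> n)"
      unfolding of_int_sum sum_distrib_left by (intro sum.cong) (simp_all add: qn level_divisors_pos)
    define W U V Z where "W = (of_int (sigma_conv r s n) :: complex)"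
      and "U = (of_int (sigma_quot 1 r n) :: complex)" and "V = (of_int (sigma_quot 1 s n) :: complex)"
      and "Z = (of_int (sum_list (map2 (\<lambda>k c. c * eta_coeff k n) [1..<21] g)) :: complex)"
    define Y where "Y = (of_int (\<Sum>\<delta>\<in>set level_divisors. 7 * \<delta> ^ 2 * sigma_quot 3 \<delta> n) :: complex)"
    define R S where "R = (of_int r :: complex)" and "S = (of_int s :: complex)"
    have nz: "R \<noteq> 0" "S \<noteq> 0" using pos by (simp_all add: R_def S_def)
    define P Q where "P = of_nat n * U / S" and "Q = of_nat n * V / R"
    have "fps_nth F n = \<alpha> * (- 288 * R * of_nat n * U - 288 * S * of_nat n * V - 2 * (R * S * (576 * W - 24 * U - 24 * V)))
        - Y / 42000 - Z / 42000"
      unfolding F_def fps_add_nth fps_mult_left_const_nth sumb sumh sq qs Y_def [symmetric]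
        eis_fps_square_nth[OF pos(1)] eis_fps_square_nth[OF pos(2)] eis_fps_product_nth[OF pos] qn[OF pos(1)] qn[OF pos(2)]
        W_def [symmetric] U_def [symmetric] V_def [symmetric] Z_def [symmetric] R_def [symmetric] S_def [symmetric]
      using that by (simp add: algebra_simps)
    also have "\<alpha> * (- 288 * R * of_nat n * U - 288 * S * of_nat n * V - 2 * (R * S * (576 * W - 24 * U - 24 * V))) =
        W - U / 24 - V / 24 + P / 4 + Q / 4"
      unfolding P_def Q_def \<alpha>_def R_def [symmetric] S_def [symmetric] using nz by (simp add: field_simps)
    finally have Feq: "fps_nth F n = W - U / 24 - V / 24 + P / 4 + Q / 4 - Y / 42000 - Z / 42000" .
    have "42000 * fps_nth F n = 42000 * W - 1750 * U - 1750 * V + 10500 * P + 10500 * Q - Y - Z"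
      unfolding Feq by (simp add: algebra_simps)
    also have "\<dots> = 42000 * W - (1750 - 10500 / S * of_nat n) * U - (1750 - 10500 / R * of_nat n) * V - Y - Z"
      by (simp add: P_def Q_def algebra_simps)
    also have "\<dots> = of_int (residual r s g n)"
      unfolding residual_def of_int_diff of_int_mult div[OF rs(1)] div[OF rs(2)]
        W_def U_def V_def Z_def Y_def R_def S_def by simp
    finally show ?thesis .
  qed
  have "fps_nth F n = 0" if "n < 33" for n
  proof (cases "n = 0")
    case False
    thus ?thesis using Fn[of n] residual_vanishes_initially[OF p that] by simp
  qed (simp add: F0)
  hence "f \<in> O[at_i_infinity](\<lambda>z. nome z ^ 33)"
    by (intro qexp_order_bound[OF qf])
  hence "f z = 0" if "Im z > 0" for z
    unfolding f_def using rs that by (intro form_at_vanishes)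
  hence "F = 0" by (rule qexp_zero_iff[OF qf])
  thus ?thesis using Fn[OF \<open>n \<ge> 1\<close>] by simp
qed

lemma sigma_quot_rat: "d > 0 \<Longrightarrow> rat_of_int (sigma_quot k d n) = rat_of_nat (divisor_sigma k (rat_of_nat n / rat_of_int d))"
  by (metis divisor_sigma_quotient of_int_of_nat_eq)

theorem theorem7:
  fixes n :: nat
  assumes "n \<ge> 1"
  shows
   "(rat_of_nat (conv_W 1 42 n) =
        1 / 6000 * rat_of_nat (divisor_sigma 3 (rat_of_nat n))
      + 1 / 1500 * rat_of_nat (divisor_sigma 3 (rat_of_nat n / 2))
      + 3 / 2000 * rat_of_nat (divisor_sigma 3 (rat_of_nat n / 3))
      + 3 / 500 * rat_of_nat (divisor_sigma 3 (rat_of_nat n / 6))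
      + 49 / 6000 * rat_of_nat (divisor_sigma 3 (rat_of_nat n / 7))
      + 49 / 1500 * rat_of_nat (divisor_sigma 3 (rat_of_nat n / 14))
      + 147 / 2000 * rat_of_nat (divisor_sigma 3 (rat_of_nat n / 21))
      + 147 / 500 * rat_of_nat (divisor_sigma 3 (rat_of_nat n / 42))
      + (1 / 24 - rat_of_nat n / 168) * rat_of_nat (divisor_sigma 1 (rat_of_nat n))
      + (1 / 24 - rat_of_nat n / 4) * rat_of_nat (divisor_sigma 1 (rat_of_nat n / 42))
      - 1 / 35 * rat_of_int (eta_coeff 1 n)
      - 57 / 2800 * rat_of_int (eta_coeff 2 n)
      - 1 / 140 * rat_of_int (eta_coeff 4 n)
      - 1 / 6000 * rat_of_int (eta_coeff 5 n)
      + 49 / 40 * rat_of_int (eta_coeff 6 n)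
      - 883 / 200 * rat_of_int (eta_coeff 7 n)
      + 2051 / 6000 * rat_of_int (eta_coeff 8 n)
      + 17 / 120 * rat_of_int (eta_coeff 9 n)
      - 97 / 50 * rat_of_int (eta_coeff 10 n)
      + 543 / 40 * rat_of_int (eta_coeff 11 n)
      - 127 / 150 * rat_of_int (eta_coeff 12 n)
      + 31 / 60 * rat_of_int (eta_coeff 13 n)
      - 27 / 10 * rat_of_int (eta_coeff 14 n)
      - 1 / 5 * rat_of_int (eta_coeff 15 n)
      + 43 / 20 * rat_of_int (eta_coeff 16 n)
      - 9 / 10 * rat_of_int (eta_coeff 18 n)
      - 9 / 400 * rat_of_int (eta_coeff 19 n)
      - 3 / 20 * rat_of_int (eta_coeff 20 n))
    \<and>
    (rat_of_nat (conv_W 2 21 n) =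
        1 / 6000 * rat_of_nat (divisor_sigma 3 (rat_of_nat n))
      + 1 / 1500 * rat_of_nat (divisor_sigma 3 (rat_of_nat n / 2))
      + 3 / 2000 * rat_of_nat (divisor_sigma 3 (rat_of_nat n / 3))
      + 3 / 500 * rat_of_nat (divisor_sigma 3 (rat_of_nat n / 6))
      + 49 / 6000 * rat_of_nat (divisor_sigma 3 (rat_of_nat n / 7))
      + 49 / 1500 * rat_of_nat (divisor_sigma 3 (rat_of_nat n / 14))
      + 147 / 2000 * rat_of_nat (divisor_sigma 3 (rat_of_nat n / 21))
      + 147 / 500 * rat_of_nat (divisor_sigma 3 (rat_of_nat n / 42))
      + (1 / 24 - rat_of_nat n / 84) * rat_of_nat (divisor_sigma 1 (rat_of_nat n / 2))
      + (1 / 24 - rat_of_nat n / 8) * rat_of_nat (divisor_sigma 1 (rat_of_nat n / 21))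
      - 1 / 70 * rat_of_int (eta_coeff 1 n)
      - 57 / 2800 * rat_of_int (eta_coeff 2 n)
      - 1 / 28 * rat_of_int (eta_coeff 3 n)
      + 1 / 70 * rat_of_int (eta_coeff 4 n)
      - 1 / 6000 * rat_of_int (eta_coeff 5 n)
      + 13 / 8 * rat_of_int (eta_coeff 6 n)
      - 703 / 200 * rat_of_int (eta_coeff 7 n)
      - 4249 / 6000 * rat_of_int (eta_coeff 8 n)
      + 41 / 120 * rat_of_int (eta_coeff 9 n)
      - 97 / 50 * rat_of_int (eta_coeff 10 n)
      + 379 / 40 * rat_of_int (eta_coeff 11 n)
      - 61 / 75 * rat_of_int (eta_coeff 12 n)
      + 11 / 20 * rat_of_int (eta_coeff 13 n)
      - 18 / 5 * rat_of_int (eta_coeff 14 n)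
      - 1 / 10 * rat_of_int (eta_coeff 15 n)
      + 39 / 20 * rat_of_int (eta_coeff 16 n)
      + 3 / 10 * rat_of_int (eta_coeff 18 n)
      - 9 / 400 * rat_of_int (eta_coeff 19 n)
      - 9 / 20 * rat_of_int (eta_coeff 20 n))
    \<and>
    (rat_of_nat (conv_W 3 14 n) =
        1 / 6000 * rat_of_nat (divisor_sigma 3 (rat_of_nat n))
      + 1 / 1500 * rat_of_nat (divisor_sigma 3 (rat_of_nat n / 2))
      + 3 / 2000 * rat_of_nat (divisor_sigma 3 (rat_of_nat n / 3))
      + 3 / 500 * rat_of_nat (divisor_sigma 3 (rat_of_nat n / 6))
      + 49 / 6000 * rat_of_nat (divisor_sigma 3 (rat_of_nat n / 7))
      + 49 / 1500 * rat_of_nat (divisor_sigma 3 (rat_of_nat n / 14))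
      + 147 / 2000 * rat_of_nat (divisor_sigma 3 (rat_of_nat n / 21))
      + 147 / 500 * rat_of_nat (divisor_sigma 3 (rat_of_nat n / 42))
      + (1 / 24 - rat_of_nat n / 56) * rat_of_nat (divisor_sigma 1 (rat_of_nat n / 3))
      + (1 / 24 - rat_of_nat n / 12) * rat_of_nat (divisor_sigma 1 (rat_of_nat n / 14))
      + 1 / 35 * rat_of_int (eta_coeff 1 n)
      - 1 / 400 * rat_of_int (eta_coeff 2 n)
      - 1 / 35 * rat_of_int (eta_coeff 4 n)
      - 1 / 6000 * rat_of_int (eta_coeff 5 n)
      - 37 / 40 * rat_of_int (eta_coeff 6 n)
      + 837 / 200 * rat_of_int (eta_coeff 7 n)
      - 2149 / 6000 * rat_of_int (eta_coeff 8 n)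
      - 17 / 120 * rat_of_int (eta_coeff 9 n)
      + 103 / 50 * rat_of_int (eta_coeff 10 n)
      - 543 / 40 * rat_of_int (eta_coeff 11 n)
      + 87 / 100 * rat_of_int (eta_coeff 12 n)
      - 31 / 60 * rat_of_int (eta_coeff 13 n)
      + 27 / 10 * rat_of_int (eta_coeff 14 n)
      + 1 / 5 * rat_of_int (eta_coeff 15 n)
      - 43 / 20 * rat_of_int (eta_coeff 16 n)
      - 9 / 28 * rat_of_int (eta_coeff 17 n)
      + 9 / 10 * rat_of_int (eta_coeff 18 n)
      - 513 / 2800 * rat_of_int (eta_coeff 19 n)
      + 3 / 20 * rat_of_int (eta_coeff 20 n))
    \<and>
    (rat_of_nat (conv_W 6 7 n) =
        1 / 6000 * rat_of_nat (divisor_sigma 3 (rat_of_nat n))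
      + 1 / 1500 * rat_of_nat (divisor_sigma 3 (rat_of_nat n / 2))
      + 3 / 2000 * rat_of_nat (divisor_sigma 3 (rat_of_nat n / 3))
      + 3 / 500 * rat_of_nat (divisor_sigma 3 (rat_of_nat n / 6))
      + 49 / 6000 * rat_of_nat (divisor_sigma 3 (rat_of_nat n / 7))
      + 49 / 1500 * rat_of_nat (divisor_sigma 3 (rat_of_nat n / 14))
      + 147 / 2000 * rat_of_nat (divisor_sigma 3 (rat_of_nat n / 21))
      + 147 / 500 * rat_of_nat (divisor_sigma 3 (rat_of_nat n / 42))
      + (1 / 24 - rat_of_nat n / 28) * rat_of_nat (divisor_sigma 1 (rat_of_nat n / 6))
      + (1 / 24 - rat_of_nat n / 24) * rat_of_nat (divisor_sigma 1 (rat_of_nat n / 7))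
      + 1 / 70 * rat_of_int (eta_coeff 1 n)
      - 407 / 2800 * rat_of_int (eta_coeff 2 n)
      + 1 / 28 * rat_of_int (eta_coeff 3 n)
      + 3 / 140 * rat_of_int (eta_coeff 4 n)
      - 1507 / 42000 * rat_of_int (eta_coeff 5 n)
      - 53 / 40 * rat_of_int (eta_coeff 6 n)
      + 6899 / 1400 * rat_of_int (eta_coeff 7 n)
      - 6349 / 6000 * rat_of_int (eta_coeff 8 n)
      - 41 / 120 * rat_of_int (eta_coeff 9 n)
      + 221 / 350 * rat_of_int (eta_coeff 10 n)
      - 379 / 40 * rat_of_int (eta_coeff 11 n)
      + 969 / 700 * rat_of_int (eta_coeff 12 n)
      - 11 / 20 * rat_of_int (eta_coeff 13 n)
      + 18 / 5 * rat_of_int (eta_coeff 14 n)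
      + 1 / 10 * rat_of_int (eta_coeff 15 n)
      - 39 / 20 * rat_of_int (eta_coeff 16 n)
      + 9 / 28 * rat_of_int (eta_coeff 17 n)
      - 3 / 10 * rat_of_int (eta_coeff 18 n)
      - 4113 / 2800 * rat_of_int (eta_coeff 19 n)
      + 9 / 20 * rat_of_int (eta_coeff 20 n))"
proof -
  have R: "0 = (case identity_data ! i of (r, s, g) \<Rightarrow> rat_of_int (residual r s g n))" if "i < 4" for i
  proof -
    have "identity_data ! i \<in> set identity_data" using that by (intro nth_mem) (simp add: identity_data_def)
    thus ?thesis using residual_vanishes assms by (auto split: prod.splits)
  qed
  have W: "rat_of_int (sigma_conv (int r) (int s) n) = rat_of_nat (conv_W r s n)" if "r > 0" "s > 0" for r s
    unfolding conv_W_eq_sigma_conv[OF that, symmetric] by simp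
  note W' = W[of 1 42, simplified] W[of 2 21, simplified] W[of 3 14, simplified] W[of 6 7, simplified]
  have quot: "rat_of_int (sigma_quot k 1 n) = rat_of_nat (divisor_sigma k (rat_of_nat n))"
    "rat_of_int (sigma_quot k (numeral d) n) = rat_of_nat (divisor_sigma k (rat_of_nat n / numeral d))" for k d
    using sigma_quot_rat[of 1 k n] sigma_quot_rat[of "numeral d" k n] by simp_all
  have upt: "[Suc 0..<21] = [1, 2, 3, 4, 5, 6, 7, 8, 9, 10, 11, 12, 13, 14, 15, 16, 17, 18, 19, 20 :: nat]"
    by (simp add: upt_rec)
  note eqs = identity_data_def residual_def level_divisors_def upt
  note norm = left_diff_distrib right_diff_distrib distrib_left distrib_right times_divide_eq_left mult.assoc
  show ?thesis
  proof (intro conjI, goal_cases)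
    case 1
    show ?case using R[of 0] by (simp add: eqs quot W' norm)
  next
    case 2
    show ?case using R[of 1] by (simp add: eqs quot W' norm)
  next
    case 3
    show ?case using R[of 2] by (simp add: eqs quot W' norm)
  next
    case 4
    show ?case using R[of 3] by (simp add: eqs quot W' norm)
  qed
qed

end
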